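(* Let $n\ge 2$, let $(M^n,g)$ be an $n$-dimensional compact oriented conformally flat Riemannian manifold with boundary and $\boldsymbol{p}:M^n\to\Lambda^{n+1}$ an isometric immersion. Let $F:(-\varepsilon,\varepsilon)\times M^n\to\mathbb{R}^{n+2}_1$ be an admissible variation of $\boldsymbol{p}$ with fixed boundary. If the scalar curvature $S$ of $(M^n,g)$ is identically zero, then the second variation of the volume is given by \[\left.\frac{d^2}{dt^2}\right|_{t=0}\mathrm{Vol}(t)=\int_{M^n}\Bigl(-\langle X,\boldsymbol{p}\rangle^2\,\mathrm{tr}(A^2)+n\,\langle\overline{\nabla}_t\overline{X},\boldsymbol{q}\rangle\Bigr)dV_0,\] where $A$ is the shape operator of $\boldsymbol{p}$, $\boldsymbol{q}$ is the dual map of $\boldsymbol{p}$, and $X$ and $\overline{X}$ are the variational vector field and the extended variational vector field of $F$, respectively.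
   Context: $\mathbb{R}^{n+2}_1$ is the Minkowski spacetime of signature $(-,+,\dots,+)$ with Lorentzian inner product $\langle\cdot,\cdot\rangle$ and Levi-Civita (flat) connection $\overline{\nabla}$, and $\Lambda^{n+1}=\{\boldsymbol{x}\in\mathbb{R}^{n+2}_1 : \langle \boldsymbol{x},\boldsymbol{x}\rangle=0\}$ is the light-cone. An isometric immersion $\boldsymbol{p}:M^n\to\Lambda^{n+1}$ is a smooth immersion $\boldsymbol{p}:M^n\to\mathbb{R}^{n+2}_1$ with image in $\Lambda^{n+1}$ such that $\boldsymbol{p}^*\langle\cdot,\cdot\rangle=g$. Tangent vectors of $M^n$ are identified with vectors of $\mathbb{R}^{n+2}_1$ via $d\boldsymbol{p}$. Dual map: there is a unique smooth map $\boldsymbol{q}:M^n\to\Lambda^{n+1}$ with $\langle\boldsymbol{p},\boldsymbol{q}\rangle=1$ and $\langle d\boldsymbol{p}(Y),\boldsymbol{q}\rangle=0$ for all tangent vector fields $Y$ on $M^n$; it is called the dual map of $\boldsymbol{p}$. Shape operator: with $\mathrm{II}(Y,Z)=(\overline{\nabla}_YZ)^\perp$ the second fundamental form of $\boldsymbol{p}$ in $\mathbb{R}^{n+2}_1$ ($\perp$ = projection to the normal bundle), $A$ is the endomorphism of $TM^n$ defined by $\langle AY,Z\rangle=\langle \mathrm{II}(Y,Z),\boldsymbol{q}\rangle$. Variations: a variation of $\boldsymbol{p}$ is a smooth map $F:(-\varepsilon,\varepsilon)\times M^n\to\mathbb{R}^{n+2}_1$ ($\varepsilon>0$) such that $F(0,x)=\boldsymbol{p}(x)$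 and each $F(t,\cdot)$ is a spacelike immersion (the induced metric $g_t$ is Riemannian). It has fixed boundary if $F(t,x)=\boldsymbol{p}(x)$ for all $t$ and all $x\in\partial M^n$. $dV_t$ is the volume form of $(M^n,g_t)$ and $\mathrm{Vol}(t)=\int_{M^n}dV_t$. The extended variational vector field is $\overline{X}=\partial F/\partial t$ (a vector field along $F$), the variational vector field is $X=\frac{\partial}{\partial t}\big|_{t=0}F$, and $(\overline{\nabla}_t\overline{X})_x=\frac{\partial^2}{\partial t^2}\big|_{t=0}F(t,x)$. The variation $F$ is admissible if there is a real-valued function $\varphi$ on $M^n$ with $X=\varphi\,\boldsymbol{q}$. *)

theory Defs
  imports "HOL-Analysis.Analysis"
begin

section \<open>Smooth functions on subsets of Euclidean spaces\<close>

primrec C_k_on :: "nat \<Rightarrow> 'a::real_normed_vector set \<Rightarrow> ('a \<Rightarrow> 'b::real_normed_vector) \<Rightarrow> bool" where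
  "C_k_on 0 U f \<longleftrightarrow> continuous_on U f"
| "C_k_on (Suc k) U f \<longleftrightarrow>
     (\<forall>x\<in>U. f differentiable (at x)) \<and> (\<forall>v. C_k_on k U (\<lambda>x. frechet_derivative f (at x) v))"

text \<open>
  Smoothness on an arbitrary set means local extendability to a smooth function on an open set.
  This is the usual notion on relatively open subsets of a closed half-space.
\<close>

definition smooth_on :: "'a::real_normed_vector set \<Rightarrow> ('a \<Rightarrow> 'b::real_normed_vector) \<Rightarrow> bool" where
  "smooth_on S f \<longleftrightarrow>
     (\<forall>x\<in>S. \<exists>W h. open W \<and> x \<in> W \<and> (\<forall>k. C_k_on k W h) \<and> (\<forall>y\<in>S \<inter> W. h y = f y))"


section \<open>Oriented smooth manifolds with boundary\<close>

text \<open>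
  Charts take values in a closed half-space of \<open>real^'n\<close>. Which coordinate is
  constrained to be nonnegative is immaterial; an arbitrary one is fixed once and for all.
\<close>

definition bdry_index :: "'n::finite" where
  "bdry_index = (SOME i. True)"

definition half_space :: "(real^'n::finite) set" where
  "half_space = {y. 0 \<le> y $ bdry_index}"

record ('m, 'n) chart =
  chart_dom :: "'m set"
  coord :: "'m \<Rightarrow> real^'n"

abbreviation cimage :: "('m, 'n::finite) chart \<Rightarrow> (real^'n) set" where
  "cimage c \<equiv> coord c ` chart_dom c"

definition chart_inv :: "('m, 'n::finite) chart \<Rightarrow> real^'n \<Rightarrow> 'm" where
  "chart_inv c = inv_into (chart_dom c) (coord c)"

text \<open>
  The differential of \<open>f\<close> at \<open>x\<close>, as a linear map on \<open>real^'n\<close>: a vector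
  \<open>v\<close> stands for the tangent vector with components \<open>v\<close> in the chart \<open>c\<close>. The derivative is
  taken within the image of the chart, so that it also makes sense at boundary points.
\<close>

definition differential ::
  "('m, 'n::finite) chart \<Rightarrow> ('m \<Rightarrow> 'b::real_normed_vector) \<Rightarrow> 'm \<Rightarrow> real^'n \<Rightarrow> 'b" where
  "differential c f x = frechet_derivative (f \<circ> chart_inv c) (at (coord c x) within cimage c)"

definition smooth_map_on ::
  "('m, 'n::finite) chart set \<Rightarrow> 'm set \<Rightarrow> ('m \<Rightarrow> 'b::real_normed_vector) \<Rightarrow> bool" where
  "smooth_map_on \<A> U f \<longleftrightarrow> (\<forall>c\<in>\<A>. smooth_on (coord c ` (chart_dom c \<inter> U)) (f \<circ> chart_inv c))"

definition is_chart :: "'m topology \<Rightarrow> ('m, 'n::finite) chart \<Rightarrow> bool" where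
  "is_chart M c \<longleftrightarrow>
     openin M (chart_dom c) \<and>
     openin (top_of_set half_space) (cimage c) \<and>
     homeomorphic_map (subtopology M (chart_dom c)) (top_of_set (cimage c)) (coord c)"

definition transition_matrix ::
  "('m, 'n::finite) chart \<Rightarrow> ('m, 'n) chart \<Rightarrow> 'm \<Rightarrow> real^'n^'n" where
  "transition_matrix c c' x = matrix (differential c (coord c') x)"

definition oriented_manifold_with_boundary ::
  "'m topology \<Rightarrow> ('m, 'n::finite) chart set \<Rightarrow> bool" where
  "oriented_manifold_with_boundary M \<A> \<longleftrightarrow>
     Hausdorff_space M \<and> second_countable M \<and>
     (\<forall>c\<in>\<A>. is_chart M c) \<and>
     (\<Union>c\<in>\<A>. chart_dom c) = topspace M \<and>
     (\<forall>c\<in>\<A>. smooth_map_on \<A> (chart_dom c) (coord c)) \<and>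
     (\<forall>c\<in>\<A>. \<forall>c'\<in>\<A>. \<forall>x\<in>chart_dom c \<inter> chart_dom c'. 0 < det (transition_matrix c c' x))"

definition manifold_boundary :: "('m, 'n::finite) chart set \<Rightarrow> 'm set" where
  "manifold_boundary \<A> = {x. \<exists>c\<in>\<A>. x \<in> chart_dom c \<and> coord c x $ bdry_index = 0}"


section \<open>Integration of n-forms\<close>

text \<open>
  An n-form \<open>\<omega>\<close> is represented by its coefficient functions: in the chart \<open>c\<close> of the oriented
  atlas it is \<open>\<omega> c dx\<^sub>1 \<and> \<dots> \<and> dx\<^sub>n\<close>. Its integral over a compact
  manifold is defined by means of a smooth partition of unity subordinate to finitely many charts
  of the atlas, and does not depend on the choice.
\<close>

definition partition_of_unity ::
  "'m topology \<Rightarrow> ('m, 'n::finite) chart set \<Rightarrow> ('m, 'n) chart set \<Rightarrow> (('m, 'n) chart \<Rightarrow> 'm \<Rightarrow> real) \<Rightarrow> bool"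
  where
  "partition_of_unity M \<A> C \<rho> \<longleftrightarrow>
     finite C \<and> C \<subseteq> \<A> \<and>
     (\<forall>c\<in>C. smooth_map_on \<A> (topspace M) (\<rho> c) \<and> (\<forall>x\<in>topspace M. 0 \<le> \<rho> c x) \<and>
            M closure_of {x \<in> topspace M. \<rho> c x \<noteq> 0} \<subseteq> chart_dom c) \<and>
     (\<forall>x\<in>topspace M. (\<Sum>c\<in>C. \<rho> c x) = 1)"

definition form_integral ::
  "'m topology \<Rightarrow> ('m, 'n::finite) chart set \<Rightarrow> (('m, 'n) chart \<Rightarrow> 'm \<Rightarrow> real) \<Rightarrow> real" where
  "form_integral M \<A> \<omega> =
     (let (C, \<rho>) = (SOME (C, \<rho>). partition_of_unity M \<A> C \<rho>)
      in \<Sum>c\<in>C. LINT y:cimage c|lborel. \<rho> c (chart_inv c y) * \<omega> c (chart_inv c y))"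


section \<open>Riemannian metrics and their curvature\<close>

text \<open>A metric is represented by its component matrices in the charts of the atlas.\<close>

type_synonym ('m, 'n) metric = "('m, 'n) chart \<Rightarrow> 'm \<Rightarrow> real^'n^'n"

definition positive_definite :: "real^'n::finite^'n \<Rightarrow> bool" where
  "positive_definite G \<longleftrightarrow> transpose G = G \<and> (\<forall>v. v \<noteq> 0 \<longrightarrow> 0 < v \<bullet> (G *v v))"

definition riemannian_metric :: "('m, 'n::finite) chart set \<Rightarrow> ('m, 'n) metric \<Rightarrow> bool" where
  "riemannian_metric \<A> g \<longleftrightarrow>
     (\<forall>c\<in>\<A>. smooth_on (cimage c) (g c \<circ> chart_inv c) \<and> (\<forall>x\<in>chart_dom c. positive_definite (g c x))) \<and>
     (\<forall>c\<in>\<A>. \<forall>c'\<in>\<A>. \<forall>x\<in>chart_dom c \<inter> chart_dom c'.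
        g c x = transpose (transition_matrix c c' x) ** g c' x ** transition_matrix c c' x)"

text \<open>Coefficient of the volume form with respect to positively oriented charts.\<close>

definition volume_form :: "('m, 'n::finite) metric \<Rightarrow> ('m, 'n) chart \<Rightarrow> 'm \<Rightarrow> real" where
  "volume_form g c x = sqrt (det (g c x))"

definition riemannian_volume :: "'m topology \<Rightarrow> ('m, 'n::finite) chart set \<Rightarrow> ('m, 'n) metric \<Rightarrow> real" where
  "riemannian_volume M \<A> g = form_integral M \<A> (volume_form g)"

text \<open>
  Conformally flat: every point has a neighbourhood which is conformally diffeomorphic to a subset
  of Euclidean space.
\<close>

definition conformally_flat ::
  "'m topology \<Rightarrow> ('m, 'n::finite) chart set \<Rightarrow> ('m, 'n) metric \<Rightarrow> bool" where
  "conformally_flat M \<A> g \<longleftrightarrow>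
     (\<forall>x\<in>topspace M. \<exists>U (\<psi> :: 'm \<Rightarrow> real^'n) (\<mu> :: 'm \<Rightarrow> real).
        openin M U \<and> x \<in> U \<and>
        smooth_map_on \<A> U \<psi> \<and> inj_on \<psi> U \<and>
        smooth_map_on \<A> U \<mu> \<and> (\<forall>y\<in>U. 0 < \<mu> y) \<and>
        (\<forall>c\<in>\<A>. \<forall>y\<in>U \<inter> chart_dom c. \<forall>v w.
           v \<bullet> (g c y *v w) = \<mu> y * (differential c \<psi> y v \<bullet> differential c \<psi> y w)))"

definition partial :: "('m, 'n::finite) chart \<Rightarrow> 'n \<Rightarrow> ('m \<Rightarrow> real) \<Rightarrow> 'm \<Rightarrow> real" where
  "partial c i f x = differential c f x (axis i 1)"

text \<open>\<open>christoffel g c k i j\<close> is the symbol with upper index \<open>k\<close> and lower indices \<open>i\<close>, \<open>j\<close>.\<close>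

definition christoffel ::
  "('m, 'n::finite) metric \<Rightarrow> ('m, 'n) chart \<Rightarrow> 'n \<Rightarrow> 'n \<Rightarrow> 'n \<Rightarrow> 'm \<Rightarrow> real" where
  "christoffel g c k i j x =
     (\<Sum>l\<in>UNIV. matrix_inv (g c x) $ k $ l *
        (partial c i (\<lambda>y. g c y $ j $ l) x + partial c j (\<lambda>y. g c y $ i $ l) x
         - partial c l (\<lambda>y. g c y $ i $ j) x)) / 2"

text \<open>
  \<open>riemann g c l i j k\<close> is the \<open>l\<close>-th component of
  \<open>R(\<partial>\<^sub>i, \<partial>\<^sub>j)\<partial>\<^sub>k = \<nabla>\<^sub>i\<nabla>\<^sub>j\<partial>\<^sub>k - \<nabla>\<^sub>j\<nabla>\<^sub>i\<partial>\<^sub>k\<close>.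
\<close>

definition riemann ::
  "('m, 'n::finite) metric \<Rightarrow> ('m, 'n) chart \<Rightarrow> 'n \<Rightarrow> 'n \<Rightarrow> 'n \<Rightarrow> 'n \<Rightarrow> 'm \<Rightarrow> real" where
  "riemann g c l i j k x =
     partial c i (christoffel g c l j k) x - partial c j (christoffel g c l i k) x
     + (\<Sum>m\<in>UNIV. christoffel g c l i m x * christoffel g c m j k x
                    - christoffel g c l j m x * christoffel g c m i k x)"

definition ricci :: "('m, 'n::finite) metric \<Rightarrow> ('m, 'n) chart \<Rightarrow> 'n \<Rightarrow> 'n \<Rightarrow> 'm \<Rightarrow> real" where
  "ricci g c j k x = (\<Sum>i\<in>UNIV. riemann g c i i j k x)"

definition scalar_curvature :: "('m, 'n::finite) metric \<Rightarrow> ('m, 'n) chart \<Rightarrow> 'm \<Rightarrow> real" where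
  "scalar_curvature g c x =
     (\<Sum>j\<in>UNIV. \<Sum>k\<in>UNIV. matrix_inv (g c x) $ j $ k * ricci g c j k x)"


section \<open>Minkowski spacetime and isometric immersions into the light-cone\<close>

text \<open>
  Since \<open>'n option\<close> has one more element than \<open>'n\<close>, this is an (n+2)-dimensional
  space. The first factor is the time axis.
\<close>

type_synonym 'n minkowski = "real \<times> (real, 'n option) vec"

definition lorentz :: "'n::finite minkowski \<Rightarrow> 'n minkowski \<Rightarrow> real" where
  "lorentz v w = - (fst v * fst w) + snd v \<bullet> snd w"

definition light_cone :: "('n::finite minkowski) set" where
  "light_cone = {v. lorentz v v = 0}"

definition induced_metric :: "('m \<Rightarrow> 'n::finite minkowski) \<Rightarrow> ('m, 'n) metric" where
  "induced_metric f c x =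
     (\<chi> i j. lorentz (differential c f x (axis i 1)) (differential c f x (axis j 1)))"

definition smooth_immersion ::
  "'m topology \<Rightarrow> ('m, 'n::finite) chart set \<Rightarrow> ('m \<Rightarrow> 'n minkowski) \<Rightarrow> bool" where
  "smooth_immersion M \<A> f \<longleftrightarrow>
     smooth_map_on \<A> (topspace M) f \<and> (\<forall>c\<in>\<A>. \<forall>x\<in>chart_dom c. inj (differential c f x))"

definition spacelike_immersion ::
  "'m topology \<Rightarrow> ('m, 'n::finite) chart set \<Rightarrow> ('m \<Rightarrow> 'n minkowski) \<Rightarrow> bool" where
  "spacelike_immersion M \<A> f \<longleftrightarrow>
     smooth_immersion M \<A> f \<and> riemannian_metric \<A> (induced_metric f)"

definition light_cone_isometric_immersion ::
  "'m topology \<Rightarrow> ('m, 'n::finite) chart set \<Rightarrow> ('m, 'n) metric \<Rightarrow> ('m \<Rightarrow> 'n minkowski) \<Rightarrow> bool" where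
  "light_cone_isometric_immersion M \<A> g p \<longleftrightarrow>
     smooth_immersion M \<A> p \<and> p ` topspace M \<subseteq> light_cone \<and>
     (\<forall>c\<in>\<A>. \<forall>x\<in>chart_dom c. induced_metric p c x = g c x)"

definition is_dual_map ::
  "'m topology \<Rightarrow> ('m, 'n::finite) chart set \<Rightarrow> ('m \<Rightarrow> 'n minkowski) \<Rightarrow> ('m \<Rightarrow> 'n minkowski) \<Rightarrow> bool" where
  "is_dual_map M \<A> p q \<longleftrightarrow>
     smooth_map_on \<A> (topspace M) q \<and> q ` topspace M \<subseteq> light_cone \<and>
     (\<forall>x\<in>topspace M. lorentz (p x) (q x) = 1) \<and>
     (\<forall>c\<in>\<A>. \<forall>x\<in>chart_dom c. \<forall>Y. lorentz (differential c p x Y) (q x) = 0)"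

definition normal_part :: "('n::finite minkowski) set \<Rightarrow> 'n minkowski \<Rightarrow> 'n minkowski" where
  "normal_part T v = (THE w. v - w \<in> T \<and> (\<forall>u\<in>T. lorentz w u = 0))"

text \<open>
  The normal part of the flat derivative in direction \<open>Y\<close> of the vector field \<open>Z\<close>. The vectors
  \<open>Y\<close>, \<open>Z\<close> are extended to vector fields with constant components in the chart; as the second
  fundamental form is tensorial, the extension does not matter.
\<close>

definition second_fundamental_form ::
  "('m \<Rightarrow> 'n::finite minkowski) \<Rightarrow> ('m, 'n) chart \<Rightarrow> 'm \<Rightarrow> real^'n \<Rightarrow> real^'n \<Rightarrow> 'n minkowski" where
  "second_fundamental_form p c x Y Z =
     normal_part (range (differential c p x)) (differential c (\<lambda>y. differential c p y Z) x Y)"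

text \<open>The component matrix of the shape operator in the chart \<open>c\<close>.\<close>

definition shape_operator ::
  "('m \<Rightarrow> 'n::finite minkowski) \<Rightarrow> ('m \<Rightarrow> 'n minkowski) \<Rightarrow> ('m, 'n) chart \<Rightarrow> 'm \<Rightarrow> real^'n^'n" where
  "shape_operator p q c x =
     (THE B. \<forall>Y Z. lorentz (differential c p x (B *v Y)) (differential c p x Z)
                   = lorentz (second_fundamental_form p c x Y Z) (q x))"


section \<open>Variations\<close>

definition variation ::
  "'m topology \<Rightarrow> ('m, 'n::finite) chart set \<Rightarrow> ('m \<Rightarrow> 'n minkowski) \<Rightarrow> real
     \<Rightarrow> (real \<Rightarrow> 'm \<Rightarrow> 'n minkowski) \<Rightarrow> bool" where
  "variation M \<A> p \<epsilon> F \<longleftrightarrow>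
     0 < \<epsilon> \<and>
     (\<forall>c\<in>\<A>. smooth_on ({-\<epsilon><..<\<epsilon>} \<times> cimage c) (\<lambda>(t, y). F t (chart_inv c y))) \<and>
     (\<forall>x\<in>topspace M. F 0 x = p x) \<and>
     (\<forall>t\<in>{-\<epsilon><..<\<epsilon>}. spacelike_immersion M \<A> (F t))"

definition fixed_boundary ::
  "('m, 'n::finite) chart set \<Rightarrow> ('m \<Rightarrow> 'n minkowski) \<Rightarrow> real \<Rightarrow> (real \<Rightarrow> 'm \<Rightarrow> 'n minkowski) \<Rightarrow> bool" where
  "fixed_boundary \<A> p \<epsilon> F \<longleftrightarrow>
     (\<forall>t\<in>{-\<epsilon><..<\<epsilon>}. \<forall>x\<in>manifold_boundary \<A>. F t x = p x)"

definition extended_variational_field ::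
  "(real \<Rightarrow> 'm \<Rightarrow> 'n::finite minkowski) \<Rightarrow> real \<Rightarrow> 'm \<Rightarrow> 'n minkowski" where
  "extended_variational_field F t x = vector_derivative (\<lambda>s. F s x) (at t)"

definition variational_field ::
  "(real \<Rightarrow> 'm \<Rightarrow> 'n::finite minkowski) \<Rightarrow> 'm \<Rightarrow> 'n minkowski" where
  "variational_field F x = extended_variational_field F 0 x"

definition acceleration_field ::
  "(real \<Rightarrow> 'm \<Rightarrow> 'n::finite minkowski) \<Rightarrow> 'm \<Rightarrow> 'n minkowski" where
  "acceleration_field F x = vector_derivative (\<lambda>t. extended_variational_field F t x) (at 0)"

definition admissible ::
  "'m topology \<Rightarrow> ('m \<Rightarrow> 'n::finite minkowski) \<Rightarrow> (real \<Rightarrow> 'm \<Rightarrow> 'n minkowski) \<Rightarrow> bool" where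
  "admissible M q F \<longleftrightarrow>
     (\<exists>\<phi> :: 'm \<Rightarrow> real. \<forall>x\<in>topspace M. variational_field F x = \<phi> x *\<^sub>R q x)"

definition has_second_derivative :: "(real \<Rightarrow> real) \<Rightarrow> real \<Rightarrow> real \<Rightarrow> bool" where
  "has_second_derivative f D t \<longleftrightarrow>
     (\<exists>f'. (\<forall>\<^sub>F s in nhds t. (f has_real_derivative f' s) (at s)) \<and>
           (f' has_real_derivative D) (at t))"

end

theory Submission
  imports Defs
begin

text \<open>
  In a chart write \<open>a\<^sub>i\<^sub>j = \<langle>\<partial>\<^sub>i \<partial>\<^sub>j p, q\<rangle>\<close>. Along \<open>p\<close> the vectors \<open>\<partial>\<^sub>1 p, \<dots>, \<partial>\<^sub>n p, p, q\<close> form a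
  frame, and comparing the symmetric third derivatives of \<open>p\<close> in this frame gives the Gauss equation,
  hence \<open>S = -2 (n - 1) tr A\<close>; so \<open>S = 0\<close> forces \<open>tr A = 0\<close>. If the variational field is \<open>\<phi> q\<close> and the
  acceleration is \<open>Y\<close>, the metric varies by \<open>g' = -2 \<phi> a\<close> and
  \<open>g''\<^sub>i\<^sub>j = 2 \<phi>\<^sup>2 \<langle>\<partial>\<^sub>i q, \<partial>\<^sub>j q\<rangle> + \<langle>\<partial>\<^sub>i Y, \<partial>\<^sub>j p\<rangle> + \<langle>\<partial>\<^sub>i p, \<partial>\<^sub>j Y\<rangle>\<close>, and therefore the volume density has second derivative
  \<open>(- \<phi>\<^sup>2 tr A\<^sup>2 + g\<^sup>i\<^sup>j \<langle>\<partial>\<^sub>i Y, \<partial>\<^sub>j p\<rangle>) dV\<close>. Since \<open>tr A = 0\<close> also means \<open>\<Delta> p = - n q\<close>, the last term is the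
  divergence of the tangential part of \<open>Y\<close> plus \<open>n \<langle>Y, q\<rangle>\<close>, and the divergence integrates to zero because
  \<open>Y\<close> vanishes on the boundary.
\<close>

section \<open>Calculus of smooth functions\<close>

text \<open>The obstacle is the divergence theorem on a manifold whose integral is a sum over a
  chosen partition of unity. In one chart only the cut-off field \<open>\<rho> c\<close> times the
  tangential part of Y has compact support, so its divergence integrates to zero at the price of an
  error: the integral of the derivative of \<open>\<rho> c\<close> along that tangential part. The
  error does not vanish chart by chart. Its total does, because the partition functions add up to 1,
  but the terms to be cancelled live in different charts; comparing them needs the change of
  variables formula for transition maps and the positivity of their determinants. Charts take values
  in a half-space, so the whole calculus, including the symmetry of second derivatives, is set up
  for derivatives within a set and transferred from local extensions to boundary points.\<close>

lemma C_k_on_cong: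
  assumes "open U" "\<And>x. x \<in> U \<Longrightarrow> f x = g x" "C_k_on k U f"
  shows "C_k_on k U g"
  using assms(2,3)
proof (induction k arbitrary: f g)
  case 0
  then show ?case by (simp cong: continuous_on_cong)
next
  case (Suc k)
  have d: "f differentiable (at x)" if "x \<in> U" for x
    using Suc.prems that by simp
  have d': "(g has_derivative frechet_derivative f (at x)) (at x)" if "x \<in> U" for x
    using d[OF that] Suc.prems(1) assms(1) that
    by (metis frechet_derivative_works has_derivative_transform_within_open)
  have eq: "frechet_derivative f (at x) v = frechet_derivative g (at x) v" if "x \<in> U" for x v
    using frechet_derivative_at[OF d'[OF that]] by simp
  have "C_k_on k U (\<lambda>x. frechet_derivative g (at x) v)" for v
    by (rule Suc.IH[OF eq]) (use Suc.prems(2) in simp_all)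
  with d' show ?case
    by (auto simp: differentiable_def)
qed

lemma C_k_on_subset: "C_k_on k U f \<Longrightarrow> V \<subseteq> U \<Longrightarrow> C_k_on k V f"
  by (induction k arbitrary: f) (auto intro: continuous_on_subset)

text \<open>The derivative may be supplied in closed form here; the closure properties below then
  become inductions whose step only has to recognise that formula as built from functions of one
  order less.\<close>

lemma C_k_on_SucI:
  assumes "open U" "\<And>x. x \<in> U \<Longrightarrow> (f has_derivative f' x) (at x)"
    and "\<And>v. C_k_on k U (\<lambda>x. f' x v)"
  shows "C_k_on (Suc k) U f"
proof -
  have "f' x = frechet_derivative f (at x)" if "x \<in> U" for x
    using assms(2) that frechet_derivative_at by blast
  then have "C_k_on k U (\<lambda>x. frechet_derivative f (at x) v)" for v
    by (intro C_k_on_cong[OF assms(1) _ assms(3)[of v]]) simp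
  then show ?thesis
    using assms(2) by (auto simp: differentiable_def)
qed

lemma C_k_on_SucD:
  assumes "C_k_on (Suc k) U f" "x \<in> U"
  shows "(f has_derivative frechet_derivative f (at x)) (at x)"
  using assms frechet_derivative_works by auto

lemma C_k_on_Suc_imp: "C_k_on (Suc k) U f \<Longrightarrow> C_k_on k U f"
proof (induction k arbitrary: f)
  case 0
  then show ?case
    by (auto intro!: continuous_at_imp_continuous_on differentiable_imp_continuous_within)
qed auto

lemma C_k_on_le: "C_k_on m U f \<Longrightarrow> k \<le> m \<Longrightarrow> C_k_on k U f"
  by (induction m) (auto simp: le_Suc_eq simp del: C_k_on.simps intro: C_k_on_Suc_imp)

lemma C_k_on_imp_continuous_on: "C_k_on k U f \<Longrightarrow> continuous_on U f"
  using C_k_on_le[of k U f 0] by simp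

lemma C_k_on_const: "open U \<Longrightarrow> C_k_on k U (\<lambda>x. c)"
  by (induction k arbitrary: c) (auto intro!: C_k_on_SucI[where f' = "\<lambda>_ _. 0"] simp del: C_k_on.simps(2))

lemma C_k_on_bounded_linear:
  assumes "open U" "bounded_linear h" "C_k_on k U f"
  shows "C_k_on k U (\<lambda>x. h (f x))"
  using assms(3)
proof (induction k arbitrary: f)
  case 0
  then show ?case
    using assms(2) by (simp add: bounded_linear.continuous_on)
next
  case (Suc k)
  show ?case
  proof (rule C_k_on_SucI[OF assms(1)])
    show "((\<lambda>x. h (f x)) has_derivative (\<lambda>v. h (frechet_derivative f (at x) v))) (at x)" if "x \<in> U" for x
      by (rule bounded_linear.has_derivative[OF assms(2)]) (rule C_k_on_SucD[OF Suc.prems that])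
    show "C_k_on k U (\<lambda>x. h (frechet_derivative f (at x) v))" for v
      by (rule Suc.IH) (use Suc.prems in simp)
  qed
qed

lemma C_k_on_ident: "open U \<Longrightarrow> C_k_on k U (\<lambda>x. x)"
  by (cases k) (auto intro!: C_k_on_SucI[where f' = "\<lambda>_ v. v"] C_k_on_const simp del: C_k_on.simps(2))

lemma C_k_on_add:
  assumes "open U" "C_k_on k U f" "C_k_on k U g"
  shows "C_k_on k U (\<lambda>x. f x + g x)"
  using assms(2,3)
proof (induction k arbitrary: f g)
  case 0
  then show ?case by (simp add: continuous_on_add)
next
  case (Suc k)
  show ?case
  proof (rule C_k_on_SucI[OF assms(1)])
    show "((\<lambda>x. f x + g x) has_derivative (\<lambda>v. frechet_derivative f (at x) v + frechet_derivative g (at x) v)) (at x)"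
      if "x \<in> U" for x
      by (intro has_derivative_add C_k_on_SucD[OF Suc.prems(1) that] C_k_on_SucD[OF Suc.prems(2) that])
    show "C_k_on k U (\<lambda>x. frechet_derivative f (at x) v + frechet_derivative g (at x) v)" for v
      by (rule Suc.IH) (use Suc.prems in simp_all)
  qed
qed

lemma C_k_on_sum:
  assumes "open U" "\<And>i. i \<in> I \<Longrightarrow> C_k_on k U (f i)"
  shows "C_k_on k U (\<lambda>x. \<Sum>i\<in>I. f i x)"
  using assms(2)
  by (induction I rule: infinite_finite_induct)
    (auto intro: C_k_on_const[OF assms(1)] C_k_on_add[OF assms(1)])

lemma C_k_on_bounded_bilinear:
  assumes "open U" "bounded_bilinear b" "C_k_on k U f" "C_k_on k U g"
  shows "C_k_on k U (\<lambda>x. b (f x) (g x))"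
  using assms(3,4)
proof (induction k arbitrary: f g)
  case 0
  then show ?case
    using assms(2) by (simp add: bounded_bilinear.continuous_on)
next
  case (Suc k)
  show ?case
  proof (rule C_k_on_SucI[OF assms(1)])
    show "((\<lambda>x. b (f x) (g x)) has_derivative
        (\<lambda>v. b (f x) (frechet_derivative g (at x) v) + b (frechet_derivative f (at x) v) (g x))) (at x)"
      if "x \<in> U" for x
      by (rule bounded_bilinear.FDERIV[OF assms(2) C_k_on_SucD[OF Suc.prems(1) that] C_k_on_SucD[OF Suc.prems(2) that]])
    show "C_k_on k U (\<lambda>x. b (f x) (frechet_derivative g (at x) v) + b (frechet_derivative f (at x) v) (g x))" for v
    proof -
      have "C_k_on k U f" "C_k_on k U g" "C_k_on k U (\<lambda>x. frechet_derivative f (at x) v)"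
        "C_k_on k U (\<lambda>x. frechet_derivative g (at x) v)"
        using Suc.prems[THEN C_k_on_Suc_imp] Suc.prems by simp_all
      then show ?thesis
        by (intro C_k_on_add[OF assms(1)] Suc.IH)
    qed
  qed
qed

text \<open>\<open>C_k_on\<close> controls derivatives in fixed directions only, while the chain
  rule evaluates the outer derivative in a direction that moves with x. Expanding that direction in
  a basis separates the two, which is why the middle space is Euclidean.\<close>

lemma C_k_on_compose:
  fixes h :: "'a::real_normed_vector \<Rightarrow> 'b::euclidean_space" and f :: "'b \<Rightarrow> 'c::real_normed_vector"
  assumes "open U" "C_k_on k V f" "C_k_on k U h" "h ` U \<subseteq> V"
  shows "C_k_on k U (\<lambda>x. f (h x))"
  using assms(2,3)
proof (induction k arbitrary: f)
  case 0
  then show ?case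
    using assms(4) by (auto intro: continuous_on_compose2)
next
  case (Suc k)
  show ?case
  proof (rule C_k_on_SucI[OF assms(1)])
    show "((\<lambda>x. f (h x)) has_derivative
        (\<lambda>v. \<Sum>b\<in>Basis. (frechet_derivative h (at x) v \<bullet> b) *\<^sub>R frechet_derivative f (at (h x)) b)) (at x)"
      if "x \<in> U" for x
    proof -
      have df: "(f has_derivative frechet_derivative f (at (h x))) (at (h x))"
        using C_k_on_SucD[OF Suc.prems(1), of "h x"] assms(4) that by auto
      have "linear (frechet_derivative f (at (h x)))"
        using df has_derivative_linear by blast
      then have eq: "frechet_derivative f (at (h x)) w = (\<Sum>b\<in>Basis. (w \<bullet> b) *\<^sub>R frechet_derivative f (at (h x)) b)" for w
        by (subst euclidean_representation[symmetric, of w]) (simp only: linear_sum linear_cmul)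
      show ?thesis
        by (rule has_derivative_eq_rhs[OF has_derivative_compose[OF C_k_on_SucD[OF Suc.prems(2) that] df]])
          (rule ext, rule eq)
    qed
    fix v
    have "C_k_on k U (\<lambda>x. frechet_derivative f (at (h x)) b)" for b
      by (rule Suc.IH) (use Suc.prems(1) C_k_on_Suc_imp[OF Suc.prems(2)] in simp_all)
    moreover have "C_k_on k U (\<lambda>x. frechet_derivative h (at x) v)"
      using Suc.prems by simp
    ultimately show "C_k_on k U (\<lambda>x. \<Sum>b\<in>Basis. (frechet_derivative h (at x) v \<bullet> b) *\<^sub>R frechet_derivative f (at (h x)) b)"
      by (intro C_k_on_sum C_k_on_bounded_bilinear[OF _ bounded_bilinear_scaleR]
          C_k_on_bounded_linear[OF _ bounded_linear_inner_left] assms(1))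
  qed
qed

text \<open>The derivative is a polynomial in the function itself, so the induction hypothesis
  covers it. For \<open>sqrt\<close> the derivative is half the inverse of \<open>sqrt\<close>,
  which closes the induction in the same way.\<close>

lemma C_k_on_inverse: "C_k_on k {x::real. x \<noteq> 0} inverse"
proof (induction k)
  case 0
  then show ?case by (auto intro!: continuous_intros)
next
  case (Suc k)
  have op: "open {x::real. x \<noteq> 0}"
    by (simp add: open_Collect_neq)
  show ?case
  proof (rule C_k_on_SucI[OF op])
    show "(inverse has_derivative (\<lambda>v. - (inverse x * inverse x) * v)) (at x)" if "x \<in> {x. x \<noteq> 0}" for x :: real
      using that by (auto intro!: derivative_eq_intros)
    show "C_k_on k {x. x \<noteq> 0} (\<lambda>x. - (inverse x * inverse x) * v)" for v :: real
    proof -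
      have "C_k_on k {x. x \<noteq> 0} (\<lambda>x::real. (inverse x * inverse x))"
        by (rule C_k_on_bounded_bilinear[OF op bounded_bilinear_mult Suc Suc])
      from C_k_on_bounded_linear[OF op bounded_linear_mult_left[of "-v"] this]
      show ?thesis by simp
    qed
  qed
qed

lemma C_k_on_sqrt: "C_k_on k {0<..} sqrt"
proof (induction k)
  case 0
  then show ?case by (auto intro!: continuous_intros)
next
  case (Suc k)
  show ?case
  proof (rule C_k_on_SucI)
    show "(sqrt has_derivative (\<lambda>v. (inverse (sqrt x) / 2) * v)) (at x)" if "x \<in> {0<..}" for x
      using that by (auto intro!: derivative_eq_intros)
    show "C_k_on k {0<..} (\<lambda>x. (inverse (sqrt x) / 2) * v)" for v :: real
    proof -
      have "C_k_on k {0<..} (\<lambda>x. inverse (sqrt x))"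
        by (rule C_k_on_compose[OF _ C_k_on_inverse Suc]) auto
      from C_k_on_bounded_linear[OF _ bounded_linear_mult_left[of "v/2"] this]
      show ?thesis by simp
    qed
  qed simp
qed

section \<open>Symmetry of second derivatives on open sets\<close>

text \<open>Two applications of the mean value theorem, along v and then along w, turn the second
  difference into a value of the second derivative at a point of the small parallelogram.\<close>

lemma symmetric_derivative_aux:
  fixes f :: "'a::real_normed_vector \<Rightarrow> real"
  assumes W: "open W" "x \<in> W"
    and f1: "\<And>y. y \<in> W \<Longrightarrow> (f has_derivative f' y) (at y)"
    and f2: "\<And>y. y \<in> W \<Longrightarrow> ((\<lambda>y. f' y v) has_derivative f2 y) (at y)"
    and e: "e > 0"
  shows "\<exists>d>0. \<forall>s. 0 < s \<longrightarrow> s < d \<longrightarrow> (\<exists>y\<in>W. dist y x < e \<and>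
     f (x + s *\<^sub>R v + s *\<^sub>R w) - f (x + s *\<^sub>R v) - f (x + s *\<^sub>R w) + f x = s * s * f2 y w)"
proof -
  obtain r where r: "r > 0" "ball x r \<subseteq> W"
    using W openE by blast
  \<comment> \<open>Keeps the parallelogram spanned by s v and s w inside the ball of radius r and
    within e of x; the summand 1 covers v = w = 0.\<close>
  define d where "d = min r e / (norm v + norm w + 1)"
  have "d > 0"
    using r e by (simp add: d_def add_nonneg_pos)
  have near: "x + a *\<^sub>R v + b *\<^sub>R w \<in> W \<and> dist (x + a *\<^sub>R v + b *\<^sub>R w) x < e"
    if "0 \<le> a" "a \<le> s" "0 \<le> b" "b \<le> s" "0 < s" "s < d" for a b s
  proof -
    have "norm (a *\<^sub>R v + b *\<^sub>R w) \<le> s * norm v + s * norm w"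
      using that by (intro order.trans[OF norm_triangle_ineq] add_mono) (auto simp: mult_right_mono)
    also have "\<dots> \<le> s * (norm v + norm w + 1)"
      using that by (simp add: algebra_simps)
    also have "\<dots> < d * (norm v + norm w + 1)"
      using that by (intro mult_strict_right_mono) (auto simp: add_nonneg_pos)
    also have "\<dots> = min r e"
      unfolding d_def
      by (smt (verit, ccfv_threshold) nonzero_divide_eq_eq norm_ge_zero)
    finally have "norm (a *\<^sub>R v + b *\<^sub>R w) < min r e" .
    then have "dist (x + a *\<^sub>R v + b *\<^sub>R w) x < min r e"
      by (simp add: dist_norm algebra_simps)
    then show ?thesis
      using r by (auto simp: subset_iff dist_commute)
  qed
  show ?thesis
  proof (intro exI[of _ d] conjI allI impI \<open>d > 0\<close>)
    fix s assume s: "0 < s" "s < d"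
    define \<phi> where "\<phi> a = f (x + a *\<^sub>R v + s *\<^sub>R w) - f (x + a *\<^sub>R v)" for a
    have "(\<phi> has_real_derivative (f' (x + a *\<^sub>R v + s *\<^sub>R w) v - f' (x + a *\<^sub>R v) v)) (at a)"
      if "0 \<le> a" "a \<le> s" for a
    proof -
      have 1: "((\<lambda>a. f (x + a *\<^sub>R v + c *\<^sub>R w)) has_real_derivative f' (x + a *\<^sub>R v + c *\<^sub>R w) v) (at a)"
        if "0 \<le> c" "c \<le> s" for c
      proof -
        have "((\<lambda>a. f (x + a *\<^sub>R v + c *\<^sub>R w)) has_derivative (\<lambda>t. f' (x + a *\<^sub>R v + c *\<^sub>R w) (t *\<^sub>R v))) (at a)"
          using near[of a s c] that s \<open>0 \<le> a\<close> \<open>a \<le> s\<close>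
          by (intro has_derivative_compose[OF _ f1]) (auto intro!: derivative_eq_intros)
        moreover have "linear (f' (x + a *\<^sub>R v + c *\<^sub>R w))"
          using f1 near[of a s c] that s \<open>0 \<le> a\<close> \<open>a \<le> s\<close> has_derivative_linear by blast
        ultimately show ?thesis
          by (simp add: has_field_derivative_def linear_cmul mult.commute[of _ "f' _ _"])
      qed
      show ?thesis
        unfolding \<phi>_def using 1[of s] 1[of 0] s by (auto intro!: derivative_eq_intros)
    qed
    from MVT2[OF s(1) this] obtain a where a: "0 < a" "a < s"
      and eq1: "\<phi> s - \<phi> 0 = s * (f' (x + a *\<^sub>R v + s *\<^sub>R w) v - f' (x + a *\<^sub>R v) v)"
      by auto
    have "((\<lambda>b. f' (x + a *\<^sub>R v + b *\<^sub>R w) v) has_real_derivative f2 (x + a *\<^sub>R v + b *\<^sub>R w) w) (at b)"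
      if "0 \<le> b" "b \<le> s" for b
    proof -
      have "((\<lambda>b. f' (x + a *\<^sub>R v + b *\<^sub>R w) v) has_derivative (\<lambda>t. f2 (x + a *\<^sub>R v + b *\<^sub>R w) (t *\<^sub>R w))) (at b)"
        using near[of a s b] that s a
        by (intro has_derivative_compose[OF _ f2]) (auto intro!: derivative_eq_intros)
      moreover have "linear (f2 (x + a *\<^sub>R v + b *\<^sub>R w))"
        using f2 near[of a s b] that s a has_derivative_linear by (metis less_imp_le)
      ultimately show ?thesis
        by (simp add: has_field_derivative_def linear_cmul mult.commute[of _ "f2 _ _"])
    qed
    from MVT2[OF s(1) this] obtain b where b: "0 < b" "b < s"
      and eq2: "f' (x + a *\<^sub>R v + s *\<^sub>R w) v - f' (x + a *\<^sub>R v) v = s * f2 (x + a *\<^sub>R v + b *\<^sub>R w) w"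
      by auto
    show "\<exists>y\<in>W. dist y x < e \<and>
       f (x + s *\<^sub>R v + s *\<^sub>R w) - f (x + s *\<^sub>R v) - f (x + s *\<^sub>R w) + f x = s * s * f2 y w"
      using near[of a s b] a b s eq1 eq2
      by (intro bexI[of _ "x + a *\<^sub>R v + b *\<^sub>R w"]) (auto simp: \<phi>_def)
  qed
qed

text \<open>The second difference does not change when v and w are exchanged, so some value of one
  mixed derivative near x equals some value of the other near x. Continuity does the rest.\<close>

lemma symmetric_derivative_real:
  fixes f :: "'a::real_normed_vector \<Rightarrow> real"
  assumes W: "open W" "x \<in> W" and f: "C_k_on 2 W f"
  shows "frechet_derivative (\<lambda>y. frechet_derivative f (at y) v) (at x) w =
         frechet_derivative (\<lambda>y. frechet_derivative f (at y) w) (at x) v" (is "?D v w = ?D w v")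
proof (rule ccontr)
  let ?D = "\<lambda>v w y. frechet_derivative (\<lambda>y. frechet_derivative f (at y) v) (at y) w"
  assume neq: "?D v w x \<noteq> ?D w v x"
  \<comment> \<open>Half the gap: a value within e of one limit cannot equal a value within e of the
    other.\<close>
  define e where "e = \<bar>?D v w x - ?D w v x\<bar> / 2"
  have "e > 0" using neq by (simp add: e_def)
  have f1: "C_k_on (Suc 0) W (\<lambda>y. frechet_derivative f (at y) v)" for v
    using f by (simp add: numeral_2_eq_2)
  have "continuous_on W (?D v w)" for v w
    using f1[of v] by simp
  then have "\<exists>\<delta>>0. \<forall>y\<in>W. dist y x < \<delta> \<longrightarrow> \<bar>?D v w y - ?D v w x\<bar> < e" for v w
    using W \<open>e > 0\<close> by (auto simp: continuous_on_iff dist_real_def)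
  from this[of v w] this[of w v] obtain \<delta>1 \<delta>2 where \<delta>: "\<delta>1 > 0" "\<delta>2 > 0"
    "\<And>y. y\<in>W \<Longrightarrow> dist y x < \<delta>1 \<Longrightarrow> \<bar>?D v w y - ?D v w x\<bar> < e"
    "\<And>y. y\<in>W \<Longrightarrow> dist y x < \<delta>2 \<Longrightarrow> \<bar>?D w v y - ?D w v x\<bar> < e"
    by metis
  have hf: "(f has_derivative frechet_derivative f (at y)) (at y)" if "y \<in> W" for y
    using f that frechet_derivative_works by (auto simp: numeral_2_eq_2)
  obtain d1 where d1: "d1 > 0" "\<And>s. 0 < s \<Longrightarrow> s < d1 \<Longrightarrow> (\<exists>y\<in>W. dist y x < \<delta>1 \<and>
     f (x + s *\<^sub>R v + s *\<^sub>R w) - f (x + s *\<^sub>R v) - f (x + s *\<^sub>R w) + f x = s * s * ?D v w y)"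
    using symmetric_derivative_aux[OF W hf C_k_on_SucD[OF f1] \<delta>(1)] by metis
  obtain d2 where d2: "d2 > 0" "\<And>s. 0 < s \<Longrightarrow> s < d2 \<Longrightarrow> (\<exists>y\<in>W. dist y x < \<delta>2 \<and>
     f (x + s *\<^sub>R w + s *\<^sub>R v) - f (x + s *\<^sub>R w) - f (x + s *\<^sub>R v) + f x = s * s * ?D w v y)"
    using symmetric_derivative_aux[OF W hf C_k_on_SucD[OF f1] \<delta>(2)] by metis
  define s where "s = min d1 d2 / 2"
  have s: "0 < s" "s < d1" "s < d2"
    using d1(1) d2(1) by (auto simp: s_def min_def)
  obtain y where y: "y \<in> W" "dist y x < \<delta>1"
     "f (x + s *\<^sub>R v + s *\<^sub>R w) - f (x + s *\<^sub>R v) - f (x + s *\<^sub>R w) + f x = s * s * ?D v w y"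
    using d1(2)[OF s(1,2)] by blast
  obtain z where z: "z \<in> W" "dist z x < \<delta>2"
     "f (x + s *\<^sub>R w + s *\<^sub>R v) - f (x + s *\<^sub>R w) - f (x + s *\<^sub>R v) + f x = s * s * ?D w v z"
    using d2(2)[OF s(1,3)] by blast
  have "s * s * ?D v w y = s * s * ?D w v z"
    unfolding y(3)[symmetric] z(3)[symmetric] by (simp add: add.assoc add.commute[of "s *\<^sub>R v"])
  then have "?D v w y = ?D w v z"
    using s(1) by simp
  with \<delta>(3)[OF y(1,2)] \<delta>(4)[OF z(1,2)] show False
    by (auto simp: e_def abs_if field_simps split: if_splits)
qed

section \<open>Smoothness on arbitrary sets, by local extension\<close>

definition local_extension ::
  "'a::real_normed_vector set \<Rightarrow> ('a \<Rightarrow> 'b::real_normed_vector) \<Rightarrow> 'a \<Rightarrow> 'a set \<Rightarrow> ('a \<Rightarrow> 'b) \<Rightarrow> bool" where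
  "local_extension S f x W h \<longleftrightarrow> open W \<and> x \<in> W \<and> (\<forall>k. C_k_on k W h) \<and> (\<forall>y\<in>S \<inter> W. h y = f y)"

lemma local_extensionD:
  assumes "local_extension S f x W h"
  shows "open W" "x \<in> W" "\<And>k. C_k_on k W h" "\<And>y. y \<in> S \<Longrightarrow> y \<in> W \<Longrightarrow> h y = f y"
  using assms unfolding local_extension_def by simp_all

lemma smooth_onE:
  assumes "smooth_on S f" "x \<in> S"
  obtains W h where "local_extension S f x W h"
  using assms unfolding smooth_on_def local_extension_def[symmetric] by metis

lemma C_k_on_imp_smooth_on: "open U \<Longrightarrow> S \<subseteq> U \<Longrightarrow> (\<And>k. C_k_on k U f) \<Longrightarrow> smooth_on S f"
  unfolding smooth_on_def by (intro ballI exI[of _ U] exI[of _ f]) auto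

lemma smooth_on_localI:
  assumes "\<And>x. x \<in> S \<Longrightarrow> \<exists>W. open W \<and> x \<in> W \<and> smooth_on (S \<inter> W) f"
  shows "smooth_on S f"
  unfolding smooth_on_def
proof
  fix x assume x: "x \<in> S"
  then obtain W where W: "open W" "x \<in> W" "smooth_on (S \<inter> W) f"
    using assms by blast
  have xW: "x \<in> S \<inter> W" using x W(2) by simp
  obtain V h where Vext: "local_extension (S \<inter> W) f x V h"
    by (rule smooth_onE[OF W(3) xW])
  note V = local_extensionD[OF Vext]
  show "\<exists>W h. open W \<and> x \<in> W \<and> (\<forall>k. C_k_on k W h) \<and> (\<forall>y\<in>S \<inter> W. h y = f y)"
    using V W by (intro exI[of _ "W \<inter> V"] exI[of _ h]) (auto intro: C_k_on_subset)
qed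

lemma smooth_on_cong_subset:
  assumes "smooth_on S f" "T \<subseteq> S" "\<And>x. x \<in> T \<Longrightarrow> f x = g x"
  shows "smooth_on T g"
  unfolding smooth_on_def
proof
  fix x assume "x \<in> T"
  then have x: "x \<in> S" using assms(2) by blast
  obtain W h where Wext: "local_extension S f x W h"
    by (rule smooth_onE[OF assms(1) x])
  note W = local_extensionD[OF Wext]
  show "\<exists>W h. open W \<and> x \<in> W \<and> (\<forall>k. C_k_on k W h) \<and> (\<forall>y\<in>T \<inter> W. h y = g y)"
    using W assms(2,3) by (intro exI[of _ W] exI[of _ h]) auto
qed

lemma smooth_on_subset: "smooth_on S f \<Longrightarrow> T \<subseteq> S \<Longrightarrow> smooth_on T f"
  by (rule smooth_on_cong_subset) auto

lemma smooth_on_cong: "smooth_on S f \<Longrightarrow> (\<And>x. x \<in> S \<Longrightarrow> f x = g x) \<Longrightarrow> smooth_on S g"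
  by (rule smooth_on_cong_subset[OF _ order.refl])

lemma smooth_on_const: "smooth_on S (\<lambda>x. c)"
  by (rule C_k_on_imp_smooth_on[of UNIV]) (auto intro: C_k_on_const)

lemma smooth_on_bounded_linear:
  assumes "bounded_linear h" "smooth_on S f"
  shows "smooth_on S (\<lambda>x. h (f x))"
  unfolding smooth_on_def
proof
  fix x assume x: "x \<in> S"
  obtain W k where Wext: "local_extension S f x W k"
    by (rule smooth_onE[OF assms(2) x])
  note W = local_extensionD[OF Wext]
  show "\<exists>W k. open W \<and> x \<in> W \<and> (\<forall>n. C_k_on n W k) \<and> (\<forall>y\<in>S \<inter> W. k y = h (f y))"
    using W by (intro exI[of _ W] exI[of _ "\<lambda>x. h (k x)"]) (auto intro: C_k_on_bounded_linear assms(1))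
qed

lemma smooth_on_bounded_bilinear:
  assumes "bounded_bilinear b" "smooth_on S f" "smooth_on S g"
  shows "smooth_on S (\<lambda>x. b (f x) (g x))"
  unfolding smooth_on_def
proof
  fix x assume x: "x \<in> S"
  obtain W k where Wext: "local_extension S f x W k"
    by (rule smooth_onE[OF assms(2) x])
  note W = local_extensionD[OF Wext]
  obtain V l where Vext: "local_extension S g x V l"
    by (rule smooth_onE[OF assms(3) x])
  note V = local_extensionD[OF Vext]
  have "C_k_on n (W \<inter> V) (\<lambda>x. b (k x) (l x))" for n
    by (rule C_k_on_bounded_bilinear[OF open_Int[OF W(1) V(1)] assms(1) C_k_on_subset[OF W(3)] C_k_on_subset[OF V(3)]])
      auto
  then show "\<exists>W h. open W \<and> x \<in> W \<and> (\<forall>n. C_k_on n W h) \<and> (\<forall>y\<in>S \<inter> W. h y = b (f y) (g y))"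
    using W(1,2,4) V(1,2,4) by (intro exI[of _ "W \<inter> V"] exI[of _ "\<lambda>x. b (k x) (l x)"]) auto
qed

lemma smooth_on_add:
  assumes "smooth_on S f" "smooth_on S g"
  shows "smooth_on S (\<lambda>x. f x + g x)"
  unfolding smooth_on_def
proof
  fix x assume x: "x \<in> S"
  obtain W k where Wext: "local_extension S f x W k"
    by (rule smooth_onE[OF assms(1) x])
  note W = local_extensionD[OF Wext]
  obtain V l where Vext: "local_extension S g x V l"
    by (rule smooth_onE[OF assms(2) x])
  note V = local_extensionD[OF Vext]
  have "C_k_on n (W \<inter> V) (\<lambda>x. k x + l x)" for n
    by (rule C_k_on_add[OF open_Int[OF W(1) V(1)] C_k_on_subset[OF W(3)] C_k_on_subset[OF V(3)]]) auto
  then show "\<exists>W h. open W \<and> x \<in> W \<and> (\<forall>n. C_k_on n W h) \<and> (\<forall>y\<in>S \<inter> W. h y = f y + g y)"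
    using W(1,2,4) V(1,2,4) by (intro exI[of _ "W \<inter> V"] exI[of _ "\<lambda>x. k x + l x"]) auto
qed

lemma smooth_on_compose:
  fixes h :: "'a::real_normed_vector \<Rightarrow> 'b::euclidean_space" and f :: "'b \<Rightarrow> 'c::real_normed_vector"
  assumes "smooth_on T f" "smooth_on S h" "h ` S \<subseteq> T"
  shows "smooth_on S (\<lambda>x. f (h x))"
  unfolding smooth_on_def
proof
  fix x assume x: "x \<in> S"
  obtain W k where Wext: "local_extension S h x W k"
    by (rule smooth_onE[OF assms(2) x])
  note W = local_extensionD[OF Wext]
  have hx: "h x \<in> T" using x assms(3) by blast
  obtain V l where Vext: "local_extension T f (h x) V l"
    by (rule smooth_onE[OF assms(1) hx])
  note V = local_extensionD[OF Vext]
  \<comment> \<open>Off S the extension k may leave the domain V of l, so it is cut down to the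
    preimage of V.\<close>
  define Z where "Z = W \<inter> k -` V"
  have "open Z"
    unfolding Z_def using continuous_open_preimage[OF C_k_on_imp_continuous_on[OF W(3)[of 0]] W(1) V(1)] .
  moreover have "C_k_on n Z (\<lambda>x. l (k x))" for n
    by (rule C_k_on_compose[OF \<open>open Z\<close> V(3)]) (auto simp: Z_def intro: C_k_on_subset[OF W(3)])
  moreover have "l (k y) = f (h y)" if "y \<in> S \<inter> Z" for y
  proof -
    have "k y = h y" "k y \<in> V" using that W(4) by (auto simp: Z_def)
    then show ?thesis using V(4)[of "h y"] assms(3) that by auto
  qed
  ultimately show "\<exists>W k. open W \<and> x \<in> W \<and> (\<forall>n. C_k_on n W k) \<and> (\<forall>y\<in>S \<inter> W. k y = f (h y))"
    using x W(2,4) V(2) by (intro exI[of _ Z] exI[of _ "\<lambda>x. l (k x)"]) (auto simp: Z_def)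
qed

lemmas smooth_on_mult = smooth_on_bounded_bilinear[OF bounded_bilinear_mult]
lemmas smooth_on_scaleR = smooth_on_bounded_bilinear[OF bounded_bilinear_scaleR]

lemma smooth_on_ident: "smooth_on S (\<lambda>x. x)"
  by (rule C_k_on_imp_smooth_on[of UNIV]) (auto intro: C_k_on_ident)

lemma smooth_on_cmult: "smooth_on S f \<Longrightarrow> smooth_on S (\<lambda>x. c * f x :: real)"
  by (rule smooth_on_mult[OF smooth_on_const])

lemma smooth_on_diff:
  assumes "smooth_on S f" "smooth_on S g" shows "smooth_on S (\<lambda>x. f x - g x)"
  using smooth_on_add[OF assms(1) smooth_on_bounded_linear[OF bounded_linear_minus[OF bounded_linear_ident] assms(2)]]
  by simp

lemma smooth_on_sum:
  "(\<And>i. i \<in> I \<Longrightarrow> smooth_on S (f i)) \<Longrightarrow> smooth_on S (\<lambda>x. \<Sum>i\<in>I. f i x)"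
  by (induction I rule: infinite_finite_induct) (auto intro: smooth_on_const smooth_on_add)

lemma smooth_on_prod:
  fixes f :: "'i \<Rightarrow> 'a::real_normed_vector \<Rightarrow> real"
  shows "(\<And>i. i \<in> I \<Longrightarrow> smooth_on S (f i)) \<Longrightarrow> smooth_on S (\<lambda>x. \<Prod>i\<in>I. f i x)"
  by (induction I rule: infinite_finite_induct) (auto intro: smooth_on_const smooth_on_mult)

lemma smooth_on_Pair:
  fixes f :: "'a::real_normed_vector \<Rightarrow> 'b::real_normed_vector" and g :: "'a \<Rightarrow> 'c::real_normed_vector"
  assumes "smooth_on S f" "smooth_on S g"
  shows "smooth_on S (\<lambda>x. (f x, g x))"
proof -
  have "bounded_linear (\<lambda>a::'b. (a, 0::'c))" "bounded_linear (\<lambda>a::'c. (0::'b, a))"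
    by (auto intro!: bounded_linear_intros)
  from smooth_on_add[OF smooth_on_bounded_linear[OF this(1) assms(1)] smooth_on_bounded_linear[OF this(2) assms(2)]]
  show ?thesis by simp
qed

lemma smooth_on_inverse:
  fixes f :: "'a::real_normed_vector \<Rightarrow> real"
  assumes "smooth_on S f" "\<And>x. x \<in> S \<Longrightarrow> f x \<noteq> 0"
  shows "smooth_on S (\<lambda>x. inverse (f x))"
  by (rule smooth_on_compose[OF C_k_on_imp_smooth_on[OF _ order.refl C_k_on_inverse] assms(1)])
    (use assms(2) in \<open>auto simp: open_Collect_neq\<close>)

lemma smooth_on_divide:
  fixes f :: "'a::real_normed_vector \<Rightarrow> real"
  assumes "smooth_on S f" "smooth_on S g" "\<And>x. x \<in> S \<Longrightarrow> g x \<noteq> 0"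
  shows "smooth_on S (\<lambda>x. f x / g x)"
  unfolding divide_inverse by (intro smooth_on_mult smooth_on_inverse assms)

lemma smooth_on_sqrt:
  assumes "smooth_on S f" "\<And>x. x \<in> S \<Longrightarrow> f x > 0"
  shows "smooth_on S (\<lambda>x. sqrt (f x))"
  by (rule smooth_on_compose[OF C_k_on_imp_smooth_on[OF _ order.refl C_k_on_sqrt] assms(1)])
    (use assms(2) in auto)

section \<open>Derivatives within a set\<close>

abbreviation deriv_in :: "'a::real_normed_vector set \<Rightarrow> ('a \<Rightarrow> 'b::real_normed_vector) \<Rightarrow> 'a \<Rightarrow> 'a \<Rightarrow> 'b" where
  "deriv_in S f x \<equiv> frechet_derivative f (at x within S)"

lemma smooth_on_has_derivative:
  assumes "smooth_on S f" "x \<in> S"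
  shows "(f has_derivative deriv_in S f x) (at x within S)"
proof -
  obtain W h where Wext: "local_extension S f x W h"
    by (rule smooth_onE[OF assms])
  note W = local_extensionD[OF Wext]
  obtain r where r: "r > 0" "ball x r \<subseteq> W"
    using W openE by blast
  have "(h has_derivative frechet_derivative h (at x)) (at x within S)"
    using C_k_on_SucD[OF W(3)[of "Suc 0"] W(2)] has_derivative_at_withinI by blast
  then have "(f has_derivative frechet_derivative h (at x)) (at x within S)"
    by (rule has_derivative_transform_within[OF _ r(1) assms(2)])
      (use r(2) W(4) in \<open>auto simp: subset_iff dist_commute\<close>)
  then show ?thesis
    using frechet_derivative_works differentiable_def by blast
qed

lemma smooth_on_imp_continuous_on: "smooth_on S f \<Longrightarrow> continuous_on S f"
  unfolding continuous_on_eq_continuous_within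
  using smooth_on_has_derivative has_derivative_continuous by blast

lemma linear_deriv_in: "smooth_on S f \<Longrightarrow> x \<in> S \<Longrightarrow> linear (deriv_in S f x)"
  using smooth_on_has_derivative has_derivative_linear by blast

lemma deriv_in_cong:
  assumes "x \<in> S" "\<And>y. y \<in> S \<Longrightarrow> f y = g y"
  shows "deriv_in S f x = deriv_in S g x"
proof -
  have "(f has_derivative F) (at x within S) \<longleftrightarrow> (g has_derivative F) (at x within S)" for F
    using has_derivative_transform[OF assms(1)] assms(2) by metis
  then show ?thesis
    unfolding frechet_derivative_def by simp
qed

text \<open>This is the condition under which a derivative within \<open>S\<close> is unique.\<close>

definition full_tangent :: "'a::euclidean_space set \<Rightarrow> bool" where
  "full_tangent S \<longleftrightarrow> (\<forall>x\<in>S. \<forall>i\<in>Basis. \<forall>e>0. \<exists>d. 0 < \<bar>d\<bar> \<and> \<bar>d\<bar> < e \<and> x + d *\<^sub>R i \<in> S)"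

lemma deriv_in_eq:
  assumes "full_tangent S" "x \<in> S" "(f has_derivative f') (at x within S)"
  shows "deriv_in S f x = f'"
proof (rule frechet_derivative_unique_within[OF _ assms(3)])
  show "(f has_derivative deriv_in S f x) (at x within S)"
    using assms(3) frechet_derivative_works differentiable_def by blast
qed (use assms(1,2) in \<open>auto simp: full_tangent_def\<close>)

text \<open>Extensions of f may differ off S, but at points of S their derivatives all agree with
  the unique derivative within S. Differentiating an extension therefore extends the derivative,
  also at boundary points.\<close>

lemma deriv_in_local:
  assumes "full_tangent S" "x \<in> S" "open W" "x \<in> W" "C_k_on (Suc k) W h" "\<And>y. y \<in> S \<Longrightarrow> y \<in> W \<Longrightarrow> h y = f y"
  shows "deriv_in S f x = frechet_derivative h (at x)"
proof (rule deriv_in_eq[OF assms(1,2)])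
  obtain r where r: "r > 0" "ball x r \<subseteq> W"
    using assms(3,4) openE by blast
  have "(h has_derivative frechet_derivative h (at x)) (at x within S)"
    using C_k_on_SucD[OF assms(5,4)] has_derivative_at_withinI by blast
  then show "(f has_derivative frechet_derivative h (at x)) (at x within S)"
    by (rule has_derivative_transform_within[OF _ r(1) assms(2)])
      (use r(2) assms(6) in \<open>auto simp: subset_iff dist_commute\<close>)
qed

lemma smooth_on_deriv_in:
  assumes "full_tangent S" "smooth_on S f"
  shows "smooth_on S (\<lambda>x. deriv_in S f x v)"
  unfolding smooth_on_def
proof
  fix x assume x: "x \<in> S"
  obtain W h where Wext: "local_extension S f x W h"
    by (rule smooth_onE[OF assms(2) x])
  note W = local_extensionD[OF Wext]
  have "deriv_in S f y = frechet_derivative h (at y)" if "y \<in> S \<inter> W" for y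
    using deriv_in_local[OF assms(1) _ W(1) _ W(3)[of "Suc 0"] W(4)] that by simp
  moreover have "C_k_on n W (\<lambda>x. frechet_derivative h (at x) v)" for n
    using W(3)[of "Suc n"] by simp
  ultimately show "\<exists>W h. open W \<and> x \<in> W \<and> (\<forall>k. C_k_on k W h) \<and> (\<forall>y\<in>S \<inter> W. h y = deriv_in S f y v)"
    using W(1,2) by (intro exI[of _ W] exI[of _ "\<lambda>x. frechet_derivative h (at x) v"]) auto
qed

lemma deriv_in_bounded_linear:
  assumes "full_tangent S" "bounded_linear h" "smooth_on S f" "x \<in> S"
  shows "deriv_in S (\<lambda>x. h (f x)) x v = h (deriv_in S f x v)"
  using deriv_in_eq[OF assms(1,4) bounded_linear.has_derivative[OF assms(2) smooth_on_has_derivative[OF assms(3,4)]]]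
  by simp

lemma deriv_in_bounded_bilinear:
  assumes "full_tangent S" "bounded_bilinear b" "smooth_on S f" "smooth_on S g" "x \<in> S"
  shows "deriv_in S (\<lambda>x. b (f x) (g x)) x v = b (f x) (deriv_in S g x v) + b (deriv_in S f x v) (g x)"
  using deriv_in_eq[OF assms(1,5) bounded_bilinear.FDERIV[OF assms(2) smooth_on_has_derivative[OF assms(3,5)]
      smooth_on_has_derivative[OF assms(4,5)]]]
  by simp

lemmas deriv_in_mult = deriv_in_bounded_bilinear[OF _ bounded_bilinear_mult]
lemmas deriv_in_scaleR = deriv_in_bounded_bilinear[OF _ bounded_bilinear_scaleR]

lemma deriv_in_const: "full_tangent S \<Longrightarrow> x \<in> S \<Longrightarrow> deriv_in S (\<lambda>x. c) x v = 0"
  by (subst deriv_in_eq[of S x _ "\<lambda>_. 0"]) auto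

lemma deriv_in_add:
  assumes "full_tangent S" "smooth_on S f" "smooth_on S g" "x \<in> S"
  shows "deriv_in S (\<lambda>x. f x + g x) x v = deriv_in S f x v + deriv_in S g x v"
  using deriv_in_eq[OF assms(1,4) has_derivative_add[OF smooth_on_has_derivative[OF assms(2,4)]
      smooth_on_has_derivative[OF assms(3,4)]]]
  by simp

lemma deriv_in_diff:
  assumes "full_tangent S" "smooth_on S f" "smooth_on S g" "x \<in> S"
  shows "deriv_in S (\<lambda>x. f x - g x) x v = deriv_in S f x v - deriv_in S g x v"
  using deriv_in_eq[OF assms(1,4) has_derivative_diff[OF smooth_on_has_derivative[OF assms(2,4)]
      smooth_on_has_derivative[OF assms(3,4)]]]
  by simp

lemma deriv_in_sum:
  assumes "full_tangent S" "\<And>i. i \<in> I \<Longrightarrow> smooth_on S (f i)" "x \<in> S"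
  shows "deriv_in S (\<lambda>x. \<Sum>i\<in>I. f i x) x v = (\<Sum>i\<in>I. deriv_in S (f i) x v)"
proof -
  have "((\<lambda>x. \<Sum>i\<in>I. f i x) has_derivative (\<lambda>v. \<Sum>i\<in>I. deriv_in S (f i) x v)) (at x within S)"
    by (intro has_derivative_sum smooth_on_has_derivative assms)
  from deriv_in_eq[OF assms(1,3) this] show ?thesis by simp
qed

lemma deriv_in_compose:
  assumes "full_tangent S" "smooth_on T f" "smooth_on S h" "h ` S \<subseteq> T" "x \<in> S"
  shows "deriv_in S (\<lambda>x. f (h x)) x v = deriv_in T f (h x) (deriv_in S h x v)"
proof -
  have "h x \<in> T" using assms(4,5) by blast
  from has_derivative_subset[OF smooth_on_has_derivative[OF assms(2) this] assms(4)]
  have "((\<lambda>x. f (h x)) has_derivative (\<lambda>v. deriv_in T f (h x) (deriv_in S h x v))) (at x within S)"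
    by (rule has_derivative_in_compose[OF smooth_on_has_derivative[OF assms(3,5)]])
  from deriv_in_eq[OF assms(1,5) this] show ?thesis by simp
qed

text \<open>Component by component, the symmetry is read off an extension, which is smooth on an
  open set; so it holds at boundary points too.\<close>

lemma deriv_in_symmetric:
  fixes f :: "'a::euclidean_space \<Rightarrow> 'b::euclidean_space"
  assumes S: "full_tangent S" and f: "smooth_on S f" and x: "x \<in> S"
  shows "deriv_in S (\<lambda>y. deriv_in S f y v) x w = deriv_in S (\<lambda>y. deriv_in S f y w) x v"
proof (rule euclidean_eqI)
  fix b :: 'b assume "b \<in> Basis"
  have fb: "smooth_on S (\<lambda>y. f y \<bullet> b)"
    by (rule smooth_on_bounded_linear[OF bounded_linear_inner_left f])
  obtain W h where Wext: "local_extension S (\<lambda>y. f y \<bullet> b) x W h"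
    by (rule smooth_onE[OF fb x])
  note W = local_extensionD[OF Wext]
  have 1: "deriv_in S f y v \<bullet> b = frechet_derivative h (at y) v" if "y \<in> S" "y \<in> W" for y v
    using deriv_in_local[OF S that(1) W(1) that(2) W(3)[of "Suc 0"] W(4)]
      deriv_in_bounded_linear[OF S bounded_linear_inner_left f that(1), of b v] by simp
  have "deriv_in S (\<lambda>y. deriv_in S f y v) x w \<bullet> b = frechet_derivative (\<lambda>y. frechet_derivative h (at y) v) (at x) w" for v w
  proof -
    have "deriv_in S (\<lambda>y. deriv_in S f y v) x w \<bullet> b = deriv_in S (\<lambda>y. deriv_in S f y v \<bullet> b) x w"
      by (rule deriv_in_bounded_linear[OF S bounded_linear_inner_left smooth_on_deriv_in[OF S f] x, symmetric])
    also have "\<dots> = frechet_derivative (\<lambda>y. frechet_derivative h (at y) v) (at x) w"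
      by (subst deriv_in_local[OF S x W(1,2), of 0 "\<lambda>y. frechet_derivative h (at y) v"])
        (use W(3)[of 2] 1 in \<open>auto simp: numeral_2_eq_2\<close>)
    finally show ?thesis .
  qed
  then show "deriv_in S (\<lambda>y. deriv_in S f y v) x w \<bullet> b = deriv_in S (\<lambda>y. deriv_in S f y w) x v \<bullet> b"
    using symmetric_derivative_real[OF W(1,2,3)] by simp
qed

lemma full_tangent_open: "open S \<Longrightarrow> full_tangent S"
  unfolding full_tangent_def
proof (intro ballI allI impI)
  fix x i :: 'a and e :: real assume "open S" "x \<in> S" "i \<in> Basis" "e > 0"
  then obtain r where "r > 0" "ball x r \<subseteq> S" using openE by blast
  then have "x + (min r e / 2) *\<^sub>R i \<in> S"
    using \<open>e > 0\<close> \<open>i \<in> Basis\<close> by (auto simp: subset_iff dist_norm)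
  then show "\<exists>d. 0 < \<bar>d\<bar> \<and> \<bar>d\<bar> < e \<and> x + d *\<^sub>R i \<in> S"
    using \<open>r > 0\<close> \<open>e > 0\<close> by (intro exI[of _ "min r e / 2"]) auto
qed

text \<open>Basis vectors have a nonnegative constrained coordinate, so small positive multiples of
  them never lead out of the half-space, and \<open>full_tangent\<close> asks for one sign
  only.\<close>

lemma full_tangent_half_space:
  fixes S :: "(real^'n::finite) set"
  assumes "openin (top_of_set half_space) S"
  shows "full_tangent S"
  unfolding full_tangent_def
proof (intro ballI allI impI)
  fix x i :: "real^'n" and e :: real assume *: "x \<in> S" "i \<in> Basis" "e > 0"
  obtain T where T: "open T" "S = half_space \<inter> T"
    using assms by (auto simp: openin_open)
  then obtain r where r: "r > 0" "ball x r \<subseteq> T" using * openE by blast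
  have "0 \<le> i $ bdry_index"
    using *(2) by (auto simp: Basis_vec_def axis_def)
  then have "x + (min r e / 2) *\<^sub>R i \<in> S"
    using r * T by (auto simp: subset_iff dist_norm half_space_def)
  then show "\<exists>d. 0 < \<bar>d\<bar> \<and> \<bar>d\<bar> < e \<and> x + d *\<^sub>R i \<in> S"
    using \<open>r > 0\<close> \<open>e > 0\<close> by (intro exI[of _ "min r e / 2"]) auto
qed

lemma full_tangent_Times:
  assumes "full_tangent S" "full_tangent T"
  shows "full_tangent (S \<times> T)"
  using assms unfolding full_tangent_def Basis_prod_def by fastforce

section \<open>Functions of time and position\<close>

lemma smooth_on_slice:
  fixes f :: "'a::euclidean_space \<times> 'b::euclidean_space \<Rightarrow> 'c::real_normed_vector"
  assumes "smooth_on (T \<times> S) f" "t \<in> T"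
  shows "smooth_on S (\<lambda>y. f (t, y))"
  by (rule smooth_on_compose[OF assms(1) smooth_on_Pair[OF smooth_on_const smooth_on_ident]])
    (use assms(2) in auto)

text \<open>Space derivatives at a fixed time become joint derivatives in the directions (0, v).
  With time as the direction (1, 0), the exchange of time and space derivatives is then an instance
  of \<open>deriv_in_symmetric\<close>.\<close>

lemma deriv_in_slice:
  fixes f :: "'a::euclidean_space \<times> 'b::euclidean_space \<Rightarrow> 'c::real_normed_vector"
  assumes "full_tangent S" "smooth_on (T \<times> S) f" "t \<in> T" "y \<in> S"
  shows "deriv_in S (\<lambda>y. f (t, y)) y v = deriv_in (T \<times> S) f (t, y) (0, v)"
proof -
  have "deriv_in S (Pair t) y v = (0, v)"
    by (subst deriv_in_eq[OF assms(1,4), of "Pair t" "\<lambda>v. (0, v)"]) (auto intro!: derivative_eq_intros)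
  then show ?thesis
    using deriv_in_compose[OF assms(1,2) smooth_on_Pair[OF smooth_on_const smooth_on_ident], of t y v] assms(3,4)
    by auto
qed

lemma has_vector_derivative_slice:
  fixes f :: "real \<times> 'b::euclidean_space \<Rightarrow> 'c::real_normed_vector"
  assumes "smooth_on (T \<times> S) f" "open T" "t \<in> T" "y \<in> S"
  shows "((\<lambda>s. f (s, y)) has_vector_derivative deriv_in (T \<times> S) f (t, y) (1, 0)) (at t)"
proof -
  have "((\<lambda>s. (s, y)) has_derivative (\<lambda>s. (s, 0))) (at t within T)"
    by (auto intro!: derivative_eq_intros)
  moreover have "(f has_derivative deriv_in (T \<times> S) f (t, y)) (at (t, y) within (\<lambda>s. (s, y)) ` T)"
    by (rule has_derivative_subset[OF smooth_on_has_derivative[OF assms(1)]]) (use assms in auto)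
  ultimately have 1: "((\<lambda>s. f (s, y)) has_derivative (\<lambda>s. deriv_in (T \<times> S) f (t, y) (s, 0))) (at t within T)"
    by (rule has_derivative_in_compose)
  have 2: "deriv_in (T \<times> S) f (t, y) (s, 0) = s *\<^sub>R deriv_in (T \<times> S) f (t, y) (1, 0)" for s
    using linear_cmul[OF linear_deriv_in[OF assms(1), of "(t, y)"], of s "(1, 0)"] assms by auto
  have "((\<lambda>s. f (s, y)) has_derivative (\<lambda>s. s *\<^sub>R deriv_in (T \<times> S) f (t, y) (1, 0))) (at t within T)"
    by (rule has_derivative_eq_rhs[OF 1]) (rule ext, rule 2)
  then show ?thesis
    by (simp add: has_vector_derivative_def at_within_open[OF assms(3,2)])
qed

section \<open>Matrix-valued functions and determinants\<close>

lemma smooth_on_vec_lambda: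
  fixes f :: "'i::finite \<Rightarrow> 'a::real_normed_vector \<Rightarrow> 'b::euclidean_space"
  assumes "\<And>i. smooth_on S (f i)"
  shows "smooth_on S (\<lambda>y. \<chi> i. f i y)"
proof -
  have "bounded_linear (\<lambda>a::'b. \<chi> j. if j = i then a else 0)" for i :: 'i
    unfolding linear_conv_bounded_linear[symmetric] by (rule linearI) (auto simp: vec_eq_iff)
  then have "smooth_on S (\<lambda>y. \<Sum>i\<in>UNIV. (\<chi> j. if j = i then f i y else 0))"
    by (intro smooth_on_sum smooth_on_bounded_linear[OF _ assms])
  then show ?thesis
    by (rule smooth_on_cong) (simp add: vec_eq_iff sum_component if_distrib)
qed

lemma smooth_on_vec_nth: "smooth_on S f \<Longrightarrow> smooth_on S (\<lambda>y. f y $ i)"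
  by (rule smooth_on_bounded_linear[OF bounded_linear_vec_nth])

lemma deriv_in_vec_nth:
  assumes "full_tangent S" "smooth_on S f" "x \<in> S"
  shows "deriv_in S (\<lambda>y. f y $ i) x v = deriv_in S f x v $ i"
  by (rule deriv_in_bounded_linear[OF assms(1) bounded_linear_vec_nth assms(2,3)])

lemma bounded_bilinear_matrix_mult: "bounded_bilinear ((**) :: real^'n::finite^'m::finite \<Rightarrow> real^'p::finite^'n \<Rightarrow> _)"
  unfolding bilinear_conv_bounded_bilinear[symmetric] bilinear_def
  by (auto intro!: linearI simp: matrix_matrix_mult_def vec_eq_iff sum.distrib sum_distrib_left algebra_simps)

lemma bounded_linear_trace: "bounded_linear (trace :: real^'n::finite^'n \<Rightarrow> real)"
  unfolding linear_conv_bounded_linear[symmetric]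
  by (rule linearI) (auto simp: trace_def sum.distrib sum_distrib_left)

lemma smooth_on_det:
  fixes G :: "'a::real_normed_vector \<Rightarrow> real^'n::finite^'n"
  assumes "smooth_on S G"
  shows "smooth_on S (\<lambda>y. det (G y))"
  unfolding det_def
  by (intro smooth_on_sum smooth_on_cmult smooth_on_prod smooth_on_vec_nth assms)

lemma matrix_inv_works:
  fixes G :: "real^'n::finite^'n"
  assumes "det G \<noteq> 0"
  shows "matrix_inv G ** G = mat 1" "G ** matrix_inv G = mat 1"
proof -
  have "\<exists>B. G ** B = mat 1 \<and> B ** G = mat 1"
    using assms invertible_det_nz[of G] by (simp add: invertible_def)
  from someI_ex[OF this] show "matrix_inv G ** G = mat 1" "G ** matrix_inv G = mat 1"
    unfolding matrix_inv_def by auto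
qed

text \<open>Cramer's rule exhibits the entries of the inverse as quotients of polynomials in the
  entries of G; smoothness of the inverse is read off from this.\<close>

lemma matrix_inv_cramer:
  fixes G :: "real^'n::finite^'n"
  assumes "det G \<noteq> 0"
  shows "matrix_inv G = (\<chi> k l. det (\<chi> i j. if j = k then axis l 1 $ i else G $ i $ j) / det G)"
proof -
  have "G *v (matrix_inv G *v axis l 1) = axis l 1" for l
    using matrix_inv_works[OF assms] by (simp add: matrix_vector_mul_assoc)
  then have *: "matrix_inv G *v axis l 1 = (\<chi> k. det (\<chi> i j. if j = k then axis l 1 $ i else G $ i $ j) / det G)" for l
    using cramer[OF assms] by blast
  have "matrix_inv G $ k $ l = (matrix_inv G *v axis l 1) $ k" for k l
    by (simp add: matrix_vector_mult_basis column_def)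
  then show ?thesis
    unfolding * by (simp add: vec_eq_iff)
qed

lemma smooth_on_matrix_inv:
  fixes G :: "'a::real_normed_vector \<Rightarrow> real^'n::finite^'n"
  assumes "smooth_on S G" "\<And>y. y \<in> S \<Longrightarrow> det (G y) \<noteq> 0"
  shows "smooth_on S (\<lambda>y. matrix_inv (G y))"
proof -
  have 1: "smooth_on S (\<lambda>y. if c then a else G y $ i $ j)" for a c i j
    by (cases c) (auto intro!: smooth_on_const smooth_on_vec_nth assms(1))
  have "smooth_on S (\<lambda>y. \<chi> k l. det (\<chi> i j. if j = k then axis l 1 $ i else G y $ i $ j) / det (G y))"
    by (intro smooth_on_vec_lambda smooth_on_divide smooth_on_det assms 1)
  then show ?thesis
    by (rule smooth_on_cong) (simp add: matrix_inv_cramer assms(2))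
qed

text \<open>In the Leibniz expansion a permutation other than the identity moves at least two
  points, so after one factor has been differentiated an off-diagonal entry of the identity matrix,
  hence a zero, is left. Only the identity permutation contributes.\<close>

lemma has_derivative_det_mat_1:
  fixes B :: "'a::real_normed_vector \<Rightarrow> real^'n::finite^'n"
  assumes B: "(B has_derivative B') (at x within S)" and x: "B x = mat 1"
  shows "((\<lambda>y. det (B y)) has_derivative (\<lambda>v. trace (B' v))) (at x within S)"
proof -
  have d: "((\<lambda>y. B y $ i $ j) has_derivative (\<lambda>v. B' v $ i $ j)) (at x within S)" for i j
    by (intro bounded_linear.has_derivative[OF bounded_linear_vec_nth] B)
  let ?P = "{p. p permutes (UNIV::'n set)}"
  define T where "T p v = of_int (sign p) * (\<Sum>i\<in>UNIV. B' v $ i $ p i * (\<Prod>j\<in>UNIV - {i}. B x $ j $ p j))" for p v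
  have "((\<lambda>y. det (B y)) has_derivative (\<lambda>v. \<Sum>p\<in>?P. T p v)) (at x within S)"
    unfolding det_def T_def
    by (intro has_derivative_sum has_derivative_mult_right has_derivative_prod d)
  moreover have "(\<Sum>p\<in>?P. T p v) = trace (B' v)" for v
  proof -
    have "T p v = 0" if p: "p \<in> ?P - {id}" for p
    proof -
      have "(\<Prod>j\<in>UNIV - {i}. B x $ j $ p j) = 0" for i
      proof -
        obtain a where a: "p a \<noteq> a" using p by (auto simp: fun_eq_iff)
        have inj: "inj p" using p permutes_inj by blast
        \<comment> \<open>If the moved point a is the differentiated index i itself, its image is
          another moved point.\<close>
        have "\<exists>j. j \<noteq> i \<and> p j \<noteq> j"
        proof (cases "a = i")
          case True
          then have "p (p a) \<noteq> p a" "p a \<noteq> i" using a inj by (auto dest: injD)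
          then show ?thesis by blast
        qed (use a in blast)
        then obtain j where "j \<noteq> i" "p j \<noteq> j" by blast
        then show ?thesis
          by (intro prod_zero) (auto simp: x mat_def intro!: bexI[of _ j])
      qed
      then show ?thesis unfolding T_def by (simp only: mult_zero_right sum.neutral_const)
    qed
    then have "(\<Sum>p\<in>?P. T p v) = (\<Sum>p\<in>{id}. T p v)"
      by (intro sum.mono_neutral_right) (auto simp: permutes_id finite_permutations)
    also have "\<dots> = trace (B' v)"
      by (simp add: T_def x mat_def trace_def sign_id)
    finally show ?thesis .
  qed
  ultimately show ?thesis by simp
qed

text \<open>Jacobi's formula: factoring out the constant matrix \<open>G x\<close> moves the base
  point to the identity matrix.\<close>

lemma has_derivative_det:
  fixes G :: "'a::real_normed_vector \<Rightarrow> real^'n::finite^'n"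
  assumes G: "(G has_derivative G') (at x within S)" and x: "det (G x) \<noteq> 0"
  shows "((\<lambda>y. det (G y)) has_derivative (\<lambda>v. det (G x) * trace (matrix_inv (G x) ** G' v))) (at x within S)"
proof -
  define B where "B y = matrix_inv (G x) ** G y" for y
  have "bounded_linear (\<lambda>A. matrix_inv (G x) ** A)"
    by (rule bounded_bilinear.bounded_linear_right[OF bounded_bilinear_matrix_mult])
  then have "(B has_derivative (\<lambda>v. matrix_inv (G x) ** G' v)) (at x within S)"
    unfolding B_def by (rule bounded_linear.has_derivative) (rule G)
  then have "((\<lambda>y. det (B y)) has_derivative (\<lambda>v. trace (matrix_inv (G x) ** G' v))) (at x within S)"
    by (rule has_derivative_det_mat_1) (simp add: B_def matrix_inv_works x)
  then have "((\<lambda>y. det (G x) * det (B y)) has_derivative (\<lambda>v. det (G x) * trace (matrix_inv (G x) ** G' v))) (at x within S)"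
    by (rule has_derivative_mult_right)
  moreover have "det (G x) * det (B y) = det (G y)" for y
  proof -
    have "G x ** B y = G y"
      by (simp add: B_def matrix_mul_assoc matrix_inv_works x)
    then show ?thesis using det_mul by metis
  qed
  ultimately show ?thesis by simp
qed

lemma deriv_in_matrix_inv:
  fixes G :: "'a::euclidean_space \<Rightarrow> real^'n::finite^'n"
  assumes S: "full_tangent S" and G: "smooth_on S G" and nz: "\<And>y. y \<in> S \<Longrightarrow> det (G y) \<noteq> 0" and x: "x \<in> S"
  shows "deriv_in S (\<lambda>y. matrix_inv (G y)) x v = - (matrix_inv (G x) ** deriv_in S G x v ** matrix_inv (G x))"
    (is "?D = _")
proof -
  have "0 = deriv_in S (\<lambda>y. matrix_inv (G y) ** G y) x v"
    using deriv_in_cong[OF x, of "\<lambda>y. matrix_inv (G y) ** G y" "\<lambda>y. mat 1"]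
    by (simp add: matrix_inv_works nz deriv_in_const[OF S x])
  also have "\<dots> = matrix_inv (G x) ** deriv_in S G x v + ?D ** G x"
    by (rule deriv_in_bounded_bilinear[OF S bounded_bilinear_matrix_mult smooth_on_matrix_inv[OF G nz] G x])
  finally have "?D ** G x = - (matrix_inv (G x) ** deriv_in S G x v)"
    by (simp add: eq_neg_iff_add_eq_0 add.commute)
  then have "?D ** (G x ** matrix_inv (G x)) = - (matrix_inv (G x) ** deriv_in S G x v ** matrix_inv (G x))"
    by (simp add: matrix_mul_assoc bounded_bilinear.minus_left[OF bounded_bilinear_matrix_mult])
  then show ?thesis by (simp add: matrix_inv_works nz x)
qed

lemma deriv_in_sqrt_det:
  fixes G :: "'a::euclidean_space \<Rightarrow> real^'n::finite^'n"
  assumes S: "full_tangent S" and G: "smooth_on S G" and pos: "det (G x) > 0" and x: "x \<in> S"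
  shows "deriv_in S (\<lambda>y. sqrt (det (G y))) x v =
    sqrt (det (G x)) / 2 * trace (matrix_inv (G x) ** deriv_in S G x v)"
proof -
  have "((\<lambda>y. det (G y)) has_derivative (\<lambda>v. det (G x) * trace (matrix_inv (G x) ** deriv_in S G x v))) (at x within S)"
    using has_derivative_det[OF smooth_on_has_derivative[OF G x]] pos by simp
  from has_derivative_real_sqrt[OF pos this]
  have "((\<lambda>y. sqrt (det (G y))) has_derivative
    (\<lambda>v. sqrt (det (G x)) / 2 * trace (matrix_inv (G x) ** deriv_in S G x v))) (at x within S)"
    by (rule has_derivative_eq_rhs) (use pos in \<open>auto simp: fun_eq_iff field_simps\<close>)
  from deriv_in_eq[OF S x this] show ?thesis by simp
qed

text \<open>Without \<open>tr0\<close> the product rule would add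
  \<open>sqrt (det (G x)) / 4\<close> times the square of the trace of the inverse of G times its
  derivative. In the application that trace is a multiple of tr A.\<close>

lemma deriv_in_deriv_in_sqrt_det:
  fixes G :: "'a::euclidean_space \<Rightarrow> real^'n::finite^'n"
  assumes S: "full_tangent S" and G: "smooth_on S G" and pos: "\<And>y. y \<in> S \<Longrightarrow> det (G y) > 0" and x: "x \<in> S"
    and tr0: "trace (matrix_inv (G x) ** deriv_in S G x v) = 0"
  shows "deriv_in S (\<lambda>y. deriv_in S (\<lambda>y. sqrt (det (G y))) y v) x v =
    sqrt (det (G x)) / 2 * (trace (matrix_inv (G x) ** deriv_in S (\<lambda>y. deriv_in S G y v) x v)
      - trace ((matrix_inv (G x) ** deriv_in S G x v) ** (matrix_inv (G x) ** deriv_in S G x v)))"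
proof -
  let ?I = "\<lambda>y. matrix_inv (G y)"
  have nz: "det (G y) \<noteq> 0" if "y \<in> S" for y using pos[OF that] by simp
  note sI = smooth_on_matrix_inv[OF G nz] and sD = smooth_on_deriv_in[OF S G, of v]
  have sID: "smooth_on S (\<lambda>y. ?I y ** deriv_in S G y v)"
    by (rule smooth_on_bounded_bilinear[OF bounded_bilinear_matrix_mult sI sD])
  have sw: "smooth_on S (\<lambda>y. sqrt (det (G y)) / 2)"
    by (intro smooth_on_divide smooth_on_sqrt smooth_on_det G pos smooth_on_const) auto
  have "deriv_in S (\<lambda>y. deriv_in S (\<lambda>y. sqrt (det (G y))) y v) x v =
    deriv_in S (\<lambda>y. sqrt (det (G y)) / 2 * trace (?I y ** deriv_in S G y v)) x v"
    by (subst deriv_in_cong[OF x]) (auto simp: deriv_in_sqrt_det[OF S G pos])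
  also have "\<dots> = sqrt (det (G x)) / 2 * deriv_in S (\<lambda>y. trace (?I y ** deriv_in S G y v)) x v"
    by (subst deriv_in_mult[OF S sw smooth_on_bounded_linear[OF bounded_linear_trace sID] x]) (simp add: tr0)
  also have "deriv_in S (\<lambda>y. trace (?I y ** deriv_in S G y v)) x v =
      trace (deriv_in S (\<lambda>y. ?I y ** deriv_in S G y v) x v)"
    by (rule deriv_in_bounded_linear[OF S bounded_linear_trace sID x])
  also have "deriv_in S (\<lambda>y. ?I y ** deriv_in S G y v) x v =
      ?I x ** deriv_in S (\<lambda>y. deriv_in S G y v) x v + deriv_in S ?I x v ** deriv_in S G x v"
    by (rule deriv_in_bounded_bilinear[OF S bounded_bilinear_matrix_mult sI sD x])
  also have "deriv_in S ?I x v = - (?I x ** deriv_in S G x v ** ?I x)"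
    by (rule deriv_in_matrix_inv[OF S G nz x])
  finally show ?thesis
    by (simp add: matrix_mul_assoc bounded_bilinear.minus_left[OF bounded_bilinear_matrix_mult]
        linear_diff[OF bounded_linear.linear[OF bounded_linear_trace]])
qed

lemma positive_definite_nonsingular:
  assumes "positive_definite G" shows "det G \<noteq> 0"
proof -
  have "inj ((*v) G)"
  proof (rule inj_onI)
    fix x y assume "G *v x = G *v y"
    then have "G *v (x - y) = 0" by (simp add: matrix_vector_mult_diff_distrib)
    then show "x = y"
      using assms unfolding positive_definite_def
      by (metis eq_iff_diff_eq_0 inner_zero_right less_irrefl)
  qed
  then show ?thesis
    using det_nz_iff_inj[OF matrix_vector_mul_linear, of G] by simp
qed

text \<open>The segment from the identity matrix to G stays positive definite, so the determinant
  cannot vanish along it and keeps the sign it has at the identity.\<close>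

lemma positive_definite_det_pos:
  fixes G :: "real^'n::finite^'n"
  assumes G: "positive_definite G" shows "det G > 0"
proof (rule ccontr)
  assume "\<not> det G > 0"
  define H where "H s = (1 - s) *\<^sub>R mat 1 + s *\<^sub>R G" for s :: real
  have "det (H s) \<noteq> 0" if "0 \<le> s" "s \<le> 1" for s
  proof (rule positive_definite_nonsingular)
    show "positive_definite (H s)"
      unfolding positive_definite_def
    proof (intro conjI allI impI)
      have "transpose (H s) = (1 - s) *\<^sub>R mat 1 + s *\<^sub>R transpose G"
        by (simp add: H_def vec_eq_iff transpose_def mat_def)
      then show "transpose (H s) = H s"
        using G by (simp add: H_def positive_definite_def)
      fix v :: "real^'n" assume v: "v \<noteq> 0"
      have "H s *v v = (1 - s) *\<^sub>R v + s *\<^sub>R (G *v v)"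
        by (simp add: H_def matrix_vector_mult_add_rdistrib scaleR_matrix_vector_assoc[symmetric])
      then have "v \<bullet> (H s *v v) = (1 - s) * (v \<bullet> v) + s * (v \<bullet> (G *v v))"
        by (simp add: inner_add_right)
      moreover have "v \<bullet> v > 0" "v \<bullet> (G *v v) > 0"
        using v G by (auto simp: positive_definite_def)
      ultimately show "0 < v \<bullet> (H s *v v)"
        using that by (cases "s = 0") (auto intro!: add_nonneg_pos)
    qed
  qed
  moreover have "det (H 0) = 1" by (simp add: H_def)
  moreover have "H 1 = G" by (simp add: H_def)
  moreover have "continuous_on {0..1} (\<lambda>s. det (H s))"
    unfolding H_def det_def by (intro continuous_intros)
  ultimately show False
    using IVT2'[of "\<lambda>s. det (H s)" 1 0 0] \<open>\<not> det G > 0\<close> by force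
qed

section \<open>Integration over pieces of a half-space\<close>

lemma half_space_closed: "closed half_space"
  unfolding half_space_def by (rule closed_halfspace_component_ge_cart)

lemma half_space_convex: "convex (half_space :: (real^'n::finite) set)"
proof -
  have "half_space = {y :: real^'n. axis bdry_index 1 \<bullet> y \<ge> 0}"
    by (simp add: half_space_def inner_axis')
  then show ?thesis
    using convex_halfspace_ge[of 0 "axis bdry_index 1 :: real^'n"] by simp
qed

text \<open>One face of the box lies in the bounding hyperplane, so the box catches points of K
  there without leaving the half-space. Integrands supported in K can then be integrated over one
  box for all times.\<close>

lemma compact_subset_cbox_half_space:
  fixes K :: "(real^'n::finite) set"
  assumes "compact K" "K \<subseteq> half_space"
  obtains a b where "K \<subseteq> cbox a b" "cbox a b \<subseteq> half_space"
proof -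
  obtain B where B: "\<And>x. x \<in> K \<Longrightarrow> norm x \<le> B"
    using compact_imp_bounded[OF assms(1)] bounded_iff by metis
  define a :: "real^'n" where "a = (\<chi> i. if i = bdry_index then 0 else - B)"
  define b :: "real^'n" where "b = (\<chi> i. B)"
  have "x \<in> cbox a b" if "x \<in> K" for x
  proof -
    have "\<bar>x $ i\<bar> \<le> B" for i
      using B[OF that] component_le_norm_cart[of x i] by linarith
    moreover have "0 \<le> x $ bdry_index" using assms(2) that by (auto simp: half_space_def)
    ultimately show ?thesis by (auto simp: a_def b_def mem_box_cart abs_le_iff minus_le_iff)
  qed
  moreover have "cbox a b \<subseteq> half_space"
  proof
    fix x assume "x \<in> cbox a b"
    then have "a $ bdry_index \<le> x $ bdry_index" by (simp add: mem_box_cart)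
    then show "x \<in> half_space" by (simp add: half_space_def a_def)
  qed
  ultimately show thesis using that by blast
qed

lemma openin_Diff_closed: "closed K \<Longrightarrow> openin (top_of_set X) (X - K)"
  unfolding openin_open by (intro exI[of _ "- K"]) auto

lemma continuous_on_extend_zero:
  fixes f :: "'a::topological_space \<Rightarrow> 'b::real_normed_vector"
  assumes "openin (top_of_set X) A" "openin (top_of_set X) B" "A \<union> B = X"
    and "continuous_on A f" "\<And>x. x \<in> A \<Longrightarrow> x \<in> B \<Longrightarrow> f x = 0"
  shows "continuous_on X (\<lambda>x. if x \<in> A then f x else 0)"
proof -
  have 1: "continuous_on A (\<lambda>x. if x \<in> A then f x else 0)"
    using assms(4) by (rule continuous_on_eq) simp
  have 2: "continuous_on B (\<lambda>x. if x \<in> A then f x else 0)"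
    by (rule continuous_on_eq[OF continuous_on_const[of _ 0]]) (use assms(5) in auto)
  show ?thesis
    using continuous_on_Un_local_open[of A B, unfolded assms(3), OF assms(1,2) 1 2] .
qed

text \<open>S and the complement of K are relatively open and cover the half-space; the extension is
  f on the first and zero on the second.\<close>

lemma continuous_on_extend_zero_half_space:
  assumes S: "openin (top_of_set half_space) S" and K: "compact K" "K \<subseteq> S"
    and f: "continuous_on S f" "\<And>y. y \<in> S \<Longrightarrow> y \<notin> K \<Longrightarrow> f y = (0::real)"
  shows "continuous_on half_space (\<lambda>y. if y \<in> S then f y else 0)"
proof (rule continuous_on_extend_zero[OF S, of "half_space - K"])
  show "openin (top_of_set half_space) (half_space - K)"
    by (rule openin_Diff_closed[OF compact_imp_closed[OF K(1)]])
  show "S \<union> (half_space - K) = half_space"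
    using K(2) openin_imp_subset[OF S] by auto
qed (use f in auto)

text \<open>Passes from the Lebesgue integral over S to a gauge integral over a box, the form in
  which differentiation under the integral sign is applied.\<close>

lemma set_integral_compact_support:
  assumes S: "openin (top_of_set half_space) S" and K: "compact K" "K \<subseteq> S"
    and f: "continuous_on S f" "\<And>y. y \<in> S \<Longrightarrow> y \<notin> K \<Longrightarrow> f y = (0::real)"
    and box: "K \<subseteq> cbox a b" "cbox a b \<subseteq> half_space"
  shows "set_integrable lborel S f"
    and "(LINT y:S|lborel. f y) = integral (cbox a b) (\<lambda>y. if y \<in> S then f y else 0)"
proof -
  let ?f = "\<lambda>y. if y \<in> S then f y else 0"
  have c: "continuous_on (cbox a b) ?f"
    by (rule continuous_on_subset[OF continuous_on_extend_zero_half_space[OF S K f] box(2)])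
  have i: "set_integrable lborel (cbox a b) ?f"
    unfolding set_integrable_def by (rule borel_integrable_compact[OF compact_cbox c])
  have eq: "indicat_real S y *\<^sub>R f y = indicat_real (cbox a b) y *\<^sub>R ?f y" for y
    using box f(2) by (auto simp: indicator_def)
  show "set_integrable lborel S f"
    using i unfolding set_integrable_def eq .
  have "(LINT y:S|lborel. f y) = (LINT y:cbox a b|lborel. ?f y)"
    unfolding set_lebesgue_integral_def eq ..
  then show "(LINT y:S|lborel. f y) = integral (cbox a b) ?f"
    using set_borel_integral_eq_integral(2)[OF i] by simp
qed

lemma set_integrable_compact_support:
  assumes S: "openin (top_of_set half_space) S" and K: "compact K" "K \<subseteq> S"
    and f: "continuous_on S f" "\<And>y. y \<in> S \<Longrightarrow> y \<notin> K \<Longrightarrow> f y = (0::real)"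
  shows "set_integrable lborel S f"
proof -
  obtain a b where "K \<subseteq> cbox a b" "cbox a b \<subseteq> half_space"
    using compact_subset_cbox_half_space[OF K(1)] K(2) openin_imp_subset[OF S] by (metis order.trans)
  then show ?thesis using set_integral_compact_support(1)[OF S K f] by blast
qed

text \<open>Leibniz rule for the zero extensions over a fixed box; joint continuity in (t, y) comes
  from gluing along S and the complement of K once more, now multiplied by I.\<close>

lemma has_real_derivative_set_integral:
  fixes f f' :: "real \<times> (real^'n::finite) \<Rightarrow> real"
  assumes S: "openin (top_of_set half_space) S" and K: "compact K" "K \<subseteq> S" and I: "open I" "convex I"
    and f: "continuous_on (I \<times> S) f" "\<And>t y. t \<in> I \<Longrightarrow> y \<in> S \<Longrightarrow> y \<notin> K \<Longrightarrow> f (t, y) = 0"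
    and f': "continuous_on (I \<times> S) f'" "\<And>t y. t \<in> I \<Longrightarrow> y \<in> S \<Longrightarrow> y \<notin> K \<Longrightarrow> f' (t, y) = 0"
    and deriv: "\<And>t y. t \<in> I \<Longrightarrow> y \<in> S \<Longrightarrow> ((\<lambda>t. f (t, y)) has_real_derivative f' (t, y)) (at t)"
    and t: "t \<in> I"
  shows "((\<lambda>t. LINT y:S|lborel. f (t, y)) has_real_derivative (LINT y:S|lborel. f' (t, y))) (at t)"
proof -
  obtain a b where box: "K \<subseteq> cbox a b" "cbox a b \<subseteq> half_space"
    using compact_subset_cbox_half_space[OF K(1)] K(2) openin_imp_subset[OF S] by (metis order.trans)
  have cs: "continuous_on S (\<lambda>y. f (t, y))" "continuous_on S (\<lambda>y. f' (t, y))" if "t \<in> I" for t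
    using that by (auto intro!: continuous_on_compose2[OF f(1)] continuous_on_compose2[OF f'(1)] continuous_intros)
  let ?f = "\<lambda>t y. if y \<in> S then f (t, y) else 0" and ?f' = "\<lambda>t y. if y \<in> S then f' (t, y) else 0"
  have op: "openin (top_of_set (I \<times> half_space)) (I \<times> S)"
    using S by (simp add: openin_Times_eq)
  have op2: "openin (top_of_set (I \<times> half_space)) (I \<times> (half_space - K))"
    using openin_Diff_closed[OF compact_imp_closed[OF K(1)], of half_space] by (simp add: openin_Times_eq)
  have "continuous_on (I \<times> half_space) (\<lambda>z. if z \<in> I \<times> S then f' z else 0)"
    by (rule continuous_on_extend_zero[OF op op2 _ f'(1)])
      (use K(2) openin_imp_subset[OF S] f'(2) in auto)
  then have "continuous_on (I \<times> cbox a b) (\<lambda>z. if z \<in> I \<times> S then f' z else 0)"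
    by (rule continuous_on_subset) (use box(2) in auto)
  then have cf': "continuous_on (I \<times> cbox a b) (\<lambda>(t, y). ?f' t y)"
    by (rule continuous_on_eq) (auto split: if_splits)
  have "((\<lambda>t. integral (cbox a b) (?f t)) has_real_derivative integral (cbox a b) (?f' t)) (at t within I)"
  proof (rule leibniz_rule_field_derivative[OF _ _ cf' t I(2)])
    show "((\<lambda>t. ?f t y) has_real_derivative ?f' t y) (at t within I)" if "t \<in> I" for t y
      using deriv[OF that, of y] by (cases "y \<in> S") (auto intro: has_field_derivative_at_within)
    show "?f t integrable_on cbox a b" if "t \<in> I" for t
      using continuous_on_subset[OF continuous_on_extend_zero_half_space[OF S K cs(1)[OF that] f(2)[OF that]] box(2)]
      by (intro integrable_continuous)
  qed
  then have "((\<lambda>t. integral (cbox a b) (?f t)) has_real_derivative integral (cbox a b) (?f' t)) (at t)"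
    using at_within_open[OF t I(1)] by simp
  then have "((\<lambda>t. LINT y:S|lborel. f (t, y)) has_real_derivative integral (cbox a b) (?f' t)) (at t)"
    by (rule has_field_derivative_transform_within_open[OF _ I(1) t])
      (use set_integral_compact_support(2)[OF S K cs(1) f(2) box] in simp)
  then show ?thesis
    using set_integral_compact_support(2)[OF S K cs(2)[OF t] f'(2)[OF t] box] by simp
qed

lemma deriv_in_eq_0:
  assumes "full_tangent S" "y \<in> S" "open U" "y \<in> U" "\<And>z. z \<in> S \<Longrightarrow> z \<in> U \<Longrightarrow> w z = 0"
  shows "deriv_in S w y = (\<lambda>v. 0)"
proof (rule deriv_in_eq[OF assms(1,2)])
  obtain r where r: "r > 0" "ball y r \<subseteq> U"
    using assms(3,4) openE by blast
  show "(w has_derivative (\<lambda>v. 0)) (at y within S)"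
    by (rule has_derivative_transform_within[OF has_derivative_const[of 0] r(1) assms(2)])
      (use r(2) assms(5) in \<open>auto simp: subset_iff dist_commute\<close>)
qed

text \<open>
  By translation invariance the difference quotients of \<open>w\<close>, extended by zero, integrate to \<open>0\<close>. They are
  dominated because the extension is Lipschitz: clamping the constrained coordinate at \<open>0\<close> does not change it.
\<close>

lemma integral_deriv_in_eq_0:
  fixes w :: "real^'n::finite \<Rightarrow> real"
  assumes S: "openin (top_of_set half_space) S" and K: "compact K" "K \<subseteq> S"
    and w: "smooth_on S w" "\<And>y. y \<in> S \<Longrightarrow> y \<notin> K \<Longrightarrow> w y = 0"
    and bdry: "\<And>y. y \<in> S \<Longrightarrow> y $ bdry_index = 0 \<Longrightarrow> w y = 0"
  shows "(LINT y:S|lborel. deriv_in S w y (axis i 1)) = 0"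
proof -
  define e :: "real^'n" where "e = axis i 1"
  define W where "W y = (if y \<in> S then w y else 0)" for y
  note ft = full_tangent_half_space[OF S]
  have SH: "S \<subseteq> half_space" using openin_imp_subset[OF S] .
  obtain T where T: "open T" "S = half_space \<inter> T"
    using S by (auto simp: openin_open)
  have oK: "open (- K)" using compact_imp_closed[OF K(1)] by auto
  have W0: "W y = 0" if "y \<notin> K" for y
    using that w(2) by (auto simp: W_def)
  have d0: "deriv_in S w y = (\<lambda>v. 0)" if "y \<in> S" "y \<notin> K" for y
    by (rule deriv_in_eq_0[OF ft that(1) oK]) (use that w(2) in auto)
  have dW: "(W has_derivative deriv_in S w y) (at y within S)" if "y \<in> S" for y
    by (rule has_derivative_transform[OF that _ smooth_on_has_derivative[OF w(1) that]]) (simp add: W_def)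
  have dS: "(W has_derivative deriv_in S w y) (at y within half_space)" if "y \<in> S" for y
  proof -
    have "at y within half_space = at y within S"
      by (rule at_within_nhd[of y T]) (use T that in auto)
    then show ?thesis using dW[OF that] by simp
  qed
  have dN: "(W has_derivative (\<lambda>v. 0)) (at y within X)" if "y \<notin> K" for y X
  proof -
    have "(W has_derivative (\<lambda>v. 0)) (at y)"
      by (rule has_derivative_transform_within_open[OF has_derivative_const[of 0] oK]) (use that W0 in auto)
    then show ?thesis by (rule has_derivative_at_withinI)
  qed
  define L where "L y = (if y \<in> S then deriv_in S w y else (\<lambda>v. 0))" for y
  have dH: "(W has_derivative L y) (at y within half_space)" for y
    using dS dN K(2) by (auto simp: L_def)
  have "\<exists>B. \<forall>y\<in>K. \<bar>deriv_in S w y (axis j 1)\<bar> \<le> B" for j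
  proof -
    have "continuous_on K (\<lambda>y. deriv_in S w y (axis j 1))"
      using smooth_on_imp_continuous_on[OF smooth_on_deriv_in[OF ft w(1)]] K(2) continuous_on_subset by blast
    then have "bounded ((\<lambda>y. deriv_in S w y (axis j 1)) ` K)"
      using K(1) compact_continuous_image compact_imp_bounded by blast
    then show ?thesis unfolding bounded_iff by auto
  qed
  then obtain B where B: "\<And>j y. y \<in> K \<Longrightarrow> \<bar>deriv_in S w y (axis j 1)\<bar> \<le> B j"
    by metis
  define C where "C = (\<Sum>j\<in>UNIV. \<bar>B j\<bar>)"
  have "C \<ge> 0" by (simp add: C_def sum_nonneg)
  have "onorm (L y) \<le> C" for y
  proof (rule onorm_bound[OF \<open>C \<ge> 0\<close>])
    fix v :: "real^'n"
    show "norm (L y v) \<le> C * norm v"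
    proof (cases "y \<in> K")
      case True
      have "v = (\<Sum>j\<in>UNIV. (v $ j) *\<^sub>R axis j 1)"
        by (simp add: vec_eq_iff sum_component axis_def if_distrib cong: if_cong)
      then have "deriv_in S w y v = deriv_in S w y (\<Sum>j\<in>UNIV. (v $ j) *\<^sub>R axis j 1)"
        by (rule arg_cong)
      also have "\<dots> = (\<Sum>j\<in>UNIV. (v $ j) * deriv_in S w y (axis j 1))"
        using linear_deriv_in[OF w(1), of y] True K(2)
        by (subst linear_sum) (auto simp: linear_cmul)
      finally have "\<bar>deriv_in S w y v\<bar> = \<bar>\<Sum>j\<in>UNIV. (v $ j) * deriv_in S w y (axis j 1)\<bar>"
        by simp
      also have "\<dots> \<le> (\<Sum>j\<in>UNIV. \<bar>(v $ j) * deriv_in S w y (axis j 1)\<bar>)"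
        by (rule sum_abs)
      also have "\<dots> \<le> (\<Sum>j\<in>UNIV. norm v * \<bar>B j\<bar>)"
      proof (rule sum_mono)
        fix j
        have "\<bar>deriv_in S w y (axis j 1)\<bar> \<le> \<bar>B j\<bar>" using B[OF True, of j] by linarith
        then show "\<bar>(v $ j) * deriv_in S w y (axis j 1)\<bar> \<le> norm v * \<bar>B j\<bar>"
          unfolding abs_mult by (intro mult_mono component_le_norm_cart) auto
      qed
      finally show ?thesis
        using True K(2) by (auto simp: L_def C_def sum_distrib_left mult.commute)
    next
      case False
      then show ?thesis using d0[of y] \<open>C \<ge> 0\<close> by (auto simp: L_def)
    qed
  qed
  \<comment> \<open>Convexity of the half-space turns the bound on the derivative into a Lipschitz
    bound.\<close>
  then have lipH: "norm (W x - W y) \<le> C * norm (x - y)" if "x \<in> half_space" "y \<in> half_space" for x y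
    using differentiable_bound[OF half_space_convex dH] that by blast
  define \<pi> :: "real^'n \<Rightarrow> real^'n" where "\<pi> y = (\<chi> j. if j = bdry_index then max 0 (y $ j) else y $ j)" for y
  have \<pi>H: "\<pi> y \<in> half_space" for y by (simp add: \<pi>_def half_space_def)
  \<comment> \<open>The boundary condition enters here: a point outside the half-space is clamped to
    the hyperplane, where \<open>bdry\<close> makes \<open>W\<close> vanish just as it does
    outside.\<close>
  have W\<pi>: "W (\<pi> y) = W y" for y
  proof (cases "y \<in> half_space")
    case True
    then have "\<pi> y = y" by (simp add: \<pi>_def half_space_def vec_eq_iff)
    then show ?thesis by simp
  next
    case False
    then have "\<pi> y $ bdry_index = 0" by (simp add: \<pi>_def half_space_def)
    then show ?thesis using bdry[of "\<pi> y"] False SH by (auto simp: W_def)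
  qed
  have lip: "\<bar>W x - W y\<bar> \<le> C * norm (x - y)" for x y
  proof -
    have "\<bar>W x - W y\<bar> \<le> C * norm (\<pi> x - \<pi> y)"
      using lipH[OF \<pi>H \<pi>H, of x y] by (simp add: W\<pi>)
    also have "norm (\<pi> x - \<pi> y) \<le> norm (x - y)"
      by (rule norm_le_componentwise_cart) (auto simp: \<pi>_def max_def)
    finally show ?thesis using \<open>C \<ge> 0\<close> by (simp add: mult_left_mono)
  qed
  obtain R where R: "\<And>y. y \<in> K \<Longrightarrow> norm y \<le> R"
    using compact_imp_bounded[OF K(1)] bounded_iff by metis
  have contW: "continuous_on UNIV W"
  proof (rule lipschitz_on_continuous_on[of C])
    show "C-lipschitz_on UNIV W"
      using lip \<open>C \<ge> 0\<close> by (auto simp: lipschitz_on_def dist_norm)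
  qed
  then have mW: "W \<in> borel_measurable borel"
    by (rule borel_measurable_continuous_onI)
  have intW: "integrable lborel W"
  proof -
    have "integrable lborel (\<lambda>y. indicator K y *\<^sub>R W y)"
      by (rule borel_integrable_compact[OF K(1)]) (use contW continuous_on_subset in blast)
    moreover have "(\<lambda>y. indicator K y *\<^sub>R W y) = W"
      by (rule ext) (use W0 in \<open>auto simp: indicator_def\<close>)
    ultimately show ?thesis by metis
  qed
  \<comment> \<open>Steps in (0, 1], so that all translates of the support lie in the ball of radius
    R + 1.\<close>
  define s :: "nat \<Rightarrow> real" where "s n = 1 / real (Suc n)" for n
  have s: "0 < s n" "s n \<le> 1" for n by (auto simp: s_def)
  have s0: "s \<longlonglongrightarrow> 0" unfolding s_def by (rule LIMSEQ_Suc[OF lim_1_over_n])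
  define u where "u n y = (W (s n *\<^sub>R e + y) - W y) / s n" for n y
  define u' where "u' y = indicator S y *\<^sub>R deriv_in S w y e" for y
  have int_shift: "integrable lborel (\<lambda>y. W (c + y))" "(LINT y|lborel. W (c + y)) = (LINT y|lborel. W y)" for c
  proof -
    have d: "distr lborel borel ((+) c) = (lborel :: (real^'n) measure)"
      by (rule lborel_distr_plus)
    have m: "(+) c \<in> measurable (lborel :: (real^'n) measure) borel" by simp
    show "integrable lborel (\<lambda>y. W (c + y))"
      using integrable_distr_eq[OF m mW] intW unfolding d by simp
    show "(LINT y|lborel. W (c + y)) = (LINT y|lborel. W y)"
      using integral_distr[OF m mW] unfolding d by simp
  qed
  have u0: "(LINT y|lborel. u n y) = 0" for n
    unfolding u_def using int_shift intW by (simp add: Bochner_Integration.integral_diff)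
  have normE: "norm e = 1" by (simp add: e_def)
  have bound: "norm (u n y) \<le> C * indicator (cball 0 (R + 1)) y" for n y
  proof (cases "y \<in> cball 0 (R + 1)")
    case True
    have "\<bar>W (s n *\<^sub>R e + y) - W y\<bar> \<le> C * s n"
      using lip[of "s n *\<^sub>R e + y" y] s[of n] normE by simp
    then show ?thesis using True s(1)[of n] by (simp add: u_def field_simps)
  next
    case False
    then have "norm y > R + 1" by simp
    moreover have "norm y \<le> norm (s n *\<^sub>R e + y) + norm (s n *\<^sub>R e)"
      by (metis add.commute add_diff_cancel_left' norm_triangle_ineq4)
    then have "norm (s n *\<^sub>R e + y) > R" using \<open>norm y > R + 1\<close> s[of n] normE by simp
    ultimately have "W y = 0" "W (s n *\<^sub>R e + y) = 0"
      using R W0 by (force, force)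
    then show ?thesis using \<open>C \<ge> 0\<close> by (simp add: u_def)
  qed
  \<comment> \<open>On the hyperplane \<open>W\<close> may have a kink, so convergence is claimed
    off it only; the hyperplane is a null set.\<close>
  have lim: "(\<lambda>n. u n y) \<longlonglongrightarrow> u' y" if y: "y $ bdry_index \<noteq> 0" for y
  proof -
    have "(W has_derivative L y) (at y)"
    proof (cases "y \<in> K")
      case True
      then have "y \<in> S" using K(2) by blast
      have "at y within S = at y"
      proof (rule at_within_interior)
        have "0 < y $ bdry_index" using \<open>y \<in> S\<close> SH y by (force simp: half_space_def)
        then have "y \<in> {y. 0 < y $ bdry_index} \<inter> T" using T \<open>y \<in> S\<close> by auto
        moreover have "open ({y. 0 < y $ bdry_index} \<inter> T)"
          using T(1) by (auto simp: open_halfspace_component_gt_cart)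
        moreover have "{y. 0 < y $ bdry_index} \<inter> T \<subseteq> S"
          using T(2) by (auto simp: half_space_def)
        ultimately show "y \<in> interior S" using interiorI by blast
      qed
      then show ?thesis using dW[OF \<open>y \<in> S\<close>] \<open>y \<in> S\<close> by (simp add: L_def)
    next
      case False
      then have "L y = (\<lambda>v. 0)" using d0[of y] by (auto simp: L_def)
      then show ?thesis using dN[OF False, of UNIV] by simp
    qed
    then have d: "(W has_derivative L y) (at (0 *\<^sub>R e + y))" by simp
    have "((\<lambda>h. h *\<^sub>R e + y) has_derivative (\<lambda>h. h *\<^sub>R e)) (at 0)"
      by (auto intro!: derivative_eq_intros)
    from has_derivative_compose[OF this d]
    have "((\<lambda>h. W (h *\<^sub>R e + y)) has_derivative (\<lambda>h. L y (h *\<^sub>R e))) (at 0)" .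
    moreover have "L y (h *\<^sub>R e) = h * L y e" for h
      using has_derivative_linear[OF dH[of y]] by (simp add: linear_cmul)
    ultimately have "((\<lambda>h. W (h *\<^sub>R e + y)) has_real_derivative L y e) (at 0)"
      by (simp add: has_field_derivative_def mult.commute[of _ "L y e"])
    then have "((\<lambda>h. (W (h *\<^sub>R e + y) - W y) / h) \<longlongrightarrow> L y e) (at 0)"
      by (simp add: DERIV_def)
    then have "(\<lambda>n. u n y) \<longlonglongrightarrow> L y e"
      unfolding u_def
    proof (rule filterlim_compose)
      show "filterlim s (at 0) sequentially"
        using s0 s(1) by (auto simp: filterlim_at less_imp_neq[THEN not_sym])
    qed
    moreover have "u' y = L y e" by (simp add: u'_def L_def)
    ultimately show ?thesis by simp
  qed
  have "AE y in lborel. (\<lambda>n. u n y) \<longlonglongrightarrow> u' y"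
  proof -
    have "negligible {y :: real^'n. y $ bdry_index = 0}"
      by (rule negligible_standard_hyperplane_cart)
    moreover have "closed {y :: real^'n. y $ bdry_index = 0}"
      by (intro closed_Collect_eq continuous_intros)
    then have "{y :: real^'n. y $ bdry_index = 0} \<in> sets lborel"
      by (simp add: borel_closed)
    ultimately have "{y :: real^'n. y $ bdry_index = 0} \<in> null_sets lborel"
      by (simp add: negligible_iff_null_sets null_sets_completion_iff)
    then show ?thesis
      by (rule AE_I') (use lim in auto)
  qed
  moreover have "u n \<in> borel_measurable lborel" for n
    unfolding u_def using mW by measurable
  moreover have "u' \<in> borel_measurable lborel"
  proof -
    have "set_integrable lborel S (\<lambda>y. deriv_in S w y e)"
      by (rule set_integrable_compact_support[OF S K smooth_on_imp_continuous_on[OF smooth_on_deriv_in[OF ft w(1)]]])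
        (use d0 in auto)
    then show ?thesis
      unfolding u'_def set_integrable_def by (rule borel_measurable_integrable)
  qed
  moreover have "integrable lborel (\<lambda>y :: real^'n. C * indicator (cball 0 (R + 1)) y)"
    using emeasure_bounded_finite[OF bounded_cball[of "0 :: real^'n" "R + 1"]]
    by (intro integrable_mult_right integrable_real_indicator) auto
  ultimately have "(\<lambda>n. LINT y|lborel. u n y) \<longlonglongrightarrow> (LINT y|lborel. u' y)"
    using bound by (intro integral_dominated_convergence[where w = "\<lambda>y. C * indicator (cball 0 (R + 1)) y"]) auto
  then have "(LINT y|lborel. u' y) = 0"
    unfolding u0 using LIMSEQ_const_iff by metis
  then show ?thesis
    by (simp add: set_lebesgue_integral_def u'_def e_def)
qed

section \<open>Change of variables\<close>

text \<open>
  The change of variables theorem of the library requires a well-ordered index type, which an arbitrary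
  finite type is not; \<open>'n fin_index\<close> is a well-ordered copy of \<open>'n\<close>.
\<close>

typedef ('n::finite) fin_index = "{..<CARD('n)}"
  by (rule exI[of _ 0]) simp

instance fin_index :: (finite) finite
proof
  have "finite (range (Rep_fin_index :: 'a fin_index \<Rightarrow> nat))"
    by (rule finite_subset[of _ "{..<CARD('a)}"]) (use Rep_fin_index in auto)
  then show "finite (UNIV :: 'a fin_index set)"
    by (rule finite_imageD) (simp add: inj_on_def Rep_fin_index_inject)
qed

instantiation fin_index :: (finite) wellorder
begin

definition less_eq_fin_index :: "'a fin_index \<Rightarrow> 'a fin_index \<Rightarrow> bool" where
  "i \<le> j \<longleftrightarrow> Rep_fin_index i \<le> Rep_fin_index j"

definition less_fin_index :: "'a fin_index \<Rightarrow> 'a fin_index \<Rightarrow> bool" where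
  "i < j \<longleftrightarrow> Rep_fin_index i < Rep_fin_index j"

instance
proof
  fix P :: "'a fin_index \<Rightarrow> bool" and i
  assume *: "\<And>i. (\<And>j. j < i \<Longrightarrow> P j) \<Longrightarrow> P i"
  show "P i"
    by (induction i rule: measure_induct_rule[of Rep_fin_index]) (rule *, simp add: less_fin_index_def)
qed (auto simp: less_eq_fin_index_def less_fin_index_def Rep_fin_index_inject[symmetric])

end

lemma card_fin_index: "CARD('n::finite fin_index) = CARD('n)"
proof -
  have "bij_betw Rep_fin_index (UNIV :: 'n fin_index set) {..<CARD('n)}"
    by (intro bij_betwI[of _ _ _ Abs_fin_index])
      (use Rep_fin_index in \<open>auto simp: Rep_fin_index_inverse Abs_fin_index_inverse\<close>)
  from bij_betw_same_card[OF this] show ?thesis by simp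
qed

text \<open>Conjugation by \<open>\<sigma>\<close> matches the permutations of the two index types
  and preserves the sign, so the Leibniz sums agree term by term.\<close>

lemma det_reindex:
  fixes A :: "real^'n::finite^'n" and \<sigma> :: "'m::finite \<Rightarrow> 'n"
  assumes \<sigma>: "bij \<sigma>"
  shows "det (\<chi> k l. A $ \<sigma> k $ \<sigma> l) = det A"
proof -
  have mp: "map_permutation UNIV \<sigma> p = \<sigma> \<circ> p \<circ> inv \<sigma>" for p
    using \<sigma> by (auto simp: map_permutation_def restrict_id_def bij_is_surj fun_eq_iff)
  have bij: "bij_betw (\<lambda>p. \<sigma> \<circ> p \<circ> inv \<sigma>) {p. p permutes UNIV} {p. p permutes UNIV}"
    using bij_betw_permutations[OF \<sigma>] by (simp add: o_def)
  have "det A = (\<Sum>p | p permutes UNIV. of_int (sign (\<sigma> \<circ> p \<circ> inv \<sigma>)) * (\<Prod>i\<in>UNIV. A $ i $ (\<sigma> \<circ> p \<circ> inv \<sigma>) i))"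
    unfolding det_def by (rule sum.reindex_bij_betw[OF bij, symmetric])
  also have "\<dots> = det (\<chi> k l. A $ \<sigma> k $ \<sigma> l)"
    unfolding det_def
  proof (rule sum.cong[OF refl])
    fix p :: "'m \<Rightarrow> 'm" assume p: "p \<in> {p. p permutes UNIV}"
    have "sign (\<sigma> \<circ> p \<circ> inv \<sigma>) = sign p"
      using sign_map_permutation[of \<sigma> UNIV p] \<sigma> p by (simp add: mp bij_is_inj)
    moreover have "(\<Prod>i\<in>UNIV. A $ i $ (\<sigma> \<circ> p \<circ> inv \<sigma>) i) = (\<Prod>k\<in>UNIV. A $ \<sigma> k $ (\<sigma> \<circ> p \<circ> inv \<sigma>) (\<sigma> k))"
      by (rule prod.reindex_bij_betw[OF \<sigma>, symmetric])
    ultimately show "of_int (sign (\<sigma> \<circ> p \<circ> inv \<sigma>)) * (\<Prod>i\<in>UNIV. A $ i $ (\<sigma> \<circ> p \<circ> inv \<sigma>) i) =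
        of_int (sign p) * (\<Prod>i\<in>UNIV. (\<chi> k l. A $ \<sigma> k $ \<sigma> l) $ i $ p i)"
      using \<sigma> by (simp add: bij_is_inj)
  qed
  finally show ?thesis ..
qed

definition reindex :: "('m \<Rightarrow> 'n) \<Rightarrow> real^'n::finite \<Rightarrow> real^'m::finite" where
  "reindex \<sigma> x = (\<chi> k. x $ \<sigma> k)"

lemma linear_reindex: "linear (reindex \<sigma>)"
  by (rule linearI) (auto simp: reindex_def vec_eq_iff)

lemma reindex_inv [simp]: "bij \<sigma> \<Longrightarrow> reindex (inv \<sigma>) (reindex \<sigma> x) = x"
  "bij \<sigma> \<Longrightarrow> reindex \<sigma> (reindex (inv \<sigma>) y) = y"
  by (simp_all add: reindex_def vec_eq_iff bij_is_inj bij_is_surj surj_f_inv_f)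

lemma reindex_eq_iff [simp]: "bij \<sigma> \<Longrightarrow> reindex \<sigma> x = reindex \<sigma> y \<longleftrightarrow> x = y"
  by (metis reindex_inv(1))

lemma borel_measurable_reindex: "reindex \<sigma> \<in> borel_measurable borel"
  using linear_reindex by (intro borel_measurable_continuous_onI linear_continuous_on)
    (simp add: linear_conv_bounded_linear)

lemma prod_Basis_cart: "(\<Prod>b\<in>Basis. (x :: real^'n::finite) \<bullet> b) = (\<Prod>i\<in>UNIV. x $ i)"
proof -
  have B: "(Basis :: (real^'n) set) = range (\<lambda>i. axis i 1)"
    by (auto simp: Basis_vec_def)
  have inj: "inj (\<lambda>i. axis i (1::real) :: real^'n)"
    by (rule injI) (simp add: axis_eq_axis)
  show ?thesis
    unfolding B prod.reindex[OF inj] by (simp add: inner_axis)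
qed

text \<open>Lebesgue measure is determined by its values on boxes, and relabelling the coordinates
  only permutes the side lengths.\<close>

lemma distr_reindex:
  fixes \<sigma> :: "'m::finite \<Rightarrow> 'n::finite"
  assumes \<sigma>: "bij \<sigma>"
  shows "distr lborel borel (reindex \<sigma>) = lborel"
proof (rule lborel_eqI[symmetric])
  fix l u :: "real^'m" assume le: "\<And>b. b \<in> Basis \<Longrightarrow> l \<bullet> b \<le> u \<bullet> b"
  have le': "l $ k \<le> u $ k" for k using le[of "axis k 1"] by (simp add: inner_axis)
  have "reindex \<sigma> -` box l u = box (reindex (inv \<sigma>) l) (reindex (inv \<sigma>) u)"
  proof (intro set_eqI iffI)
    fix x assume "x \<in> reindex \<sigma> -` box l u"
    then have "l $ k < x $ \<sigma> k \<and> x $ \<sigma> k < u $ k" for k by (auto simp: mem_box_cart reindex_def)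
    from this[of "inv \<sigma> _"] show "x \<in> box (reindex (inv \<sigma>) l) (reindex (inv \<sigma>) u)"
      using \<sigma> by (auto simp: mem_box_cart reindex_def bij_is_surj surj_f_inv_f)
  next
    fix x assume "x \<in> box (reindex (inv \<sigma>) l) (reindex (inv \<sigma>) u)"
    then have "l $ inv \<sigma> i < x $ i \<and> x $ i < u $ inv \<sigma> i" for i by (auto simp: mem_box_cart reindex_def)
    from this[of "\<sigma> _"] show "x \<in> reindex \<sigma> -` box l u"
      using \<sigma> by (auto simp: mem_box_cart reindex_def bij_is_inj)
  qed
  then have "emeasure (distr lborel borel (reindex \<sigma>)) (box l u) = emeasure lborel (box (reindex (inv \<sigma>) l) (reindex (inv \<sigma>) u))"
    using borel_measurable_reindex[of \<sigma>] by (subst emeasure_distr) auto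
  also have "\<dots> = (\<Prod>b\<in>Basis. (reindex (inv \<sigma>) u - reindex (inv \<sigma>) l) \<bullet> b)"
    by (rule emeasure_lborel_box) (use le' in \<open>auto simp: Basis_vec_def inner_axis reindex_def\<close>)
  also have "\<dots> = (\<Prod>i\<in>UNIV. (u - l) $ inv \<sigma> i)"
    by (simp add: prod_Basis_cart reindex_def)
  also have "\<dots> = (\<Prod>k\<in>UNIV. (u - l) $ k)"
    using prod.reindex_bij_betw[OF bij_imp_bij_inv[OF \<sigma>], of "\<lambda>k. (u - l) $ k"] by simp
  finally show "emeasure (distr lborel borel (reindex \<sigma>)) (box l u) = (\<Prod>b\<in>Basis. (u - l) \<bullet> b)"
    by (simp add: prod_Basis_cart)
qed simp

lemma set_integral_reindex:
  fixes \<sigma> :: "'m::finite \<Rightarrow> 'n::finite" and h :: "real^'n \<Rightarrow> real"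
  assumes \<sigma>: "bij \<sigma>" and h: "set_integrable lborel S h"
  shows "set_integrable lborel (reindex \<sigma> ` S) (\<lambda>y. h (reindex (inv \<sigma>) y))"
    and "(LINT y:reindex \<sigma> ` S|lborel. h (reindex (inv \<sigma>) y)) = (LINT x:S|lborel. h x)"
proof -
  let ?k = "\<lambda>x. indicator S x *\<^sub>R h x"
  have eq: "indicator (reindex \<sigma> ` S) y *\<^sub>R h (reindex (inv \<sigma>) y) = ?k (reindex (inv \<sigma>) y)" for y
  proof -
    have "y \<in> reindex \<sigma> ` S \<longleftrightarrow> reindex (inv \<sigma>) y \<in> S"
      using \<sigma> imageI[of "reindex (inv \<sigma>) y" S "reindex \<sigma>"] by auto
    then show ?thesis by (simp add: indicator_def)
  qed
  have k: "integrable lborel ?k" using h by (simp add: set_integrable_def)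
  then have mk: "?k \<in> borel_measurable borel" using borel_measurable_integrable by auto
  have d: "distr lborel borel (reindex (inv \<sigma>)) = lborel"
    by (rule distr_reindex[OF bij_imp_bij_inv[OF \<sigma>]])
  have m: "reindex (inv \<sigma>) \<in> measurable lborel borel" using borel_measurable_reindex by simp
  show "set_integrable lborel (reindex \<sigma> ` S) (\<lambda>y. h (reindex (inv \<sigma>) y))"
    unfolding set_integrable_def eq using integrable_distr_eq[OF m mk] k unfolding d by simp
  show "(LINT y:reindex \<sigma> ` S|lborel. h (reindex (inv \<sigma>) y)) = (LINT x:S|lborel. h x)"
    unfolding set_lebesgue_integral_def eq using integral_distr[OF m mk] unfolding d by simp
qed

lemma set_integral_change_of_variables_wellorder:
  fixes f :: "real^'m::{finite,wellorder} \<Rightarrow> real" and g :: "real^'m::_ \<Rightarrow> real^'m::_"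
  assumes S: "S \<in> sets borel"
    and g: "\<And>x. x \<in> S \<Longrightarrow> (g has_derivative g' x) (at x within S)" "inj_on g S"
    and f: "set_integrable lborel (g ` S) f"
    and f': "set_integrable lborel S (\<lambda>x. \<bar>det (matrix (g' x))\<bar> * f (g x))"
  shows "(LINT y:g ` S|lborel. f y) = (LINT x:S|lborel. \<bar>det (matrix (g' x))\<bar> * f (g x))"
proof -
  have abs: "h absolutely_integrable_on X" if "set_integrable lborel X h" for h :: "real^'m::_ \<Rightarrow> real" and X
    using that unfolding set_integrable_def by (simp add: integrable_completion borel_measurable_integrable)
  \<comment> \<open>The change of variables theorem speaks of vector-valued integrands; the scalar
    one is read as a vector with a single component.\<close>
  define F :: "real^'m::_ \<Rightarrow> real^1" where "F x = (\<chi> i. f x)" for x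
  have F1: "F x $ 1 = f x" for x by (simp add: F_def)
  have "F absolutely_integrable_on g ` S"
    using abs[OF f] by (simp add: absolutely_integrable_on_1_iff F1)
  then have "(\<lambda>x. \<bar>det (matrix (g' x))\<bar> *\<^sub>R F (g x)) absolutely_integrable_on S \<and>
    integral S (\<lambda>x. \<bar>det (matrix (g' x))\<bar> *\<^sub>R F (g x)) = integral (g ` S) F"
    using S by (subst has_absolute_integral_change_of_variables[OF _ g]) auto
  then have "integral S (\<lambda>x. \<bar>det (matrix (g' x))\<bar> * f (g x)) = integral (g ` S) f"
    by (metis (mono_tags, lifting) F1 integral_on_1_eq vec_component vector_scaleR_component real_scaleR_def integral_cong)
  then show ?thesis
    using set_borel_integral_eq_integral(2)[OF f] set_borel_integral_eq_integral(2)[OF f'] by simp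
qed

text \<open>The map g is conjugated with the relabelling of coordinates. Its Jacobian matrix has
  rows and columns permuted simultaneously, which does not affect the determinant.\<close>

lemma set_integral_change_of_variables:
  fixes f :: "real^'n::finite \<Rightarrow> real" and g :: "real^'n \<Rightarrow> real^'n"
  assumes S: "S \<in> sets borel"
    and g: "\<And>x. x \<in> S \<Longrightarrow> (g has_derivative g' x) (at x within S)" "inj_on g S"
    and f: "set_integrable lborel (g ` S) f"
    and f': "set_integrable lborel S (\<lambda>x. \<bar>det (matrix (g' x))\<bar> * f (g x))"
  shows "(LINT y:g ` S|lborel. f y) = (LINT x:S|lborel. \<bar>det (matrix (g' x))\<bar> * f (g x))"
proof -
  obtain \<sigma> :: "'n fin_index \<Rightarrow> 'n" where \<sigma>: "bij \<sigma>"
    using finite_same_card_bij[of "UNIV :: 'n fin_index set" "UNIV :: 'n set"] by (auto simp: card_fin_index)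
  let ?R = "reindex \<sigma>" and ?R' = "reindex (inv \<sigma>)"
  define G where "G y = ?R (g (?R' y))" for y
  define G' where "G' y v = ?R (g' (?R' y) (?R' v))" for y v
  have bl: "bounded_linear ?R" "bounded_linear ?R'"
    using linear_reindex by (auto simp: linear_conv_bounded_linear)
  have GS: "G ` (?R ` S) = ?R ` (g ` S)"
    using \<sigma> by (force simp: G_def image_image)
  have "?R ` S = ?R' -` S"
    using \<sigma> imageI[of "reindex (inv \<sigma>) _" S "reindex \<sigma>"] by force
  then have bS: "?R ` S \<in> sets borel"
    using measurable_sets[OF borel_measurable_reindex S] by simp
  have dG: "(G has_derivative G' y) (at y within ?R ` S)" if "y \<in> ?R ` S" for y
  proof -
    have "?R' y \<in> S" using that \<sigma> by auto
    moreover have "?R' ` (?R ` S) = S" using \<sigma> by (force simp: image_image)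
    ultimately have "(g has_derivative g' (?R' y)) (at (?R' y) within ?R' ` (?R ` S))"
      using g(1) by simp
    from has_derivative_in_compose[OF bounded_linear_imp_has_derivative[OF bl(2)] this]
    have "((\<lambda>y. g (?R' y)) has_derivative (\<lambda>v. g' (?R' y) (?R' v))) (at y within ?R ` S)" .
    from bounded_linear.has_derivative[OF bl(1) this] show ?thesis
      unfolding G_def G'_def .
  qed
  have det: "det (matrix (G' (?R x))) = det (matrix (g' x))" if "x \<in> S" for x
  proof -
    have "?R' (axis l 1) = axis (\<sigma> l) 1" for l
      using \<sigma> by (auto simp: reindex_def axis_def vec_eq_iff bij_is_inj bij_is_surj surj_f_inv_f)
    then have "G' (?R x) (axis l 1) $ k = g' x (axis (\<sigma> l) 1) $ \<sigma> k" for k l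
      using \<sigma> by (simp add: G'_def) (simp add: reindex_def)
    then have "matrix (G' (?R x)) = (\<chi> k l. matrix (g' x) $ \<sigma> k $ \<sigma> l)"
      by (simp add: matrix_def vec_eq_iff)
    then show ?thesis using det_reindex[OF \<sigma>] by simp
  qed
  have inj: "inj_on G (?R ` S)"
  proof (rule inj_onI)
    fix y z assume "y \<in> ?R ` S" "z \<in> ?R ` S" "G y = G z"
    then have "g (?R' y) = g (?R' z)" "?R' y \<in> S" "?R' z \<in> S"
      using \<sigma> by (auto simp: G_def)
    then have "?R' y = ?R' z" using g(2) by (auto dest: inj_onD)
    from arg_cong[OF this, of ?R] show "y = z" using \<sigma> by simp
  qed
  have eq: "(\<lambda>y. \<bar>det (matrix (g' (?R' y)))\<bar> * f (g (?R' y))) y = \<bar>det (matrix (G' y))\<bar> * f (?R' (G y))" if "y \<in> ?R ` S" for y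
    using that det \<sigma> by (auto simp: G_def)
  have "(LINT y:G ` ?R ` S|lborel. f (?R' y)) = (LINT y:?R ` S|lborel. \<bar>det (matrix (G' y))\<bar> * f (?R' (G y)))"
  proof (rule set_integral_change_of_variables_wellorder[OF bS dG inj])
    show "set_integrable lborel (G ` ?R ` S) (\<lambda>y. f (?R' y))"
      unfolding GS by (rule set_integral_reindex(1)[OF \<sigma> f])
    show "set_integrable lborel (?R ` S) (\<lambda>y. \<bar>det (matrix (G' y))\<bar> * f (?R' (G y)))"
      using set_integral_reindex(1)[OF \<sigma> f'] eq by (simp cong: set_integrable_cong)
  qed
  also have "(LINT y:G ` ?R ` S|lborel. f (?R' y)) = (LINT y:g ` S|lborel. f y)"
    unfolding GS by (rule set_integral_reindex(2)[OF \<sigma> f])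
  also have "(LINT y:?R ` S|lborel. \<bar>det (matrix (G' y))\<bar> * f (?R' (G y))) =
      (LINT y:?R ` S|lborel. \<bar>det (matrix (g' (?R' y)))\<bar> * f (g (?R' y)))"
    by (rule set_lebesgue_integral_cong) (use bS eq in auto)
  also have "\<dots> = (LINT x:S|lborel. \<bar>det (matrix (g' x))\<bar> * f (g x))"
    by (rule set_integral_reindex(2)[OF \<sigma> f'])
  finally show ?thesis .
qed

section \<open>Charts and partitions of unity\<close>

text \<open>The factor \<open>1 / t ^ m\<close> makes the family closed under differentiation up to linear combinations.\<close>

definition flat :: "nat \<Rightarrow> real \<Rightarrow> real" where
  "flat m t = (if t > 0 then exp (- 1 / t) / t ^ m else 0)"

text \<open>With t = 1/x the right-hand limit is the decay of x^m / exp x at infinity.\<close>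

lemma flat_tendsto_0: "(flat m \<longlongrightarrow> 0) (at 0)"
proof (rule filterlim_split_at)
  show "(flat m \<longlongrightarrow> 0) (at_left 0)"
  proof (rule tendsto_eventually)
    show "\<forall>\<^sub>F t in at_left 0. flat m t = 0"
      by (auto simp: flat_def eventually_at_filter)
  qed
  have "((\<lambda>x. flat m (inverse x)) \<longlongrightarrow> 0) at_top"
  proof (rule Lim_transform_eventually[OF tendsto_power_div_exp_0[of m]])
    show "\<forall>\<^sub>F x :: real in at_top. x ^ m / exp x = flat m (inverse x)"
      using eventually_gt_at_top[of 0]
      by eventually_elim (simp add: flat_def exp_minus power_inverse divide_simps)
  qed
  then show "(flat m \<longlongrightarrow> 0) (at_right 0)"
    by (simp add: filterlim_at_right_to_top)
qed

lemma has_real_derivative_flat: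
  "(flat m has_real_derivative (flat (m + 2) t - real m * flat (m + 1) t)) (at t)"
proof (cases t "0 :: real" rule: linorder_cases)
  case less
  have "(flat m has_real_derivative 0) (at t)"
    by (rule has_field_derivative_transform_within_open[OF DERIV_const, of "{..<0}" _ 0])
      (use less in \<open>auto simp: flat_def\<close>)
  then show ?thesis using less by (simp add: flat_def)
next
  case equal
  \<comment> \<open>The difference quotient of \<open>flat m\<close> at 0 is the next member of the
    family.\<close>
  have "((\<lambda>h. (flat m h - flat m 0) / h) \<longlongrightarrow> 0) (at 0)"
  proof (rule Lim_transform_eventually[OF flat_tendsto_0[of "Suc m"]])
    show "\<forall>\<^sub>F h in at 0. flat (Suc m) h = (flat m h - flat m 0) / h"
      by (auto simp: flat_def eventually_at_filter)
  qed
  then show ?thesis using equal by (simp add: DERIV_def flat_def)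
next
  case greater
  have "((\<lambda>t. exp (- inverse t) * inverse t ^ m) has_real_derivative
      exp (- inverse t) * (inverse t ^ 2) * inverse t ^ m + exp (- inverse t) * (real m * inverse t ^ (m - 1) * (- (inverse t ^ 2)))) (at t)"
    using greater by (auto intro!: derivative_eq_intros simp: power2_eq_square)
  also have "exp (- inverse t) * (inverse t ^ 2) * inverse t ^ m + exp (- inverse t) * (real m * inverse t ^ (m - 1) * (- (inverse t ^ 2)))
      = flat (m + 2) t - real m * flat (m + 1) t"
    using greater by (cases m) (simp_all add: flat_def divide_inverse power_inverse[symmetric] power2_eq_square algebra_simps)
  finally have "((\<lambda>t. exp (- 1 / t) / t ^ m) has_real_derivative (flat (m + 2) t - real m * flat (m + 1) t)) (at t)"
    by (simp add: divide_inverse power_inverse)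
  then show ?thesis
    by (rule has_field_derivative_transform_within_open[of _ _ _ "{0<..}"]) (use greater in \<open>auto simp: flat_def\<close>)
qed

lemma C_k_on_flat: "C_k_on k UNIV (flat m)"
proof (induction k arbitrary: m)
  case 0
  have "continuous_on UNIV (flat m)"
    by (rule DERIV_continuous_on) (rule DERIV_subset[OF has_real_derivative_flat subset_UNIV])
  then show ?case by simp
next
  case (Suc k)
  show ?case
  proof (rule C_k_on_SucI[OF open_UNIV])
    show "(flat m has_derivative (\<lambda>v. v * (flat (m + 2) t + (- real m) * flat (m + 1) t))) (at t)" for t
      using has_real_derivative_flat[of m t] by (simp add: has_field_derivative_def mult_commute_abs)
    have "C_k_on k UNIV (\<lambda>t. (- real m) * flat (m + 1) t)"
      by (rule C_k_on_bounded_linear[OF open_UNIV bounded_linear_mult_right Suc])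
    from C_k_on_bounded_linear[OF open_UNIV bounded_linear_mult_right C_k_on_add[OF open_UNIV Suc[of "m + 2"] this]]
    show "C_k_on k UNIV (\<lambda>t. v * (flat (m + 2) t + (- real m) * flat (m + 1) t))" for v .
  qed
qed

section \<open>Coordinate images, smooth maps and partitions of unity for an oriented atlas\<close>

locale compatible_atlas =
  fixes M :: "'m topology" and \<A> :: "('m, 'n::finite) chart set"
  assumes oriented: "oriented_manifold_with_boundary M \<A>"
begin

lemma is_chart: "c \<in> \<A> \<Longrightarrow> is_chart M c"
  using oriented by (simp add: oriented_manifold_with_boundary_def)

lemma Hausdorff: "Hausdorff_space M"
  using oriented by (simp add: oriented_manifold_with_boundary_def)

lemma cover: "x \<in> topspace M \<Longrightarrow> \<exists>c\<in>\<A>. x \<in> chart_dom c"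
  using oriented by (auto simp: oriented_manifold_with_boundary_def)

lemma chart_dom_open: "c \<in> \<A> \<Longrightarrow> openin M (chart_dom c)"
  using is_chart by (simp add: is_chart_def)

lemma chart_dom_topspace: "c \<in> \<A> \<Longrightarrow> x \<in> chart_dom c \<Longrightarrow> x \<in> topspace M"
  using chart_dom_open openin_subset by blast

lemma cimage_open: "c \<in> \<A> \<Longrightarrow> openin (top_of_set half_space) (cimage c)"
  using is_chart by (simp add: is_chart_def)

lemma full_tangent_cimage: "c \<in> \<A> \<Longrightarrow> full_tangent (cimage c)"
  by (rule full_tangent_half_space[OF cimage_open])

lemma coord_homeomorphic:
  "c \<in> \<A> \<Longrightarrow> homeomorphic_map (subtopology M (chart_dom c)) (top_of_set (cimage c)) (coord c)"
  using is_chart by (simp add: is_chart_def)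

lemma topspace_chart: "c \<in> \<A> \<Longrightarrow> topspace (subtopology M (chart_dom c)) = chart_dom c"
  using chart_dom_open openin_subset by (auto simp: topspace_subtopology)

lemma coord_inj: "c \<in> \<A> \<Longrightarrow> inj_on (coord c) (chart_dom c)"
  using homeomorphic_imp_injective_map[OF coord_homeomorphic] topspace_chart by metis

lemma chart_inv_coord [simp]: "c \<in> \<A> \<Longrightarrow> x \<in> chart_dom c \<Longrightarrow> chart_inv c (coord c x) = x"
  by (simp add: chart_inv_def coord_inj)

lemma chart_inv_in: "y \<in> cimage c \<Longrightarrow> chart_inv c y \<in> chart_dom c"
  by (simp add: chart_inv_def inv_into_into)

lemma coord_chart_inv [simp]: "y \<in> cimage c \<Longrightarrow> coord c (chart_inv c y) = y"
  by (simp add: chart_inv_def f_inv_into_f)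

lemma openin_coord_image:
  assumes c: "c \<in> \<A>" and U: "openin M U" "U \<subseteq> chart_dom c"
  shows "openin (top_of_set half_space) (coord c ` U)"
proof -
  have "openin (subtopology M (chart_dom c)) U"
    using U by (auto simp: openin_subtopology)
  then have "openin (top_of_set (cimage c)) (coord c ` U)"
    using homeomorphic_map_openness_eq[OF coord_homeomorphic[OF c]] by blast
  then show ?thesis using cimage_open[OF c] openin_trans by blast
qed

lemma openin_coord_vimage:
  assumes c: "c \<in> \<A>" and V: "open V"
  shows "openin M {x \<in> chart_dom c. coord c x \<in> V}"
proof -
  have "continuous_map (subtopology M (chart_dom c)) (top_of_set (cimage c)) (coord c)"
    by (rule homeomorphic_imp_continuous_map[OF coord_homeomorphic[OF c]])
  then have "openin (subtopology M (chart_dom c)) {x \<in> topspace (subtopology M (chart_dom c)). coord c x \<in> cimage c \<inter> V}"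
    by (rule openin_continuous_map_preimage) (use V in \<open>auto simp: openin_open\<close>)
  then have "openin M {x \<in> topspace (subtopology M (chart_dom c)). coord c x \<in> cimage c \<inter> V}"
    using chart_dom_open[OF c] openin_trans_full by blast
  moreover have "{x \<in> topspace (subtopology M (chart_dom c)). coord c x \<in> cimage c \<inter> V} = {x \<in> chart_dom c. coord c x \<in> V}"
    using topspace_chart[OF c] by auto
  ultimately show ?thesis by simp
qed

lemma compactin_coord_vimage:
  assumes c: "c \<in> \<A>" and K: "compact K" "K \<subseteq> cimage c"
  shows "compactin M {x \<in> chart_dom c. coord c x \<in> K}"
proof -
  let ?U = "{x \<in> chart_dom c. coord c x \<in> K}"
  have "coord c ` ?U = K" using K(2) by auto
  then have "compactin (top_of_set (cimage c)) (coord c ` ?U)"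
    using K by (simp add: compactin_subtopology)
  then have "compactin (subtopology M (chart_dom c)) ?U"
    using homeomorphic_map_compactness[OF coord_homeomorphic[OF c], of ?U] topspace_chart[OF c] by auto
  then show ?thesis by (simp add: compactin_subtopology)
qed

lemma smooth_map_on_localI:
  assumes "\<And>x. x \<in> topspace M \<Longrightarrow> \<exists>U. openin M U \<and> x \<in> U \<and> smooth_map_on \<A> U f"
  shows "smooth_map_on \<A> (topspace M) f"
  unfolding smooth_map_on_def
proof
  fix d assume d: "d \<in> \<A>"
  show "smooth_on (coord d ` (chart_dom d \<inter> topspace M)) (f \<circ> chart_inv d)"
  proof (rule smooth_on_localI)
    fix y assume "y \<in> coord d ` (chart_dom d \<inter> topspace M)"
    then obtain x where x: "x \<in> chart_dom d" "x \<in> topspace M" "y = coord d x" by blast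
    obtain U where U: "openin M U" "x \<in> U" "smooth_map_on \<A> U f" using assms[OF x(2)] by blast
    have "openin (top_of_set half_space) (coord d ` (chart_dom d \<inter> U))"
      by (rule openin_coord_image[OF d]) (use U(1) chart_dom_open[OF d] in auto)
    then obtain W where W: "open W" "coord d ` (chart_dom d \<inter> U) = half_space \<inter> W"
      by (auto simp: openin_open)
    have "cimage d \<subseteq> half_space" using cimage_open[OF d] openin_imp_subset by blast
    then have "coord d ` (chart_dom d \<inter> topspace M) \<inter> W \<subseteq> coord d ` (chart_dom d \<inter> U)"
      using W(2) by auto
    then have "smooth_on (coord d ` (chart_dom d \<inter> topspace M) \<inter> W) (f \<circ> chart_inv d)"
      using U(3) d smooth_on_subset unfolding smooth_map_on_def by blast
    moreover have "y \<in> W" using x U W(2) by auto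
    ultimately show "\<exists>W. open W \<and> y \<in> W \<and> smooth_on (coord d ` (chart_dom d \<inter> topspace M) \<inter> W) (f \<circ> chart_inv d)"
      using W(1) by blast
  qed
qed

lemma coord_smooth:
  assumes "c \<in> \<A>" "d \<in> \<A>"
  shows "smooth_on (coord d ` (chart_dom d \<inter> chart_dom c)) (coord c \<circ> chart_inv d)"
  using assms oriented by (simp add: oriented_manifold_with_boundary_def smooth_map_on_def)

lemma smooth_in_chart:
  assumes "c \<in> \<A>" "smooth_map_on \<A> (topspace M) f"
  shows "smooth_on (cimage c) (f \<circ> chart_inv c)"
proof -
  have "chart_dom c \<inter> topspace M = chart_dom c"
    using chart_dom_topspace[OF assms(1)] by auto
  then show ?thesis using assms unfolding smooth_map_on_def by metis
qed

text \<open>The bump is \<open>flat 0\<close> of r^2 - |y - y0|^2 in a chart, extended by zero. It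
  vanishes off the preimage C of a compact piece of a closed ball, and C is closed in M because M is
  Hausdorff. So the chart domain and the complement of C are open sets that cover M, and the bump is
  smooth on each.\<close>

lemma bump_exists:
  assumes x: "x \<in> topspace M"
  shows "\<exists>c \<beta> U C. c \<in> \<A> \<and> smooth_map_on \<A> (topspace M) \<beta> \<and> (\<forall>z. 0 \<le> \<beta> z) \<and> openin M U \<and> x \<in> U \<and>
    (\<forall>z\<in>U. 0 < \<beta> z) \<and> closedin M C \<and> C \<subseteq> chart_dom c \<and> (\<forall>z. z \<notin> C \<longrightarrow> \<beta> z = (0::real))"
proof -
  obtain c where c: "c \<in> \<A>" "x \<in> chart_dom c" using cover[OF x] by blast
  obtain T where T: "open T" "cimage c = half_space \<inter> T"
    using cimage_open[OF c(1)] by (auto simp: openin_open)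
  define y0 where "y0 = coord c x"
  have "y0 \<in> T" using T(2) c(2) by (auto simp: y0_def)
  then obtain r where r: "r > 0" "cball y0 r \<subseteq> T" using T(1) open_contains_cball by blast
  define K where "K = cball y0 r \<inter> half_space"
  have K: "compact K" "K \<subseteq> cimage c"
    using r T(2) half_space_closed by (auto simp: K_def compact_Int_closed)
  define C where "C = {z \<in> chart_dom c. coord c z \<in> K}"
  define U where "U = {z \<in> chart_dom c. coord c z \<in> ball y0 r}"
  define k where "k y = flat 0 (r\<^sup>2 - (y - y0) \<bullet> (y - y0))" for y
  have k: "smooth_on UNIV k"
  proof -
    have "smooth_on UNIV (\<lambda>y. r\<^sup>2 - (y - y0) \<bullet> (y - y0))"
      by (intro smooth_on_diff smooth_on_const smooth_on_bounded_bilinear[OF bounded_bilinear_inner] smooth_on_ident)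
    from smooth_on_compose[OF C_k_on_imp_smooth_on[OF open_UNIV subset_UNIV[of UNIV] C_k_on_flat] this]
    show ?thesis unfolding k_def by simp
  qed
  have kpos: "k y > 0 \<longleftrightarrow> y \<in> ball y0 r" "k y \<ge> 0" for y
  proof -
    have "(y - y0) \<bullet> (y - y0) < r\<^sup>2 \<longleftrightarrow> norm (y - y0) < r"
      unfolding power2_norm_eq_inner[symmetric]
      using r(1) power_strict_mono[of "norm (y - y0)" r 2] power2_less_imp_less[of "norm (y - y0)" r] by auto
    then show "k y > 0 \<longleftrightarrow> y \<in> ball y0 r" by (simp add: k_def flat_def dist_norm norm_minus_commute)
    show "k y \<ge> 0" by (simp add: k_def flat_def)
  qed
  define \<beta> where "\<beta> z = (if z \<in> chart_dom c then k (coord c z) else 0)" for z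
  have C: "closedin M C"
    unfolding C_def by (rule compactin_imp_closedin[OF Hausdorff compactin_coord_vimage[OF c(1) K]])
  have \<beta>0: "\<beta> z = 0" if "z \<notin> C" for z
  proof (cases "z \<in> chart_dom c")
    case True
    then have "coord c z \<notin> ball y0 r"
      using that T(2) r(2) by (auto simp: C_def K_def)
    then show ?thesis using kpos[of "coord c z"] by (auto simp: \<beta>_def)
  qed (simp add: \<beta>_def)
  have "smooth_map_on \<A> (topspace M) \<beta>"
  proof (rule smooth_map_on_localI)
    fix z assume z: "z \<in> topspace M"
    show "\<exists>U. openin M U \<and> z \<in> U \<and> smooth_map_on \<A> U \<beta>"
    proof (cases "z \<in> C")
      case True
      have "smooth_map_on \<A> (chart_dom c) \<beta>"
        unfolding smooth_map_on_def
      proof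
        fix d assume d: "d \<in> \<A>"
        have "smooth_on (coord d ` (chart_dom d \<inter> chart_dom c)) (\<lambda>y. k ((coord c \<circ> chart_inv d) y))"
          by (rule smooth_on_compose[OF k coord_smooth[OF c(1) d]]) auto
        then show "smooth_on (coord d ` (chart_dom d \<inter> chart_dom c)) (\<beta> \<circ> chart_inv d)"
          by (rule smooth_on_cong) (use d in \<open>auto simp: \<beta>_def\<close>)
      qed
      then show ?thesis using True chart_dom_open[OF c(1)] by (auto simp: C_def)
    next
      case False
      have "smooth_map_on \<A> (topspace M - C) \<beta>"
        unfolding smooth_map_on_def
      proof
        fix d assume d: "d \<in> \<A>"
        show "smooth_on (coord d ` (chart_dom d \<inter> (topspace M - C))) (\<beta> \<circ> chart_inv d)"
          by (rule smooth_on_cong[OF smooth_on_const[of _ 0]]) (use d \<beta>0 in auto)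
      qed
      then show ?thesis using False z C by (intro exI[of _ "topspace M - C"]) auto
    qed
  qed
  moreover have "openin M U" unfolding U_def by (rule openin_coord_vimage[OF c(1) open_ball])
  moreover have "x \<in> U" using c r(1) by (simp add: U_def y0_def)
  moreover have "\<forall>z\<in>U. 0 < \<beta> z" using kpos(1) by (auto simp: U_def \<beta>_def)
  moreover have "\<forall>z. 0 \<le> \<beta> z" using kpos(2) by (simp add: \<beta>_def)
  moreover have "C \<subseteq> chart_dom c" by (auto simp: C_def)
  ultimately show ?thesis using c(1) C \<beta>0 by blast
qed

text \<open>By compactness finitely many positivity sets of bumps cover M; dividing by the sum of
  these bumps, which is positive everywhere, normalises them.\<close>

lemma partition_of_unity_exists:
  assumes "compact_space M"
  shows "\<exists>C \<rho>. partition_of_unity M \<A> C \<rho>"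
proof -
  obtain c \<beta> U C where b: "\<And>x. x \<in> topspace M \<Longrightarrow> c x \<in> \<A> \<and> smooth_map_on \<A> (topspace M) (\<beta> x) \<and> (\<forall>z. 0 \<le> \<beta> x z) \<and>
    openin M (U x) \<and> x \<in> U x \<and> (\<forall>z\<in>U x. 0 < \<beta> x z) \<and> closedin M (C x) \<and> C x \<subseteq> chart_dom (c x) \<and>
    (\<forall>z. z \<notin> C x \<longrightarrow> \<beta> x z = (0::real))"
    using bump_exists by metis
  have U: "(\<forall>W\<in>U ` topspace M. openin M W) \<and> topspace M \<subseteq> \<Union>(U ` topspace M)"
    using b by blast
  obtain \<F> where \<F>: "finite \<F>" "\<F> \<subseteq> U ` topspace M" "topspace M \<subseteq> \<Union>\<F>"
    using assms[unfolded compact_space_alt, rule_format, OF U] by blast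
  obtain X where X: "X \<subseteq> topspace M" "finite X" "\<F> = U ` X"
    using finite_subset_image[OF \<F>(1,2)] by blast
  then have X: "finite X" "X \<subseteq> topspace M" "topspace M \<subseteq> (\<Union>x\<in>X. U x)"
    using \<F>(3) by simp_all
  define \<sigma> where "\<sigma> z = (\<Sum>x\<in>X. \<beta> x z)" for z
  have \<sigma>: "\<sigma> z > 0" if z: "z \<in> topspace M" for z
  proof -
    obtain x where x: "x \<in> X" "z \<in> U x" using X(3) z by blast
    have "0 < \<beta> x z" using b x X(2) by blast
    also have "\<dots> \<le> \<sigma> z"
      unfolding \<sigma>_def by (rule member_le_sum) (use b X x in auto)
    finally show ?thesis .
  qed
  \<comment> \<open>Partitions are indexed by charts, and several points of X may have been given
    the same chart; their bumps are added up.\<close>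
  define \<rho> where "\<rho> d z = (\<Sum>x\<in>{x\<in>X. c x = d}. \<beta> x z) / \<sigma> z" for d z
  have "partition_of_unity M \<A> (c ` X) \<rho>"
    unfolding partition_of_unity_def
  proof (intro conjI ballI)
    show "finite (c ` X)" "c ` X \<subseteq> \<A>" using X b by auto
    show "(\<Sum>d\<in>c ` X. \<rho> d z) = 1" if "z \<in> topspace M" for z
    proof -
      have "(\<Sum>d\<in>c ` X. \<rho> d z) = (\<Sum>d\<in>c ` X. \<Sum>x\<in>{x\<in>X. c x = d}. \<beta> x z) / \<sigma> z"
        by (simp add: \<rho>_def sum_divide_distrib)
      also have "\<dots> = \<sigma> z / \<sigma> z"
        unfolding \<sigma>_def by (subst sum.group) (use X in auto)
      finally show ?thesis using \<sigma>[OF that] by simp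
    qed
    fix d assume d: "d \<in> c ` X"
    show "0 \<le> \<rho> d z" if "z \<in> topspace M" for z
      unfolding \<rho>_def using b X(2) \<sigma>[OF that] by (intro divide_nonneg_pos sum_nonneg) auto
    show "smooth_map_on \<A> (topspace M) (\<rho> d)"
      unfolding smooth_map_on_def
    proof
      fix e assume e: "e \<in> \<A>"
      have s: "smooth_on (coord e ` (chart_dom e \<inter> topspace M)) (\<lambda>y. \<beta> x (chart_inv e y))" if "x \<in> X" for x
        using b[of x] that X(2) e unfolding smooth_map_on_def o_def by blast
      have "\<sigma> (chart_inv e y) \<noteq> 0" if "y \<in> coord e ` (chart_dom e \<inter> topspace M)" for y
        using that \<sigma> e by force
      then show "smooth_on (coord e ` (chart_dom e \<inter> topspace M)) (\<rho> d \<circ> chart_inv e)"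
        unfolding o_def \<rho>_def \<sigma>_def by (intro smooth_on_divide smooth_on_sum s) auto
    qed
    show "M closure_of {z \<in> topspace M. \<rho> d z \<noteq> 0} \<subseteq> chart_dom d"
    proof -
      let ?C = "\<Union>x\<in>{x\<in>X. c x = d}. C x"
      have "{z \<in> topspace M. \<rho> d z \<noteq> 0} \<subseteq> ?C"
      proof
        fix z assume z: "z \<in> {z \<in> topspace M. \<rho> d z \<noteq> 0}"
        show "z \<in> ?C"
        proof (rule ccontr)
          assume "z \<notin> ?C"
          then have "\<beta> x z = 0" if "x \<in> X" "c x = d" for x
            using b[of x] X(2) that by auto
          then have "\<rho> d z = 0" by (simp add: \<rho>_def)
          then show False using z by simp
        qed
      qed
      moreover have "closedin M ?C"
        using X b by (intro closedin_Union) auto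
      ultimately have "M closure_of {z \<in> topspace M. \<rho> d z \<noteq> 0} \<subseteq> ?C"
        by (rule closure_of_minimal)
      also have "?C \<subseteq> chart_dom d" using b X(2) by blast
      finally show ?thesis .
    qed
  qed
  then show ?thesis by blast
qed

text \<open>The partition is chosen without reference to the form, so a single one serves the
  volumes at all times as well as the second variation integral.\<close>

lemma form_integral_partition:
  assumes "compact_space M"
  obtains C \<rho> where "partition_of_unity M \<A> C \<rho>"
    "\<And>\<omega>. form_integral M \<A> \<omega> = (\<Sum>c\<in>C. LINT y:cimage c|lborel. \<rho> c (chart_inv c y) * \<omega> c (chart_inv c y))"
proof -
  define P where "P = (SOME (C, \<rho>). partition_of_unity M \<A> C \<rho>)"
  obtain C \<rho> where P: "P = (C, \<rho>)" by (cases P)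
  have "case P of (C, \<rho>) \<Rightarrow> partition_of_unity M \<A> C \<rho>"
    unfolding P_def by (rule someI_ex) (use partition_of_unity_exists[OF assms] in auto)
  then have "partition_of_unity M \<A> C \<rho>" by (simp add: P)
  moreover have "form_integral M \<A> \<omega> = (\<Sum>c\<in>C. LINT y:cimage c|lborel. \<rho> c (chart_inv c y) * \<omega> c (chart_inv c y))" for \<omega>
    unfolding form_integral_def P_def[symmetric] P by simp
  ultimately show thesis using that by blast
qed

end

section \<open>Hypersurfaces of the light-cone in local coordinates\<close>

lemma bounded_bilinear_lorentz: "bounded_bilinear (lorentz :: 'n::finite minkowski \<Rightarrow> _)"
  unfolding bilinear_conv_bounded_bilinear[symmetric] bilinear_def lorentz_def
  by (auto intro!: linearI simp: algebra_simps inner_add_left inner_add_right)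

lemmas lorentz_simps =
  bounded_bilinear.add_left[OF bounded_bilinear_lorentz] bounded_bilinear.add_right[OF bounded_bilinear_lorentz]
  bounded_bilinear.scaleR_left[OF bounded_bilinear_lorentz] bounded_bilinear.scaleR_right[OF bounded_bilinear_lorentz]
  bounded_bilinear.sum_left[OF bounded_bilinear_lorentz] bounded_bilinear.sum_right[OF bounded_bilinear_lorentz]
  bounded_bilinear.diff_left[OF bounded_bilinear_lorentz] bounded_bilinear.diff_right[OF bounded_bilinear_lorentz]
  bounded_bilinear.zero_left[OF bounded_bilinear_lorentz] bounded_bilinear.zero_right[OF bounded_bilinear_lorentz]

lemma lorentz_commute: "lorentz v w = lorentz w v"
  by (simp add: lorentz_def inner_commute mult.commute)

text \<open>The product of v with its time reflection is the squared Euclidean norm of v.\<close>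

lemma lorentz_nondegenerate:
  assumes "\<And>w. lorentz v w = 0" shows "v = 0"
proof -
  have "(fst v)\<^sup>2 + (norm (snd v))\<^sup>2 = 0"
    using assms[of "(- fst v, snd v)"] by (simp add: lorentz_def power2_eq_square power2_norm_eq_inner[symmetric])
  then have "fst v = 0" "snd v = 0"
    by (simp_all add: add_nonneg_eq_0_iff)
  then show ?thesis by (simp add: prod_eq_iff)
qed

lemmas smooth_on_lorentz = smooth_on_bounded_bilinear[OF bounded_bilinear_lorentz]
lemmas deriv_in_lorentz = deriv_in_bounded_bilinear[OF _ bounded_bilinear_lorentz]

definition gram :: "(real^'n::finite) set \<Rightarrow> (real^'n \<Rightarrow> 'n minkowski) \<Rightarrow> real^'n \<Rightarrow> real^'n^'n" where
  "gram S f y = (\<chi> i j. lorentz (deriv_in S f y (axis i 1)) (deriv_in S f y (axis j 1)))"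

lemma linear_axis_expansion:
  fixes L :: "real^'n::finite \<Rightarrow> 'b::real_vector"
  assumes "linear L"
  shows "L v = (\<Sum>k\<in>UNIV. v $ k *\<^sub>R L (axis k 1))"
proof -
  have "v = (\<Sum>k\<in>UNIV. v $ k *\<^sub>R axis k 1)"
    by (simp add: vec_eq_iff sum_component axis_def if_distrib cong: if_cong)
  then have "L v = L (\<Sum>k\<in>UNIV. v $ k *\<^sub>R axis k 1)"
    by (rule arg_cong)
  also have "\<dots> = (\<Sum>k\<in>UNIV. v $ k *\<^sub>R L (axis k 1))"
    by (simp add: linear_sum[OF assms] linear_cmul[OF assms])
  finally show ?thesis .
qed

text \<open>The geometry inside one chart: S is the chart image, P and Q are p and q in coordinates.
  Openness of S is replaced by \<open>full_tangent\<close>, so that boundary points are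
  included.\<close>

locale light_cone_patch =
  fixes S :: "(real^'n::finite) set" and P Q :: "real^'n \<Rightarrow> 'n minkowski"
  assumes ft: "full_tangent S"
    and sP: "smooth_on S P" and sQ: "smooth_on S Q"
    and PP: "y \<in> S \<Longrightarrow> lorentz (P y) (P y) = 0"
    and QQ: "y \<in> S \<Longrightarrow> lorentz (Q y) (Q y) = 0"
    and PQ: "y \<in> S \<Longrightarrow> lorentz (P y) (Q y) = 1"
    and dPQ: "y \<in> S \<Longrightarrow> lorentz (deriv_in S P y v) (Q y) = 0"
    and pos: "y \<in> S \<Longrightarrow> positive_definite (gram S P y)"
begin

abbreviation pd :: "'n \<Rightarrow> (real^'n \<Rightarrow> 'b::real_normed_vector) \<Rightarrow> real^'n \<Rightarrow> 'b" where
  "pd i f y \<equiv> deriv_in S f y (axis i 1)"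

abbreviation "G \<equiv> gram S P"
abbreviation "Gi y \<equiv> matrix_inv (G y)"

definition sff :: "real^'n \<Rightarrow> real^'n^'n" where
  "sff y = (\<chi> i j. lorentz (pd i (pd j P) y) (Q y))"

lemma spd: "smooth_on S f \<Longrightarrow> smooth_on S (pd i f)"
  by (rule smooth_on_deriv_in[OF ft])

lemma G_nth: "G y $ i $ j = lorentz (pd i P y) (pd j P y)"
  by (simp add: gram_def)

lemma sG: "smooth_on S G"
  unfolding gram_def by (intro smooth_on_vec_lambda smooth_on_lorentz spd sP)

lemma sG_nth: "smooth_on S (\<lambda>y. G y $ i $ j)"
  by (intro smooth_on_vec_nth sG)

lemma G_sym: "G y $ i $ j = G y $ j $ i"
  by (simp add: G_nth lorentz_commute)

lemma detG_pos: "y \<in> S \<Longrightarrow> det (G y) > 0"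
  by (rule positive_definite_det_pos[OF pos])

lemma detG_nz: "y \<in> S \<Longrightarrow> det (G y) \<noteq> 0"
  using detG_pos by force

lemma sGi: "smooth_on S Gi"
  by (rule smooth_on_matrix_inv[OF sG detG_nz])

lemma sGi_nth: "smooth_on S (\<lambda>y. Gi y $ i $ j)"
  by (intro smooth_on_vec_nth sGi)

lemma Gi_G: assumes "y \<in> S" shows "(\<Sum>l\<in>UNIV. Gi y $ k $ l * G y $ l $ m) = (if k = m then 1 else 0)"
  using matrix_inv_works(1)[OF detG_nz[OF assms]] by (simp add: vec_eq_iff matrix_matrix_mult_def mat_def)

lemma Gi_sym: assumes "y \<in> S" shows "Gi y $ i $ j = Gi y $ j $ i"
proof -
  have "transpose (G y) = G y" by (simp add: transpose_def vec_eq_iff G_sym)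
  then have "transpose (Gi y) ** G y = mat 1"
    using matrix_inv_works(2)[OF detG_nz[OF assms]] matrix_transpose_mul[of "G y" "Gi y"] by simp
  then have "transpose (Gi y) = Gi y"
    using matrix_inv_works[OF detG_nz[OF assms]]
    by (metis matrix_mul_assoc matrix_mul_lid matrix_mul_rid)
  moreover have "transpose (Gi y) $ i $ j = Gi y $ j $ i" by (simp add: transpose_def)
  ultimately show ?thesis by simp
qed

lemma G_Gi: assumes "y \<in> S" shows "(\<Sum>l\<in>UNIV. G y $ m $ l * Gi y $ l $ k) = (if k = m then 1 else 0)"
  using Gi_G[OF assms, of k m] by (simp add: Gi_sym[OF assms, of k] G_sym[of y m] mult.commute)

lemma pd_lorentz:
  assumes "smooth_on S f" "smooth_on S g" "y \<in> S"
  shows "pd i (\<lambda>z. lorentz (f z) (g z)) y = lorentz (f y) (pd i g y) + lorentz (pd i f y) (g y)"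
  by (rule deriv_in_lorentz[OF ft assms])

text \<open>Source of the frame relations below, each of which comes from differentiating a constant
  product of P, Q and the derivatives of P.\<close>

lemma lorentz_pd_eq:
  assumes "smooth_on S f" "smooth_on S g" "y \<in> S" "\<And>z. z \<in> S \<Longrightarrow> lorentz (f z) (g z) = c"
  shows "lorentz (f y) (pd i g y) = - lorentz (pd i f y) (g y)"
proof -
  have "pd i (\<lambda>z. lorentz (f z) (g z)) y = pd i (\<lambda>z. c) y"
    by (rule fun_cong[OF deriv_in_cong[OF assms(3,4)]])
  then have "pd i (\<lambda>z. lorentz (f z) (g z)) y = 0"
    by (simp add: deriv_in_const[OF ft assms(3)])
  then show ?thesis
    unfolding pd_lorentz[OF assms(1-3)] by linarith
qed

lemma dP_P: "y \<in> S \<Longrightarrow> lorentz (pd i P y) (P y) = 0"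
  using lorentz_pd_eq[OF sP sP _ PP, of y i] by (simp add: lorentz_commute)

lemma dQ_Q: "y \<in> S \<Longrightarrow> lorentz (pd i Q y) (Q y) = 0"
  using lorentz_pd_eq[OF sQ sQ _ QQ, of y i] by (simp add: lorentz_commute)

lemma dQ_P: "y \<in> S \<Longrightarrow> lorentz (pd i Q y) (P y) = 0"
  using lorentz_pd_eq[OF sP sQ _ PQ, of y i] dPQ[of y "axis i 1"] by (simp add: lorentz_commute)

lemma ddP_P: "y \<in> S \<Longrightarrow> lorentz (pd i (pd j P) y) (P y) = - G y $ i $ j"
  using lorentz_pd_eq[where f = "pd j P" and g = P and i = i and y = y, OF spd[OF sP] sP _ dP_P]
  by (simp add: G_nth lorentz_commute)

text \<open>Weingarten equation, from differentiating the orthogonality of Q to the derivatives of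
  P.\<close>

lemma dP_dQ: "y \<in> S \<Longrightarrow> lorentz (pd j P y) (pd i Q y) = - sff y $ i $ j"
  using lorentz_pd_eq[where f = "pd j P" and g = Q and i = i and y = y, OF spd[OF sP] sQ _ dPQ]
  by (simp add: sff_def)

lemma pd_commute:
  fixes f :: "real^'n \<Rightarrow> 'b::euclidean_space"
  shows "smooth_on S f \<Longrightarrow> y \<in> S \<Longrightarrow> pd i (pd j f) y = pd j (pd i f) y"
  by (rule deriv_in_symmetric[OF ft])

lemma sff_sym: "y \<in> S \<Longrightarrow> sff y $ i $ j = sff y $ j $ i"
  by (simp add: sff_def pd_commute[OF sP])

text \<open>The derivatives of P together with P and Q are n + 2 independent vectors, so they span,
  and the product is nondegenerate. Independence holds because products with Q and P isolate the
  coefficients of P and Q, and on the remaining tangent part the product is the positive definite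
  \<open>G\<close>.\<close>

lemma orthogonal_imp_0:
  assumes y: "y \<in> S" and v: "\<And>k. lorentz v (pd k P y) = 0" "lorentz v (P y) = 0" "lorentz v (Q y) = 0"
  shows "v = 0"
proof -
  define \<Phi> :: "(real^'n) \<times> real \<times> real \<Rightarrow> 'n minkowski" where
    "\<Phi> = (\<lambda>(u, s, t). (\<Sum>k\<in>UNIV. u $ k *\<^sub>R pd k P y) + s *\<^sub>R P y + t *\<^sub>R Q y)"
  have lin: "linear \<Phi>"
    by (rule linearI) (auto simp: \<Phi>_def algebra_simps sum.distrib scaleR_sum_right)
  have inj: "inj \<Phi>"
  proof (rule iffD2[OF linear_injective_0[OF lin]], intro allI impI)
    fix x assume x: "\<Phi> x = 0"
    obtain u s t where x3: "x = (u, s, t)" by (cases x)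
    define w where "w = (\<Sum>k\<in>UNIV. u $ k *\<^sub>R pd k P y)"
    have 0: "w + s *\<^sub>R P y + t *\<^sub>R Q y = 0" using x by (simp add: \<Phi>_def x3 w_def)
    have wP: "lorentz w (P y) = 0" "lorentz w (Q y) = 0"
      by (simp_all add: w_def lorentz_simps dP_P dPQ y)
    have "s = lorentz (w + s *\<^sub>R P y + t *\<^sub>R Q y) (Q y)"
      by (simp add: lorentz_simps wP PQ QQ y)
    then have s: "s = 0" by (simp add: 0 lorentz_simps)
    have "t = lorentz (w + s *\<^sub>R P y + t *\<^sub>R Q y) (P y)"
      using PQ[OF y] by (simp add: lorentz_simps wP PP y lorentz_commute)
    then have t: "t = 0" by (simp add: 0 lorentz_simps)
    have "w = 0" using 0 s t by simp
    then have "0 = lorentz w w" by (simp add: lorentz_simps)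
    also have "\<dots> = u \<bullet> (G y *v u)"
      by (simp add: w_def lorentz_simps inner_vec_def matrix_vector_mult_def G_nth sum_distrib_left mult_ac lorentz_commute)
    finally have "u = 0" using pos[OF y] by (metis less_irrefl positive_definite_def)
    then show "x = 0" by (simp add: x3 s t zero_prod_def)
  qed
  have "dim (range \<Phi>) = DIM((real^'n) \<times> real \<times> real)"
    using dim_image_eq[OF lin, of UNIV] inj by simp
  also have "\<dots> = DIM('n minkowski)" by simp
  finally have "span (range \<Phi>) = UNIV" using dim_eq_full by blast
  then have surj: "range \<Phi> = UNIV"
    using linear_subspace_image[OF lin subspace_UNIV] span_eq_iff by metis
  show ?thesis
  proof (rule lorentz_nondegenerate)
    fix w
    obtain x where "w = \<Phi> x" using surj by (metis UNIV_I image_iff)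
    then show "lorentz v w = 0"
      by (cases x) (simp add: \<Phi>_def lorentz_simps v)
  qed
qed

text \<open>The components of a vector along the \<open>\<partial>\<^sub>k P\<close> in the frame \<open>\<partial>\<^sub>1 P, \<dots>, \<partial>\<^sub>n P, P, Q\<close>.\<close>

definition cmp :: "real^'n \<Rightarrow> 'n \<Rightarrow> 'n minkowski \<Rightarrow> real" where
  "cmp y k v = (\<Sum>l\<in>UNIV. Gi y $ k $ l * lorentz v (pd l P y))"

lemma sum_delta_mult: "(\<Sum>k\<in>UNIV. b k * (if k = m then 1 else 0)) = (b m :: real)"
  "(\<Sum>k\<in>UNIV. b k * (if m = k then 1 else 0)) = b m" for m :: 'n
  by (simp_all add: if_distrib cong: if_cong)

text \<open>P and Q are null with product 1, so the coefficient of P is the product with Q and vice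
  versa.\<close>

lemma frame_decomposition:
  assumes y: "y \<in> S"
  shows "v = (\<Sum>k\<in>UNIV. cmp y k v *\<^sub>R pd k P y) + lorentz v (Q y) *\<^sub>R P y + lorentz v (P y) *\<^sub>R Q y"
    (is "v = ?r")
proof -
  have "v - ?r = 0"
  proof (rule orthogonal_imp_0[OF y])
    fix m
    have "(\<Sum>k\<in>UNIV. cmp y k v * lorentz (pd k P y) (pd m P y)) =
        (\<Sum>k\<in>UNIV. \<Sum>l\<in>UNIV. lorentz v (pd l P y) * (G y $ m $ k * Gi y $ k $ l))"
      unfolding cmp_def sum_distrib_right
      by (intro sum.cong refl) (simp add: G_nth lorentz_commute[of "pd m P y"])
    also have "\<dots> = (\<Sum>l\<in>UNIV. lorentz v (pd l P y) * (\<Sum>k\<in>UNIV. G y $ m $ k * Gi y $ k $ l))"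
      by (subst sum.swap) (simp add: sum_distrib_left)
    also have "\<dots> = lorentz v (pd m P y)"
      by (simp add: G_Gi[OF y] sum_delta_mult)
    finally show "lorentz (v - ?r) (pd m P y) = 0"
      using dP_P[OF y, of m] dPQ[OF y, of "axis m 1"]
      by (simp add: lorentz_simps lorentz_commute[of _ "pd m P y"])
  next
    show "lorentz (v - ?r) (P y) = 0"
      using PQ[OF y] by (simp add: lorentz_simps dP_P PP y lorentz_commute[of "Q y"])
    show "lorentz (v - ?r) (Q y) = 0"
      by (simp add: lorentz_simps dPQ PQ QQ y)
  qed
  then show ?thesis by simp
qed

lemma cmp_linear: "cmp y k (v + w) = cmp y k v + cmp y k w" "cmp y k (r *\<^sub>R v) = r * cmp y k v"
   "cmp y k (v - w) = cmp y k v - cmp y k w"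
   "cmp y k (\<Sum>i\<in>I. f i) = (\<Sum>i\<in>I. cmp y k (f i))"
proof -
  show 1: "cmp y k (v + w) = cmp y k v + cmp y k w" for v w
    by (simp add: cmp_def lorentz_simps algebra_simps sum.distrib)
  show "cmp y k (r *\<^sub>R v) = r * cmp y k v"
    by (simp add: cmp_def lorentz_simps sum_distrib_left algebra_simps)
  show "cmp y k (v - w) = cmp y k v - cmp y k w"
    by (simp add: cmp_def lorentz_simps algebra_simps sum_subtractf)
  show "cmp y k (\<Sum>i\<in>I. f i) = (\<Sum>i\<in>I. cmp y k (f i))"
    unfolding cmp_def lorentz_simps sum_distrib_left by (rule sum.swap)
qed

lemma cmp_frame:
  assumes y: "y \<in> S"
  shows "cmp y k (pd m P y) = (if k = m then 1 else 0)" "cmp y k (P y) = 0" "cmp y k (Q y) = 0"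
proof -
  show "cmp y k (pd m P y) = (if k = m then 1 else 0)"
    using Gi_G[OF y, of k m] by (simp add: cmp_def G_nth lorentz_commute)
  show "cmp y k (P y) = 0" using dP_P[OF y] by (simp add: cmp_def lorentz_commute)
  show "cmp y k (Q y) = 0" using dPQ[OF y] by (simp add: cmp_def lorentz_commute)
qed

section \<open>Curvature of the coordinate metric and the Gauss equation\<close>

definition chr :: "'n \<Rightarrow> 'n \<Rightarrow> 'n \<Rightarrow> real^'n \<Rightarrow> real" where
  "chr k i j y = (\<Sum>l\<in>UNIV. Gi y $ k $ l *
     (pd i (\<lambda>y. G y $ j $ l) y + pd j (\<lambda>y. G y $ i $ l) y - pd l (\<lambda>y. G y $ i $ j) y)) / 2"

definition riem :: "'n \<Rightarrow> 'n \<Rightarrow> 'n \<Rightarrow> 'n \<Rightarrow> real^'n \<Rightarrow> real" where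
  "riem l i j k y = pd i (chr l j k) y - pd j (chr l i k) y
     + (\<Sum>m\<in>UNIV. chr l i m y * chr m j k y - chr l j m y * chr m i k y)"

definition scal :: "real^'n \<Rightarrow> real" where
  "scal y = (\<Sum>j\<in>UNIV. \<Sum>k\<in>UNIV. Gi y $ j $ k * (\<Sum>i\<in>UNIV. riem i i j k y))"

lemma pd_G: "y \<in> S \<Longrightarrow> pd k (\<lambda>y. G y $ i $ j) y =
    lorentz (pd i P y) (pd k (pd j P) y) + lorentz (pd k (pd i P) y) (pd j P y)"
  unfolding G_nth by (rule pd_lorentz[OF spd[OF sP] spd[OF sP]])

text \<open>The Koszul combination of derivatives of the metric collapses to twice the product of a
  second derivative of P with \<open>pd l P\<close>. Christoffel symbols are thus the tangential
  frame components of the second derivatives.\<close>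

lemma chr_eq:
  assumes y: "y \<in> S"
  shows "chr k i j y = cmp y k (pd i (pd j P) y)"
proof -
  have "pd i (\<lambda>y. G y $ j $ l) y + pd j (\<lambda>y. G y $ i $ l) y - pd l (\<lambda>y. G y $ i $ j) y =
      2 * lorentz (pd i (pd j P) y) (pd l P y)" for l
    using pd_commute[OF sP y, of j i] pd_commute[OF sP y, of i l] pd_commute[OF sP y, of j l]
    by (simp add: pd_G y lorentz_commute)
  then show ?thesis
    by (simp add: chr_def cmp_def sum_divide_distrib)
qed

lemma schr: "smooth_on S (chr k i j)"
proof -
  have "smooth_on S (\<lambda>y. cmp y k (pd i (pd j P) y))"
    unfolding cmp_def by (intro smooth_on_sum smooth_on_mult sGi_nth smooth_on_lorentz spd sP)
  then show ?thesis by (rule smooth_on_cong) (simp add: chr_eq)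
qed

lemma pd_scaleR:
  assumes "smooth_on S f" "smooth_on S g" "y \<in> S"
  shows "pd i (\<lambda>z. f z *\<^sub>R g z) y = f y *\<^sub>R pd i g y + pd i f y *\<^sub>R g y"
  by (rule deriv_in_scaleR[OF ft assms])

text \<open>Gauss equation, in the form obtained from the symmetry of the third derivatives of \<open>P\<close>.\<close>

lemma riem_eq:
  assumes y: "y \<in> S"
  shows "riem l i j k y = sff y $ i $ k * (if l = j then 1 else 0) - sff y $ j $ k * (if l = i then 1 else 0)
    + G y $ i $ k * (\<Sum>s\<in>UNIV. Gi y $ l $ s * sff y $ j $ s) - G y $ j $ k * (\<Sum>s\<in>UNIV. Gi y $ l $ s * sff y $ i $ s)"
proof -
  have sII: "smooth_on S (\<lambda>z. sff z $ j $ k)" for j k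
    unfolding sff_def by (simp, intro smooth_on_lorentz spd sP sQ)
  have cQ: "cmp y l (pd i Q y) = - (\<Sum>s\<in>UNIV. Gi y $ l $ s * sff y $ i $ s)" for i
    using dP_dQ[OF y] by (simp add: cmp_def lorentz_commute sum_negf)
  have third: "cmp y l (pd i (pd j (pd k P)) y) =
      pd i (chr l j k) y + (\<Sum>m\<in>UNIV. chr l i m y * chr m j k y)
      + sff y $ j $ k * (if l = i then 1 else 0)
      + G y $ j $ k * (\<Sum>s\<in>UNIV. Gi y $ l $ s * sff y $ i $ s)" for i j
  proof -
    \<comment> \<open>Gauss formula: the coefficient of P is \<open>sff\<close>, and that of Q is
      the product with P, which is minus the metric.\<close>
    have "pd j (pd k P) z = (\<Sum>m\<in>UNIV. chr m j k z *\<^sub>R pd m P z) + (sff z $ j $ k *\<^sub>R P z - G z $ j $ k *\<^sub>R Q z)"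
      if "z \<in> S" for z
    proof -
      have "pd j (pd k P) z = (\<Sum>m\<in>UNIV. chr m j k z *\<^sub>R pd m P z) + sff z $ j $ k *\<^sub>R P z
          + lorentz (pd j (pd k P) z) (P z) *\<^sub>R Q z"
        using frame_decomposition[OF that, of "pd j (pd k P) z"] by (simp add: chr_eq that sff_def)
      then show ?thesis by (simp add: ddP_P that)
    qed
    then have "pd i (pd j (pd k P)) y =
        pd i (\<lambda>z. (\<Sum>m\<in>UNIV. chr m j k z *\<^sub>R pd m P z) + (sff z $ j $ k *\<^sub>R P z - G z $ j $ k *\<^sub>R Q z)) y"
      by (rule fun_cong[OF deriv_in_cong[OF y]])
    also have "\<dots> = pd i (\<lambda>z. \<Sum>m\<in>UNIV. chr m j k z *\<^sub>R pd m P z) y + pd i (\<lambda>z. sff z $ j $ k *\<^sub>R P z - G z $ j $ k *\<^sub>R Q z) y"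
      by (intro deriv_in_add ft y smooth_on_sum smooth_on_diff smooth_on_scaleR schr spd sP sQ sII sG_nth)
    also have "pd i (\<lambda>z. \<Sum>m\<in>UNIV. chr m j k z *\<^sub>R pd m P z) y = (\<Sum>m\<in>UNIV. pd i (\<lambda>z. chr m j k z *\<^sub>R pd m P z) y)"
      by (intro deriv_in_sum ft y smooth_on_scaleR schr spd sP)
    also have "\<dots> = (\<Sum>m\<in>UNIV. chr m j k y *\<^sub>R pd i (pd m P) y + pd i (chr m j k) y *\<^sub>R pd m P y)"
      by (intro sum.cong refl pd_scaleR schr spd sP y)
    also have "pd i (\<lambda>z. sff z $ j $ k *\<^sub>R P z - G z $ j $ k *\<^sub>R Q z) y =
        pd i (\<lambda>z. sff z $ j $ k *\<^sub>R P z) y - pd i (\<lambda>z. G z $ j $ k *\<^sub>R Q z) y"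
      by (intro deriv_in_diff ft y smooth_on_scaleR sII sG_nth sP sQ)
    also have "pd i (\<lambda>z. sff z $ j $ k *\<^sub>R P z) y = sff y $ j $ k *\<^sub>R pd i P y + pd i (\<lambda>z. sff z $ j $ k) y *\<^sub>R P y"
      by (intro pd_scaleR sII sP y)
    also have "pd i (\<lambda>z. G z $ j $ k *\<^sub>R Q z) y = G y $ j $ k *\<^sub>R pd i Q y + pd i (\<lambda>z. G z $ j $ k) y *\<^sub>R Q y"
      by (intro pd_scaleR sG_nth sQ y)
    finally have "pd i (pd j (pd k P)) y = (\<Sum>m\<in>UNIV. chr m j k y *\<^sub>R pd i (pd m P) y + pd i (chr m j k) y *\<^sub>R pd m P y)
        + (sff y $ j $ k *\<^sub>R pd i P y + pd i (\<lambda>z. sff z $ j $ k) y *\<^sub>R P y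
        - (G y $ j $ k *\<^sub>R pd i Q y + pd i (\<lambda>z. G z $ j $ k) y *\<^sub>R Q y))" .
    then have "cmp y l (pd i (pd j (pd k P)) y) =
        (\<Sum>m\<in>UNIV. chr m j k y * chr l i m y + pd i (chr m j k) y * (if l = m then 1 else 0))
        + sff y $ j $ k * (if l = i then 1 else 0) - G y $ j $ k * cmp y l (pd i Q y)"
      by (simp only: cmp_linear cmp_frame[OF y] chr_eq[OF y, symmetric])
    then show ?thesis
      unfolding sum.distrib sum_delta_mult cQ by (simp add: mult.commute[of "chr _ j k y"])
  qed
  \<comment> \<open>The third derivative is symmetric in i and j; the difference of its two
    expansions is the curvature plus the terms in \<open>G\<close> and \<open>sff\<close>.\<close>
  have "pd i (pd j (pd k P)) y = pd j (pd i (pd k P)) y"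
    by (rule pd_commute[OF spd[OF sP] y])
  then have "cmp y l (pd i (pd j (pd k P)) y) = cmp y l (pd j (pd i (pd k P)) y)"
    by simp
  then show ?thesis
    unfolding third riem_def sum_subtractf by linarith
qed

text \<open>With a for \<open>sff\<close>, one contraction of the Gauss equation gives Ric = (2 - n)
  a - (tr A) g, and the second gives (2 - n) tr A - n tr A.\<close>

lemma scal_eq:
  assumes y: "y \<in> S"
  shows "scal y = (2 - 2 * real CARD('n)) * trace (Gi y ** sff y)"
proof -
  define T where "T = trace (Gi y ** sff y)"
  have T: "(\<Sum>i\<in>UNIV. \<Sum>s\<in>UNIV. Gi y $ i $ s * sff y $ i $ s) = T"
    using sff_sym[OF y] by (simp add: T_def trace_def matrix_matrix_mult_def)
  have ric: "(\<Sum>i\<in>UNIV. riem i i j k y) = (2 - real CARD('n)) * sff y $ j $ k - G y $ j $ k * T" for j k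
  proof -
    have "(\<Sum>i\<in>UNIV. G y $ i $ k * (\<Sum>s\<in>UNIV. Gi y $ i $ s * sff y $ j $ s)) =
        (\<Sum>s\<in>UNIV. sff y $ j $ s * (\<Sum>i\<in>UNIV. Gi y $ s $ i * G y $ i $ k))"
      unfolding sum_distrib_left by (subst sum.swap) (simp add: Gi_sym[OF y] mult_ac)
    also have "\<dots> = sff y $ j $ k" by (simp add: Gi_G[OF y] sum_delta_mult)
    finally have 1: "(\<Sum>i\<in>UNIV. G y $ i $ k * (\<Sum>s\<in>UNIV. Gi y $ i $ s * sff y $ j $ s)) = sff y $ j $ k" .
    have "(\<Sum>i\<in>UNIV. riem i i j k y) = sff y $ j $ k - real CARD('n) * sff y $ j $ k + sff y $ j $ k - G y $ j $ k * T"
      unfolding riem_eq[OF y] sum.distrib sum_subtractf 1 sum_delta_mult T[symmetric] sum_distrib_left[symmetric] by simp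
    then show ?thesis by (simp add: algebra_simps)
  qed
  have "scal y = (\<Sum>j\<in>UNIV. \<Sum>k\<in>UNIV. (2 - real CARD('n)) * (Gi y $ j $ k * sff y $ j $ k) - T * (Gi y $ j $ k * G y $ k $ j))"
    by (simp add: scal_def ric G_sym[of y] algebra_simps)
  also have "\<dots> = (2 - real CARD('n)) * T - T * (\<Sum>j\<in>UNIV. \<Sum>k\<in>UNIV. Gi y $ j $ k * G y $ k $ j)"
    unfolding sum_subtractf sum_distrib_left[symmetric] T ..
  also have "(\<Sum>j\<in>UNIV. \<Sum>k\<in>UNIV. Gi y $ j $ k * G y $ k $ j) = real CARD('n)"
    by (simp add: Gi_G[OF y])
  finally show ?thesis by (simp add: T_def algebra_simps)
qed

end

section \<open>Divergence of the tangential part of a field\<close>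

context light_cone_patch begin

lemma trace_Gi_mult:
  assumes "\<And>i j. A $ i $ j = A $ j $ i"
  shows "trace (Gi y ** A) = (\<Sum>i\<in>UNIV. \<Sum>j\<in>UNIV. Gi y $ i $ j * A $ i $ j)"
  by (simp add: trace_def matrix_matrix_mult_def assms[of _ i for i])

abbreviation vol :: "real^'n \<Rightarrow> real" where
  "vol y \<equiv> sqrt (det (G y))"

lemma svol: "smooth_on S vol"
  by (intro smooth_on_sqrt smooth_on_det sG detG_pos)

text \<open>The product with \<open>conormal i\<close> reads off the i-th contravariant component of
  the tangential part of a vector, times the volume density. Summing its coordinate derivatives over
  i gives the Riemannian divergence times the density.\<close>

definition conormal :: "'n \<Rightarrow> real^'n \<Rightarrow> 'n minkowski" where
  "conormal i z = (\<Sum>j\<in>UNIV. (vol z * Gi z $ i $ j) *\<^sub>R pd j P z)"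

lemma sconormal: "smooth_on S (conormal i)"
  unfolding conormal_def by (intro smooth_on_sum smooth_on_scaleR smooth_on_mult svol sGi_nth spd sP)

lemma conormal_lorentz:
  "lorentz (conormal i y) v = vol y * (\<Sum>j\<in>UNIV. Gi y $ i $ j * lorentz (pd j P y) v)"
  by (simp add: conormal_def lorentz_simps sum_distrib_left mult.assoc)

lemma conormal_frame:
  assumes y: "y \<in> S"
  shows "lorentz (conormal i y) (pd k P y) = (if i = k then vol y else 0)"
    and "lorentz (conormal i y) (P y) = 0" and "lorentz (conormal i y) (Q y) = 0"
  using Gi_G[OF y, of i k] by (simp_all add: conormal_lorentz G_nth dP_P dPQ y)

text \<open>The induced Laplacian of \<open>P\<close> is \<open>- n Q\<close> when the trace of the shape operator vanishes; in
  divergence form this needs no Christoffel symbols, since it can be tested against the frame.\<close>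

lemma divergence_conormal:
  assumes y: "y \<in> S" and tr: "trace (Gi y ** sff y) = 0"
  shows "(\<Sum>i\<in>UNIV. pd i (conormal i) y) = (- (real CARD('n) * vol y)) *\<^sub>R Q y"
proof -
  let ?Z = "\<Sum>i\<in>UNIV. pd i (conormal i) y"
  have "?Z + (real CARD('n) * vol y) *\<^sub>R Q y = 0"
  proof (rule orthogonal_imp_0[OF y])
    fix k
    \<comment> \<open>Against \<open>pd k P\<close>: by Jacobi's formula the derivative of the
      density cancels the terms with mixed second derivatives of P.\<close>
    have "lorentz (pd i (conormal i) y) (pd k P y) = (if i = k then pd k vol y else 0) - lorentz (conormal i y) (pd k (pd i P) y)" for i
    proof -
      have "pd i (\<lambda>z. lorentz (conormal i z) (pd k P z)) y = (if i = k then pd k vol y else 0)"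
        using deriv_in_cong[OF y, of "\<lambda>z. lorentz (conormal i z) (pd k P z)" "\<lambda>z. if i = k then vol z else 0"]
        by (cases "i = k") (simp_all add: conormal_frame deriv_in_const[OF ft y])
      moreover have "pd i (\<lambda>z. lorentz (conormal i z) (pd k P z)) y =
          lorentz (conormal i y) (pd i (pd k P) y) + lorentz (pd i (conormal i) y) (pd k P y)"
        by (rule pd_lorentz[OF sconormal spd[OF sP] y])
      ultimately show ?thesis
        using pd_commute[OF sP y, of k i] by simp
    qed
    then have "lorentz ?Z (pd k P y) = pd k vol y - (\<Sum>i\<in>UNIV. lorentz (conormal i y) (pd k (pd i P) y))"
      by (simp add: lorentz_simps sum_subtractf)
    also have "(\<Sum>i\<in>UNIV. lorentz (conormal i y) (pd k (pd i P) y)) =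
        vol y * (\<Sum>i\<in>UNIV. \<Sum>j\<in>UNIV. Gi y $ i $ j * lorentz (pd j P y) (pd k (pd i P) y))"
      by (simp add: conormal_lorentz sum_distrib_left)
    also have "pd k vol y = vol y / 2 * trace (Gi y ** pd k G y)"
      by (rule deriv_in_sqrt_det[OF ft sG detG_pos[OF y] y])
    also have "trace (Gi y ** pd k G y) = (\<Sum>i\<in>UNIV. \<Sum>j\<in>UNIV. Gi y $ i $ j * pd k G y $ i $ j)"
    proof (rule trace_Gi_mult)
      fix i j
      have "pd k G y $ i $ j = pd k (\<lambda>y. G y $ i $ j) y" for i j
        using deriv_in_vec_nth[OF ft smooth_on_vec_nth[OF sG] y, of i j] deriv_in_vec_nth[OF ft sG y, of i] by simp
      then show "pd k G y $ i $ j = pd k G y $ j $ i" using G_sym by simp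
    qed
    also have "\<dots> = (\<Sum>i\<in>UNIV. \<Sum>j\<in>UNIV. Gi y $ i $ j * lorentz (pd i P y) (pd k (pd j P) y))
        + (\<Sum>i\<in>UNIV. \<Sum>j\<in>UNIV. Gi y $ i $ j * lorentz (pd j P y) (pd k (pd i P) y))"
    proof -
      have "pd k G y $ i $ j = lorentz (pd i P y) (pd k (pd j P) y) + lorentz (pd j P y) (pd k (pd i P) y)" for i j
      proof -
        have "pd k G y $ i $ j = pd k (\<lambda>y. G y $ i $ j) y"
          using deriv_in_vec_nth[OF ft smooth_on_vec_nth[OF sG] y, of i j] deriv_in_vec_nth[OF ft sG y, of i] by simp
        also have "\<dots> = lorentz (pd i P y) (pd k (pd j P) y) + lorentz (pd j P y) (pd k (pd i P) y)"
          using pd_G[where y = y and k = k and i = i and j = j, OF y] lorentz_commute[of "pd k (pd i P) y" "pd j P y"] by simp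
        finally show ?thesis .
      qed
      then show ?thesis by (simp add: distrib_left sum.distrib)
    qed
    also have "(\<Sum>i\<in>UNIV. \<Sum>j\<in>UNIV. Gi y $ i $ j * lorentz (pd i P y) (pd k (pd j P) y)) =
        (\<Sum>i\<in>UNIV. \<Sum>j\<in>UNIV. Gi y $ i $ j * lorentz (pd j P y) (pd k (pd i P) y))"
      by (subst sum.swap) (simp add: Gi_sym[OF y])
    finally have "lorentz ?Z (pd k P y) = 0" by simp
    then show "lorentz (?Z + (real CARD('n) * vol y) *\<^sub>R Q y) (pd k P y) = 0"
      using dPQ[OF y] by (simp add: lorentz_simps lorentz_commute[of "Q y"])
  next
    \<comment> \<open>Against P: each index contributes minus the density, which is the origin of
      the factor n.\<close>
    have "lorentz (pd i (conormal i) y) (P y) = - lorentz (conormal i y) (pd i P y)" for i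
      using lorentz_pd_eq[OF sconormal sP y, of i 0 i] conormal_frame(2) by simp
    then have "lorentz ?Z (P y) = - (\<Sum>i\<in>(UNIV::'n set). vol y)"
      by (simp add: lorentz_simps conormal_frame(1)[OF y] sum_negf)
    then show "lorentz (?Z + (real CARD('n) * vol y) *\<^sub>R Q y) (P y) = 0"
      using PQ[OF y] by (simp add: lorentz_simps lorentz_commute[of "Q y"])
  next
    \<comment> \<open>Against Q: what is left is the density times tr A, and here \<open>tr\<close>
      enters.\<close>
    have "lorentz (pd i (conormal i) y) (Q y) = - lorentz (conormal i y) (pd i Q y)" for i
      using lorentz_pd_eq[OF sconormal sQ y, of i 0 i] conormal_frame(3) by simp
    then have "lorentz ?Z (Q y) = vol y * (\<Sum>i\<in>UNIV. \<Sum>j\<in>UNIV. Gi y $ i $ j * sff y $ i $ j)"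
      by (simp add: lorentz_simps conormal_lorentz dP_dQ[OF y] sum_negf sum_distrib_left)
    also have "(\<Sum>i\<in>UNIV. \<Sum>j\<in>UNIV. Gi y $ i $ j * sff y $ i $ j) = 0"
      using trace_Gi_mult[OF sff_sym[OF y]] tr by simp
    finally show "lorentz (?Z + (real CARD('n) * vol y) *\<^sub>R Q y) (Q y) = 0"
      by (simp add: lorentz_simps QQ y)
  qed
  then show ?thesis by (simp add: eq_neg_iff_add_eq_0)
qed

text \<open>Half the metric trace of the first-order change of the induced metric under the
  displacement field Y.\<close>

definition trace_dP :: "(real^'n \<Rightarrow> 'n minkowski) \<Rightarrow> real^'n \<Rightarrow> real" where
  "trace_dP Y y = (\<Sum>i\<in>UNIV. \<Sum>j\<in>UNIV. Gi y $ i $ j * lorentz (pd j P y) (pd i Y y))"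

text \<open>Product rule together with \<open>divergence_conormal\<close>; the cut-off leaves the
  derivative of \<open>\<rho>\<close> along the tangential part of Y as an extra term.\<close>

lemma divergence_tangential:
  assumes y: "y \<in> S" and tr: "trace (Gi y ** sff y) = 0" and Y: "smooth_on S Y" and \<rho>: "smooth_on S \<rho>"
  shows "(\<Sum>i\<in>UNIV. pd i (\<lambda>z. \<rho> z * lorentz (conormal i z) (Y z)) y) =
    (\<Sum>i\<in>UNIV. pd i \<rho> y * lorentz (conormal i y) (Y y))
    + \<rho> y * (vol y * trace_dP Y y - real CARD('n) * vol y * lorentz (Y y) (Q y))"
proof -
  have "pd i (\<lambda>z. \<rho> z * lorentz (conormal i z) (Y z)) y =
     pd i \<rho> y * lorentz (conormal i y) (Y y) + \<rho> y * (lorentz (conormal i y) (pd i Y y) + lorentz (pd i (conormal i) y) (Y y))" for i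
    using deriv_in_mult[OF ft \<rho> smooth_on_lorentz[OF sconormal Y] y] pd_lorentz[OF sconormal Y y, of i i]
    by simp
  then have "(\<Sum>i\<in>UNIV. pd i (\<lambda>z. \<rho> z * lorentz (conormal i z) (Y z)) y) =
     (\<Sum>i\<in>UNIV. pd i \<rho> y * lorentz (conormal i y) (Y y))
     + \<rho> y * ((\<Sum>i\<in>UNIV. lorentz (conormal i y) (pd i Y y)) + lorentz (\<Sum>i\<in>UNIV. pd i (conormal i) y) (Y y))"
    by (simp add: sum.distrib sum_distrib_left lorentz_simps distrib_left)
  also have "(\<Sum>i\<in>UNIV. lorentz (conormal i y) (pd i Y y)) = vol y * trace_dP Y y"
    by (simp add: conormal_lorentz trace_dP_def sum_distrib_left)
  also have "lorentz (\<Sum>i\<in>UNIV. pd i (conormal i) y) (Y y) = - (real CARD('n) * vol y * lorentz (Y y) (Q y))"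
    unfolding divergence_conormal[OF y tr] lorentz_simps by (simp add: lorentz_commute)
  finally show ?thesis by simp
qed

text \<open>The divergence integrates to zero: \<open>\<rho>\<close> provides compact support in the
  chart, and Y vanishes where the chart meets the boundary. The integral with the derivatives of
  \<open>\<rho>\<close> is nonzero in general and is disposed of only after summing over the
  charts.\<close>

lemma integral_trace_dP:
  assumes S: "openin (top_of_set half_space) S" and K: "compact K" "K \<subseteq> S"
    and tr: "\<And>y. y \<in> S \<Longrightarrow> trace (Gi y ** sff y) = 0"
    and Y: "smooth_on S Y" "\<And>y. y \<in> S \<Longrightarrow> y $ bdry_index = 0 \<Longrightarrow> Y y = 0"
    and \<rho>: "smooth_on S \<rho>" "\<And>y. y \<in> S \<Longrightarrow> y \<notin> K \<Longrightarrow> \<rho> y = 0"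
  shows "(LINT y:S|lborel. \<rho> y * (vol y * trace_dP Y y)) =
    (LINT y:S|lborel. \<rho> y * (real CARD('n) * vol y * lorentz (Y y) (Q y)))
    - (LINT y:S|lborel. \<Sum>i\<in>UNIV. pd i \<rho> y * lorentz (conormal i y) (Y y))"
proof -
  have oK: "open (- K)" using compact_imp_closed[OF K(1)] by auto
  have zero: "pd i f y = 0" if "y \<in> S" "y \<notin> K" "\<And>z. z \<in> S \<Longrightarrow> z \<notin> K \<Longrightarrow> f z = 0" for i y and f :: "real^'n \<Rightarrow> real"
  proof -
    have "deriv_in S f y = (\<lambda>v. 0)"
      by (rule deriv_in_eq_0[OF ft that(1) oK]) (use that in auto)
    then show ?thesis by simp
  qed
  have d\<rho>0: "pd i \<rho> y = 0" if "y \<in> S" "y \<notin> K" for i y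
    by (rule zero[OF that \<rho>(2)])
  have s0: "smooth_on S (\<lambda>z. \<rho> z * lorentz (conormal i z) (Y z))" for i
    by (intro smooth_on_mult smooth_on_lorentz sconormal Y \<rho>)
  have int0: "(LINT y:S|lborel. pd i (\<lambda>z. \<rho> z * lorentz (conormal i z) (Y z)) y) = 0" for i
    by (rule integral_deriv_in_eq_0[OF S K s0]) (use \<rho>(2) Y(2) in \<open>auto simp: lorentz_simps\<close>)
  have i0: "set_integrable lborel S (pd i (\<lambda>z. \<rho> z * lorentz (conormal i z) (Y z)))" for i
    by (rule set_integrable_compact_support[OF S K smooth_on_imp_continuous_on[OF spd[OF s0]]])
      (rule zero, auto simp: \<rho>(2))
  have i1: "set_integrable lborel S (\<lambda>y. \<Sum>i\<in>UNIV. pd i \<rho> y * lorentz (conormal i y) (Y y))"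
    by (rule set_integrable_compact_support[OF S K smooth_on_imp_continuous_on])
      (auto intro!: smooth_on_sum smooth_on_mult smooth_on_lorentz sconormal Y spd \<rho> simp: d\<rho>0)
  have i2: "set_integrable lborel S (\<lambda>y. \<rho> y * (vol y * trace_dP Y y))"
    unfolding trace_dP_def
    by (rule set_integrable_compact_support[OF S K smooth_on_imp_continuous_on])
      (auto intro!: smooth_on_sum smooth_on_mult smooth_on_lorentz svol sGi_nth Y spd sP \<rho>(1) simp: \<rho>(2))
  have i3: "set_integrable lborel S (\<lambda>y. \<rho> y * (real CARD('n) * vol y * lorentz (Y y) (Q y)))"
    by (rule set_integrable_compact_support[OF S K smooth_on_imp_continuous_on])
      (auto intro!: smooth_on_mult smooth_on_const smooth_on_lorentz svol Y sQ \<rho>(1) simp: \<rho>(2))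
  have "0 = (\<Sum>i\<in>UNIV. LINT y:S|lborel. pd i (\<lambda>z. \<rho> z * lorentz (conormal i z) (Y z)) y)"
    by (simp add: int0)
  also have "\<dots> = (LINT y:S|lborel. \<Sum>i\<in>UNIV. pd i (\<lambda>z. \<rho> z * lorentz (conormal i z) (Y z)) y)"
    unfolding set_lebesgue_integral_def scaleR_sum_right
    by (rule Bochner_Integration.integral_sum[symmetric]) (use i0 in \<open>simp add: set_integrable_def\<close>)
  also have "\<dots> = (LINT y:S|lborel. (\<Sum>i\<in>UNIV. pd i \<rho> y * lorentz (conormal i y) (Y y)) +
      (\<rho> y * (vol y * trace_dP Y y) - \<rho> y * (real CARD('n) * vol y * lorentz (Y y) (Q y))))"
    unfolding set_lebesgue_integral_def
    by (intro Bochner_Integration.integral_cong refl)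
      (auto simp: indicator_def divergence_tangential[OF _ tr Y(1) \<rho>(1)] right_diff_distrib)
  also have "\<dots> = (LINT y:S|lborel. \<Sum>i\<in>UNIV. pd i \<rho> y * lorentz (conormal i y) (Y y)) +
      ((LINT y:S|lborel. \<rho> y * (vol y * trace_dP Y y)) -
       (LINT y:S|lborel. \<rho> y * (real CARD('n) * vol y * lorentz (Y y) (Q y))))"
    using i1 i2 i3 by (subst set_integral_add) (auto simp: set_integral_diff)
  finally show ?thesis by simp
qed

section \<open>The shape operator in coordinates\<close>

lemma deriv_P_eq: "y \<in> S \<Longrightarrow> deriv_in S P y u = (\<Sum>k\<in>UNIV. u $ k *\<^sub>R pd k P y)"
  by (rule linear_axis_expansion[OF linear_deriv_in[OF sP]])

lemma lorentz_deriv_P: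
  assumes y: "y \<in> S"
  shows "lorentz (deriv_in S P y u) (deriv_in S P y v) = u \<bullet> (G y *v v)"
proof -
  have 1: "lorentz (deriv_in S P y u) (deriv_in S P y v) = (\<Sum>k\<in>UNIV. u $ k * lorentz (pd k P y) (deriv_in S P y v))"
    by (subst deriv_P_eq[OF y, of u])
      (simp only: bounded_bilinear.sum_left[OF bounded_bilinear_lorentz] bounded_bilinear.scaleR_left[OF bounded_bilinear_lorentz] real_scaleR_def)
  have 2: "lorentz (pd k P y) (deriv_in S P y v) = (G y *v v) $ k" for k
    by (subst deriv_P_eq[OF y, of v]) (simp add: lorentz_simps matrix_vector_mult_def G_nth mult.commute)
  show ?thesis unfolding 1 2 by (simp add: inner_vec_def)
qed

text \<open>Subtracting the tangential frame components produces a normal part, and definiteness of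
  \<open>G\<close> makes it the only one, which resolves the definite description. It differs from v
  by a tangent vector, to which Q is orthogonal.\<close>

lemma lorentz_normal_part:
  assumes y: "y \<in> S"
  shows "lorentz (normal_part (range (deriv_in S P y)) v) (Q y) = lorentz v (Q y)"
proof -
  let ?T = "range (deriv_in S P y)"
  have lin: "linear (deriv_in S P y)" by (rule linear_deriv_in[OF sP y])
  let ?w = "v - deriv_in S P y (\<chi> k. cmp y k v)"
  have "normal_part ?T v = ?w"
    unfolding normal_part_def
  proof (rule the_equality)
    have "lorentz ?w (pd m P y) = 0" for m
    proof -
      have "deriv_in S P y (\<chi> k. cmp y k v) = v - (lorentz v (Q y) *\<^sub>R P y + lorentz v (P y) *\<^sub>R Q y)"
        unfolding eq_diff_eq add.assoc[symmetric]
        by (subst deriv_P_eq[OF y, of "\<chi> k. cmp y k v"])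
          (simp only: vec_lambda_beta frame_decomposition[OF y, symmetric])
      then show ?thesis
        using dP_P[OF y, of m] dPQ[OF y, of "axis m 1"]
        by (simp add: lorentz_simps lorentz_commute[of _ "pd m P y"])
    qed
    then have orth: "lorentz ?w (deriv_in S P y u) = 0" for u
      by (subst deriv_P_eq[OF y, of u]) (simp only: lorentz_simps mult_zero_right scaleR_zero_right sum.neutral_const)
    show "v - ?w \<in> ?T \<and> (\<forall>u\<in>?T. lorentz ?w u = 0)" using orth by auto
    fix w assume w: "v - w \<in> ?T \<and> (\<forall>u\<in>?T. lorentz w u = 0)"
    obtain u where u: "v - w = deriv_in S P y u" using w by blast
    let ?d = "(\<chi> k. cmp y k v) - u"
    have d: "deriv_in S P y ?d = w - ?w"
      using u by (simp add: linear_diff[OF lin] algebra_simps)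
    have "lorentz (w - ?w) (deriv_in S P y ?d) = lorentz w (deriv_in S P y ?d) - lorentz ?w (deriv_in S P y ?d)"
      by (rule bounded_bilinear.diff_left[OF bounded_bilinear_lorentz])
    then have "lorentz (deriv_in S P y ?d) (deriv_in S P y ?d) = 0"
      using w orth unfolding d[symmetric] by simp
    then have "?d = 0"
      using pos[OF y] unfolding lorentz_deriv_P[OF y] positive_definite_def by (metis less_irrefl)
    then show "w = ?w" using d linear_0[OF lin] by simp
  qed
  then show ?thesis by (simp add: lorentz_simps dPQ y)
qed

lemma lorentz_deriv_deriv_P:
  assumes y: "y \<in> S"
  shows "lorentz (deriv_in S (\<lambda>z. deriv_in S P z Z) y Y) (Q y) = Y \<bullet> (sff y *v Z)"
proof -
  have "deriv_in S (\<lambda>z. deriv_in S P z Z) y Y = (\<Sum>i\<in>UNIV. Y $ i *\<^sub>R pd i (\<lambda>z. deriv_in S P z Z) y)"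
    by (rule linear_axis_expansion[OF linear_deriv_in[OF smooth_on_deriv_in[OF ft sP] y]])
  also have "\<dots> = (\<Sum>i\<in>UNIV. Y $ i *\<^sub>R deriv_in S (pd i P) y Z)"
    by (simp add: deriv_in_symmetric[OF ft sP y, of Z])
  also have "\<dots> = (\<Sum>i\<in>UNIV. Y $ i *\<^sub>R (\<Sum>j\<in>UNIV. Z $ j *\<^sub>R pd j (pd i P) y))"
    by (simp add: linear_axis_expansion[OF linear_deriv_in[OF spd[OF sP] y], of _ Z])
  finally show ?thesis
    by (simp add: lorentz_simps inner_vec_def matrix_vector_mult_def sff_def pd_commute[OF sP y] sum_distrib_left mult_ac)
qed

text \<open>By \<open>lorentz_normal_part\<close> and the symmetry of \<open>G\<close> and
  \<open>sff\<close>, the defining identity amounts to \<open>G y ** B = sff y\<close>; definiteness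
  of \<open>G\<close> gives uniqueness.\<close>

lemma shape_eq:
  assumes y: "y \<in> S"
  shows "(THE B. \<forall>Y Z. lorentz (deriv_in S P y (B *v Y)) (deriv_in S P y Z) =
     lorentz (normal_part (range (deriv_in S P y)) (deriv_in S (\<lambda>z. deriv_in S P z Z) y Y)) (Q y)) = Gi y ** sff y"
proof (rule the_equality)
  have tG: "transpose (Gi y) = Gi y" "transpose (sff y) = sff y"
    by (simp_all add: transpose_def vec_eq_iff Gi_sym[OF y] sff_sym[OF y])
  have "(Gi y ** sff y *v Y) \<bullet> (G y *v Z) = Y \<bullet> (sff y *v Z)" for Y Z
  proof -
    have "(Gi y ** sff y *v Y) \<bullet> (G y *v Z) = (Gi y *v (sff y *v Y)) \<bullet> (G y *v Z)"
      by (simp add: matrix_vector_mul_assoc)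
    also have "\<dots> = (sff y *v Y) \<bullet> (Gi y *v (G y *v Z))"
      using dot_lmul_matrix[of "sff y *v Y" "Gi y" "G y *v Z"] tG
      by (metis transpose_matrix_vector)
    also have "Gi y *v (G y *v Z) = Z"
      by (simp add: matrix_vector_mul_assoc matrix_inv_works(1)[OF detG_nz[OF y]])
    also have "(sff y *v Y) \<bullet> Z = Y \<bullet> (sff y *v Z)"
      using dot_lmul_matrix[of Y "sff y" Z] tG by (metis transpose_matrix_vector)
    finally show ?thesis .
  qed
  then show 1: "\<forall>Y Z. lorentz (deriv_in S P y (Gi y ** sff y *v Y)) (deriv_in S P y Z) =
     lorentz (normal_part (range (deriv_in S P y)) (deriv_in S (\<lambda>z. deriv_in S P z Z) y Y)) (Q y)"
    by (simp add: lorentz_normal_part lorentz_deriv_P lorentz_deriv_deriv_P y)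
  fix B assume B: "\<forall>Y Z. lorentz (deriv_in S P y (B *v Y)) (deriv_in S P y Z) =
     lorentz (normal_part (range (deriv_in S P y)) (deriv_in S (\<lambda>z. deriv_in S P z Z) y Y)) (Q y)"
  have "B *v Y = (Gi y ** sff y) *v Y" for Y
  proof -
    let ?d = "B *v Y - (Gi y ** sff y) *v Y"
    have "(B *v Y) \<bullet> (G y *v Z) = ((Gi y ** sff y) *v Y) \<bullet> (G y *v Z)" for Z
      using 1 B lorentz_deriv_P[OF y] by metis
    then have "?d \<bullet> (G y *v ?d) = 0" by (simp add: inner_diff_left)
    then have "?d = 0" using pos[OF y] unfolding positive_definite_def by (metis less_irrefl)
    then show ?thesis by simp
  qed
  then show "B = Gi y ** sff y" by (simp add: matrix_eq)
qed

end

section \<open>The volume density along a variation\<close>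

text \<open>\<open>\<Phi>\<close> is the variation in coordinates. The factor of the admissible
  field is expressed through the field: pairing X = \<phi> q with p gives \<phi> = \<langle>X,
  p\<rangle>, which is smooth because X and p are.\<close>

locale patch_variation = light_cone_patch S P Q
  for S :: "(real^'n::finite) set" and P Q :: "real^'n \<Rightarrow> 'n minkowski" +
  fixes I :: "real set" and \<Phi> :: "real \<times> (real^'n) \<Rightarrow> 'n minkowski"
  assumes I: "open I" "0 \<in> I"
    and s\<Phi>: "smooth_on (I \<times> S) \<Phi>"
    and \<Phi>0: "y \<in> S \<Longrightarrow> \<Phi> (0, y) = P y"
    and pos_t: "t \<in> I \<Longrightarrow> y \<in> S \<Longrightarrow> positive_definite (gram S (\<lambda>y. \<Phi> (t, y)) y)"
    and admissible: "y \<in> S \<Longrightarrow> deriv_in (I \<times> S) \<Phi> (0, y) (1, 0) =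
      lorentz (deriv_in (I \<times> S) \<Phi> (0, y) (1, 0)) (P y) *\<^sub>R Q y"
begin

abbreviation dt :: "(real \<times> (real^'n) \<Rightarrow> 'b::real_normed_vector) \<Rightarrow> real \<times> (real^'n) \<Rightarrow> 'b" where
  "dt f z \<equiv> deriv_in (I \<times> S) f z (1, 0)"

abbreviation dx :: "'n \<Rightarrow> (real \<times> (real^'n) \<Rightarrow> 'b::real_normed_vector) \<Rightarrow> real \<times> (real^'n) \<Rightarrow> 'b" where
  "dx i f z \<equiv> deriv_in (I \<times> S) f z (0, axis i 1)"

lemma ft2: "full_tangent (I \<times> S)"
  by (rule full_tangent_Times[OF full_tangent_open[OF I(1)] ft])

lemma sdt: "smooth_on (I \<times> S) f \<Longrightarrow> smooth_on (I \<times> S) (dt f)"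
  by (rule smooth_on_deriv_in[OF ft2])

lemma sdx: "smooth_on (I \<times> S) f \<Longrightarrow> smooth_on (I \<times> S) (dx i f)"
  by (rule smooth_on_deriv_in[OF ft2])

lemma dt_dx:
  fixes f :: "real \<times> (real^'n) \<Rightarrow> 'b::euclidean_space"
  shows "smooth_on (I \<times> S) f \<Longrightarrow> z \<in> I \<times> S \<Longrightarrow> dt (dx i f) z = dx i (dt f) z"
  by (rule deriv_in_symmetric[OF ft2])

definition H :: "real \<times> (real^'n) \<Rightarrow> real^'n^'n" where
  "H z = (\<chi> i j. lorentz (dx i \<Phi> z) (dx j \<Phi> z))"

lemma sH: "smooth_on (I \<times> S) H"
  unfolding H_def by (intro smooth_on_vec_lambda smooth_on_lorentz sdx s\<Phi>)

lemma dx_slice: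
  fixes f :: "real \<times> (real^'n) \<Rightarrow> 'b::real_normed_vector"
  shows "smooth_on (I \<times> S) f \<Longrightarrow> t \<in> I \<Longrightarrow> y \<in> S \<Longrightarrow> dx i f (t, y) = pd i (\<lambda>y. f (t, y)) y"
  by (rule deriv_in_slice[OF ft, symmetric])

lemma H_eq_gram: "t \<in> I \<Longrightarrow> y \<in> S \<Longrightarrow> H (t, y) = gram S (\<lambda>y. \<Phi> (t, y)) y"
  by (simp add: H_def gram_def dx_slice[OF s\<Phi>])

lemma detH_pos: "z \<in> I \<times> S \<Longrightarrow> det (H z) > 0"
  using positive_definite_det_pos[OF pos_t] by (auto simp: H_eq_gram)

definition vd :: "real \<times> (real^'n) \<Rightarrow> real" where
  "vd z = sqrt (det (H z))"

lemma svd: "smooth_on (I \<times> S) vd"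
  unfolding vd_def by (intro smooth_on_sqrt smooth_on_det sH detH_pos)

lemma has_derivative_dt:
  assumes "smooth_on (I \<times> S) f" "t \<in> I" "y \<in> S"
  shows "((\<lambda>t. f (t, y)) has_vector_derivative dt f (t, y)) (at t)"
  by (rule has_vector_derivative_slice[OF assms(1) I(1) assms(2,3)])

definition X :: "real^'n \<Rightarrow> 'n minkowski" where "X y = dt \<Phi> (0, y)"
definition Y :: "real^'n \<Rightarrow> 'n minkowski" where "Y y = dt (dt \<Phi>) (0, y)"

lemma sX: "smooth_on S X"
  unfolding X_def by (rule smooth_on_slice[OF sdt[OF s\<Phi>] I(2)])

lemma sY: "smooth_on S Y"
  unfolding Y_def by (rule smooth_on_slice[OF sdt[OF sdt[OF s\<Phi>]] I(2)])

abbreviation \<phi> :: "real^'n \<Rightarrow> real" where "\<phi> y \<equiv> lorentz (X y) (P y)"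

lemma s\<phi>: "smooth_on S \<phi>"
  by (rule smooth_on_lorentz[OF sX sP])

lemma pd_X: assumes "y \<in> S" shows "pd i X y = \<phi> y *\<^sub>R pd i Q y + pd i \<phi> y *\<^sub>R Q y"
proof -
  have "pd i X y = pd i (\<lambda>z. \<phi> z *\<^sub>R Q z) y"
    by (rule fun_cong[OF deriv_in_cong[OF assms]]) (use admissible in \<open>simp add: X_def\<close>)
  also have "\<dots> = \<phi> y *\<^sub>R pd i Q y + pd i \<phi> y *\<^sub>R Q y"
    by (rule pd_scaleR[OF s\<phi> sQ assms])
  finally show ?thesis .
qed

lemma H_derivatives:
  assumes z: "z \<in> I \<times> S"
  shows "dt H z $ i $ j = lorentz (dx i \<Phi> z) (dx j (dt \<Phi>) z) + lorentz (dx i (dt \<Phi>) z) (dx j \<Phi> z)"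
    and "dt (dt H) z $ i $ j = lorentz (dx i \<Phi> z) (dx j (dt (dt \<Phi>)) z)
      + 2 * lorentz (dx i (dt \<Phi>) z) (dx j (dt \<Phi>) z) + lorentz (dx i (dt (dt \<Phi>)) z) (dx j \<Phi> z)"
proof -
  have nth: "dt K z $ i $ j = dt (\<lambda>z. K z $ i $ j) z" if "smooth_on (I \<times> S) K" "z \<in> I \<times> S"
    for K :: "real \<times> (real^'n) \<Rightarrow> real^'n^'n" and z
    using deriv_in_vec_nth[OF ft2 smooth_on_vec_nth[OF that(1)] that(2), of i j "(1, 0)"]
      deriv_in_vec_nth[OF ft2 that, of i "(1, 0)"] by simp
  have bil: "dt (\<lambda>z. lorentz (f z) (g z)) z = lorentz (f z) (dt g z) + lorentz (dt f z) (g z)"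
    if "smooth_on (I \<times> S) f" "smooth_on (I \<times> S) g" "z \<in> I \<times> S" for f g :: "real \<times> (real^'n) \<Rightarrow> 'n minkowski" and z
    by (rule deriv_in_lorentz[OF ft2 that])
  have 1: "dt H z $ i $ j = lorentz (dx i \<Phi> z) (dx j (dt \<Phi>) z) + lorentz (dx i (dt \<Phi>) z) (dx j \<Phi> z)"
    if "z \<in> I \<times> S" for z
  proof -
    have "dt H z $ i $ j = dt (\<lambda>z. lorentz (dx i \<Phi> z) (dx j \<Phi> z)) z"
      unfolding nth[OF sH that] by (simp add: H_def)
    then show ?thesis
      by (simp add: bil[OF sdx[OF s\<Phi>] sdx[OF s\<Phi>] that] dt_dx[OF s\<Phi> that])
  qed
  show "dt H z $ i $ j = lorentz (dx i \<Phi> z) (dx j (dt \<Phi>) z) + lorentz (dx i (dt \<Phi>) z) (dx j \<Phi> z)"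
    by (rule 1[OF z])
  have "dt (dt H) z $ i $ j =
      dt (\<lambda>z. lorentz (dx i \<Phi> z) (dx j (dt \<Phi>) z) + lorentz (dx i (dt \<Phi>) z) (dx j \<Phi> z)) z"
    unfolding nth[OF sdt[OF sH] z] by (rule fun_cong[OF deriv_in_cong[OF z 1]])
  also have "\<dots> = dt (\<lambda>z. lorentz (dx i \<Phi> z) (dx j (dt \<Phi>) z)) z + dt (\<lambda>z. lorentz (dx i (dt \<Phi>) z) (dx j \<Phi> z)) z"
    by (intro deriv_in_add ft2 z smooth_on_lorentz sdx sdt s\<Phi>)
  also have "dt (\<lambda>z. lorentz (dx i \<Phi> z) (dx j (dt \<Phi>) z)) z =
      lorentz (dx i \<Phi> z) (dt (dx j (dt \<Phi>)) z) + lorentz (dt (dx i \<Phi>) z) (dx j (dt \<Phi>) z)"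
    by (intro bil sdx sdt s\<Phi> z)
  also have "dt (\<lambda>z. lorentz (dx i (dt \<Phi>) z) (dx j \<Phi> z)) z =
      lorentz (dx i (dt \<Phi>) z) (dt (dx j \<Phi>) z) + lorentz (dt (dx i (dt \<Phi>)) z) (dx j \<Phi> z)"
    by (intro bil sdx sdt s\<Phi> z)
  finally show "dt (dt H) z $ i $ j = lorentz (dx i \<Phi> z) (dx j (dt (dt \<Phi>)) z)
      + 2 * lorentz (dx i (dt \<Phi>) z) (dx j (dt \<Phi>) z) + lorentz (dx i (dt (dt \<Phi>)) z) (dx j \<Phi> z)"
    by (simp add: dt_dx[OF s\<Phi> z] dt_dx[OF sdt[OF s\<Phi>] z])
qed

lemma slices_0:
  assumes y: "y \<in> S"
  shows "dx i \<Phi> (0, y) = pd i P y" "dx i (dt \<Phi>) (0, y) = pd i X y" "dx i (dt (dt \<Phi>)) (0, y) = pd i Y y"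
  using dx_slice[OF s\<Phi> I(2) y] dx_slice[OF sdt[OF s\<Phi>] I(2) y] dx_slice[OF sdt[OF sdt[OF s\<Phi>]] I(2) y]
    deriv_in_cong[OF y, of "\<lambda>y. \<Phi> (0, y)" P] \<Phi>0
  by (simp_all add: X_def[abs_def] Y_def[abs_def])

lemma H_0: "y \<in> S \<Longrightarrow> H (0, y) = G y"
  by (simp add: H_def vec_eq_iff slices_0 G_nth)

text \<open>The derivative of \<open>\<phi>\<close> multiplies Q, which is orthogonal to the
  derivatives of P; the rest is the Weingarten equation, once for each factor of the
  product.\<close>

lemma dt_H_0:
  assumes y: "y \<in> S" shows "dt H (0, y) = (- 2 * \<phi> y) *\<^sub>R sff y"
proof -
  have z: "(0, y) \<in> I \<times> S" using I(2) y by simp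
  have "lorentz (pd i P y) (pd j X y) = - \<phi> y * sff y $ j $ i" for i j
    using dP_dQ[OF y, of i j] dPQ[OF y, of "axis i 1"] by (simp add: pd_X[OF y] lorentz_simps)
  then show ?thesis
    using sff_sym[OF y]
    by (simp add: vec_eq_iff H_derivatives(1)[OF z] slices_0[OF y] lorentz_commute[of "pd _ X y"])
qed

text \<open>The derivatives of Q are orthogonal to P and Q, hence tangential, with components given
  by minus the shape operator. Their products form the third fundamental form.\<close>

lemma dQ_dQ:
  assumes y: "y \<in> S"
  shows "lorentz (pd i Q y) (pd j Q y) = (sff y ** Gi y ** sff y) $ i $ j"
proof -
  have c: "cmp y k (pd i Q y) = - (\<Sum>l\<in>UNIV. Gi y $ k $ l * sff y $ i $ l)" for k
    using dP_dQ[OF y] by (simp add: cmp_def lorentz_commute sum_negf)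
  have "pd i Q y = (\<Sum>k\<in>UNIV. cmp y k (pd i Q y) *\<^sub>R pd k P y)"
    by (subst frame_decomposition[OF y, of "pd i Q y"]) (simp add: dQ_Q dQ_P y)
  then have "lorentz (pd i Q y) (pd j Q y) = lorentz (\<Sum>k\<in>UNIV. cmp y k (pd i Q y) *\<^sub>R pd k P y) (pd j Q y)"
    by (rule arg_cong)
  also have "\<dots> = (\<Sum>k\<in>UNIV. (\<Sum>l\<in>UNIV. Gi y $ k $ l * sff y $ i $ l) * sff y $ k $ j)"
    using sff_sym[OF y, of j] by (simp add: lorentz_simps c dP_dQ[OF y] bounded_bilinear.minus_left[OF bounded_bilinear_lorentz])
  also have "\<dots> = (sff y ** Gi y ** sff y) $ i $ j"
    by (simp add: matrix_matrix_mult_def Gi_sym[OF y] mult.commute)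
  finally show ?thesis .
qed

text \<open>Origin of the coefficient -1: the second derivative of the metric contributes half of 2
  \<phi>^2 tr A^2, the square of the first derivative takes away half of 4 \<phi>^2 tr A^2.\<close>

lemma dt_dt_vd_0:
  assumes y: "y \<in> S" and tr: "trace (Gi y ** sff y) = 0"
  shows "dt (dt vd) (0, y) = vol y * trace_dP Y y
    - vol y * ((\<phi> y)\<^sup>2 * trace ((Gi y ** sff y) ** (Gi y ** sff y)))"
proof -
  have z: "(0, y) \<in> I \<times> S" using I(2) y by simp
  let ?A = "Gi y ** sff y" and ?B = "(\<chi> i j. lorentz (pd j P y) (pd i Y y)) :: real^'n^'n"
  have smult: "M ** (c *\<^sub>R N) = c *\<^sub>R (M ** N)" "(c *\<^sub>R M) ** N = c *\<^sub>R (M ** N)" for c :: real and M N :: "real^'n^'n"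
    by (simp_all add: bounded_bilinear.scaleR_right[OF bounded_bilinear_matrix_mult]
        bounded_bilinear.scaleR_left[OF bounded_bilinear_matrix_mult])
  have trs: "trace (c *\<^sub>R M) = c * trace M" "trace (M + N) = trace M + trace N" for c :: real and M N :: "real^'n^'n"
    by (simp_all add: trace_def sum.distrib sum_distrib_left)
  have A1: "matrix_inv (H (0, y)) ** dt H (0, y) = (- 2 * \<phi> y) *\<^sub>R ?A"
    by (simp add: H_0 y dt_H_0 smult del: scaleR_minus_left)
  \<comment> \<open>The density is stationary at t = 0 at every point of the chart, not only after
    integration.\<close>
  have tr0: "trace (matrix_inv (H (0, y)) ** dt H (0, y)) = 0"
    unfolding A1 trs tr by simp
  have "dt (dt vd) (0, y) = vd (0, y) / 2 * (trace (matrix_inv (H (0, y)) ** dt (dt H) (0, y))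
      - trace ((matrix_inv (H (0, y)) ** dt H (0, y)) ** (matrix_inv (H (0, y)) ** dt H (0, y))))"
    unfolding vd_def
    by (rule deriv_in_deriv_in_sqrt_det[OF ft2 sH detH_pos z tr0])
  also have "trace ((matrix_inv (H (0, y)) ** dt H (0, y)) ** (matrix_inv (H (0, y)) ** dt H (0, y))) =
      4 * (\<phi> y)\<^sup>2 * trace (?A ** ?A)"
    unfolding A1 smult trs by (simp add: power2_eq_square)
  also have "trace (matrix_inv (H (0, y)) ** dt (dt H) (0, y)) = 2 * trace_dP Y y + 2 * (\<phi> y)\<^sup>2 * trace (?A ** ?A)"
  proof -
    \<comment> \<open>The derivatives of \<open>\<phi>\<close> drop out because Q is null and
      orthogonal to its own derivatives.\<close>
    have XX: "lorentz (pd i X y) (pd j X y) = (\<phi> y)\<^sup>2 * (sff y ** Gi y ** sff y) $ i $ j" for i j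
      using dQ_Q[OF y, of j] QQ[OF y]
      by (simp add: pd_X[OF y] lorentz_simps dQ_dQ[OF y] dQ_Q[OF y] lorentz_commute[of "Q y" "pd j Q y"] power2_eq_square)
    have "dt (dt H) (0, y) = ?B + transpose ?B + (2 * (\<phi> y)\<^sup>2) *\<^sub>R (sff y ** Gi y ** sff y)"
      by (simp add: vec_eq_iff H_derivatives(2)[OF z] slices_0[OF y] XX transpose_def lorentz_commute)
    moreover have "trace (Gi y ** ?B) = trace_dP Y y"
      unfolding trace_def trace_dP_def matrix_matrix_mult_def
      by (subst sum.swap) (simp add: Gi_sym[OF y])
    moreover have "trace (Gi y ** transpose ?B) = trace_dP Y y"
      by (simp add: trace_def trace_dP_def matrix_matrix_mult_def transpose_def)
    ultimately show ?thesis
      by (simp add: H_0 y matrix_add_ldistrib trs smult matrix_mul_assoc)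
  qed
  also have "vd (0, y) = vol y" by (simp add: vd_def H_0 y)
  finally show ?thesis by (simp add: field_simps)
qed

end

section \<open>Independence of the chart\<close>

context compatible_atlas begin

lemma differential_chart_inv:
  "y \<in> cimage c \<Longrightarrow> differential c f (chart_inv c y) = deriv_in (cimage c) (f \<circ> chart_inv c) y"
  by (simp add: differential_def)

lemma overlap_open:
  assumes "c \<in> \<A>" "d \<in> \<A>"
  shows "openin M (chart_dom c \<inter> chart_dom d)"
  using chart_dom_open assms by auto

text \<open>The image of U is relatively open in the chart image, so derivatives computed on an
  overlap of charts agree with those on the whole chart.\<close>

lemma at_within_coord_image:
  assumes c: "c \<in> \<A>" and U: "openin M U" "U \<subseteq> chart_dom c" and x: "x \<in> U"
  shows "at (coord c x) within coord c ` U = at (coord c x) within cimage c"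
proof -
  obtain W where W: "open W" "coord c ` U = half_space \<inter> W"
    using openin_coord_image[OF c U] by (auto simp: openin_open)
  have "cimage c \<inter> W \<subseteq> coord c ` U"
    using openin_imp_subset[OF cimage_open[OF c]] W(2) by auto
  moreover have "coord c ` U \<subseteq> cimage c" using U(2) by auto
  then have "coord c ` U \<subseteq> cimage c \<inter> W" using W(2) by blast
  ultimately have "cimage c \<inter> W = coord c ` U" by blast
  moreover have "coord c ` U \<inter> W = coord c ` U" using W(2) by auto
  ultimately show ?thesis
    using W x by (intro at_within_nhd[of _ W]) auto
qed

lemma transition_smooth:
  assumes "c \<in> \<A>" "d \<in> \<A>"
  shows "smooth_on (coord c ` (chart_dom c \<inter> chart_dom d)) (coord d \<circ> chart_inv c)"
  by (rule coord_smooth[OF assms(2,1)])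

lemma transition_has_derivative:
  assumes c: "c \<in> \<A>" and d: "d \<in> \<A>" and x: "x \<in> chart_dom c \<inter> chart_dom d"
  shows "((coord d \<circ> chart_inv c) has_derivative (\<lambda>v. transition_matrix c d x *v v))
    (at (coord c x) within coord c ` (chart_dom c \<inter> chart_dom d))"
proof -
  let ?S = "coord c ` (chart_dom c \<inter> chart_dom d)"
  have w: "at (coord c x) within ?S = at (coord c x) within cimage c"
    by (rule at_within_coord_image[OF c overlap_open[OF c d] _ x]) simp
  have h: "((coord d \<circ> chart_inv c) has_derivative deriv_in ?S (coord d \<circ> chart_inv c) (coord c x)) (at (coord c x) within ?S)"
    by (rule smooth_on_has_derivative[OF transition_smooth[OF c d]]) (use x in auto)
  have "deriv_in ?S (coord d \<circ> chart_inv c) (coord c x) = (\<lambda>v. transition_matrix c d x *v v)"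
    unfolding transition_matrix_def differential_def w[symmetric]
    by (simp add: matrix_vector_mul(2)[OF has_derivative_linear[OF h]])
  then show ?thesis using h by simp
qed

text \<open>Chain rule for the transition map, carried out on the overlap, where both coordinate
  expressions are available.\<close>

lemma differential_change:
  assumes c: "c \<in> \<A>" and d: "d \<in> \<A>" and f: "smooth_map_on \<A> (topspace M) f"
    and x: "x \<in> chart_dom c \<inter> chart_dom d"
  shows "differential c f x v = differential d f x (transition_matrix c d x *v v)"
proof -
  let ?S = "coord c ` (chart_dom c \<inter> chart_dom d)" and ?\<tau> = "coord d \<circ> chart_inv c"
  have oS: "openin (top_of_set half_space) ?S"
    by (rule openin_coord_image[OF c overlap_open[OF c d]]) simp
  have xS: "coord c x \<in> ?S" using x by blast
  have w: "at (coord c x) within ?S = at (coord c x) within cimage c"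
    by (rule at_within_coord_image[OF c overlap_open[OF c d] _ x]) simp
  have "differential c f x v = deriv_in ?S (f \<circ> chart_inv c) (coord c x) v"
    by (simp add: differential_def w)
  also have "\<dots> = deriv_in ?S (\<lambda>y. (f \<circ> chart_inv d) (?\<tau> y)) (coord c x) v"
    by (rule fun_cong[OF deriv_in_cong[OF xS]]) (use c d in auto)
  also have "\<dots> = deriv_in (cimage d) (f \<circ> chart_inv d) (?\<tau> (coord c x)) (deriv_in ?S ?\<tau> (coord c x) v)"
    by (rule deriv_in_compose[OF full_tangent_half_space[OF oS] smooth_in_chart[OF d f] transition_smooth[OF c d] _ xS])
      (use c in auto)
  also have "deriv_in ?S ?\<tau> (coord c x) v = transition_matrix c d x *v v"
    using deriv_in_eq[OF full_tangent_half_space[OF oS] xS transition_has_derivative[OF c d x]] by simp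
  finally show ?thesis using c x by (simp add: differential_def o_def)
qed

lemma transition_det_pos:
  "c \<in> \<A> \<Longrightarrow> d \<in> \<A> \<Longrightarrow> x \<in> chart_dom c \<inter> chart_dom d \<Longrightarrow> 0 < det (transition_matrix c d x)"
  using oriented by (simp add: oriented_manifold_with_boundary_def)

lemma compact_coord_image:
  assumes c: "c \<in> \<A>" and L: "compactin M L" "L \<subseteq> chart_dom c"
  shows "compact (coord c ` L)"
proof -
  have "compactin (subtopology M (chart_dom c)) L" using L by (simp add: compactin_subtopology)
  then have "compactin (top_of_set (cimage c)) (coord c ` L)"
    using homeomorphic_map_compactness[OF coord_homeomorphic[OF c], of L] topspace_chart[OF c] L(2) by auto
  then show ?thesis by (simp add: compactin_subtopology)
qed

text \<open>Both densities vanish off the compact L, so each integral may be restricted to the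
  overlap. There the change of variables formula applies to the transition map, and orientation
  removes the absolute value from its Jacobian.\<close>

lemma integral_chart_independent:
  assumes c: "c \<in> \<A>" and d: "d \<in> \<A>"
    and L: "compactin M L" "L \<subseteq> chart_dom c \<inter> chart_dom d"
    and cont: "continuous_on (cimage c) (\<lambda>y. \<omega> (chart_inv c y))" "continuous_on (cimage d) (\<lambda>y. \<omega>' (chart_inv d y))"
    and zero: "\<And>x. x \<in> chart_dom c \<Longrightarrow> x \<notin> L \<Longrightarrow> \<omega> x = 0" "\<And>x. x \<in> chart_dom d \<Longrightarrow> x \<notin> L \<Longrightarrow> \<omega>' x = 0"
    and trans: "\<And>x. x \<in> chart_dom c \<inter> chart_dom d \<Longrightarrow> \<omega> x = det (transition_matrix c d x) * \<omega>' x"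
  shows "(LINT y:cimage c|lborel. \<omega> (chart_inv c y)) = (LINT y:cimage d|lborel. \<omega>' (chart_inv d y))"
proof -
  let ?U = "chart_dom c \<inter> chart_dom d" and ?\<tau> = "coord d \<circ> chart_inv c"
  have restrict: "set_integrable lborel (coord e ` ?U) (\<lambda>y. \<theta> (chart_inv e y))"
    "(LINT y:coord e ` ?U|lborel. \<theta> (chart_inv e y)) = (LINT y:cimage e|lborel. \<theta> (chart_inv e y))"
    "coord e ` ?U \<in> sets borel"
    if e: "e \<in> \<A>" "?U \<subseteq> chart_dom e" and \<theta>: "continuous_on (cimage e) (\<lambda>y. \<theta> (chart_inv e y))"
      "\<And>x. x \<in> chart_dom e \<Longrightarrow> x \<notin> L \<Longrightarrow> \<theta> x = 0" for e and \<theta> :: "'m \<Rightarrow> real"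
  proof -
    have o: "openin (top_of_set half_space) (coord e ` ?U)"
      by (rule openin_coord_image[OF e(1) overlap_open[OF c d] e(2)])
    have K: "compact (coord e ` L)" by (rule compact_coord_image[OF e(1) L(1)]) (use L(2) e(2) in auto)
    show "set_integrable lborel (coord e ` ?U) (\<lambda>y. \<theta> (chart_inv e y))"
    proof (rule set_integrable_compact_support[OF o K])
      show "coord e ` L \<subseteq> coord e ` ?U" using L(2) by auto
      show "continuous_on (coord e ` ?U) (\<lambda>y. \<theta> (chart_inv e y))"
        by (rule continuous_on_subset[OF \<theta>(1)]) (use e(2) in auto)
      fix y assume y: "y \<in> coord e ` ?U" "y \<notin> coord e ` L"
      then obtain x where x: "x \<in> ?U" "y = coord e x" by blast
      then have "x \<in> chart_dom e" "x \<notin> L" using y(2) e(2) by blast+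
      then show "\<theta> (chart_inv e y) = 0" using x(2) \<theta>(2) e(1) by simp
    qed
    have "indicator (coord e ` ?U) y *\<^sub>R \<theta> (chart_inv e y) = indicator (cimage e) y *\<^sub>R \<theta> (chart_inv e y)" for y
    proof (cases "y \<in> cimage e \<and> y \<notin> coord e ` ?U")
      case True
      then obtain x where x: "x \<in> chart_dom e" "y = coord e x" by blast
      then have "x \<notin> L" using True L(2) by auto
      then show ?thesis using \<theta>(2)[OF x(1)] x e(1) by simp
    next
      case False
      then have "y \<in> cimage e \<longleftrightarrow> y \<in> coord e ` ?U" using e(2) by auto
      then show ?thesis by (simp add: indicator_def)
    qed
    then show "(LINT y:coord e ` ?U|lborel. \<theta> (chart_inv e y)) = (LINT y:cimage e|lborel. \<theta> (chart_inv e y))"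
      unfolding set_lebesgue_integral_def by presburger
    obtain W where "open W" "coord e ` ?U = half_space \<inter> W" using o by (auto simp: openin_open)
    then show "coord e ` ?U \<in> sets borel"
      using half_space_closed by (auto intro: borel_closed borel_open)
  qed
  note rc = restrict[where e = c and \<theta> = \<omega>, OF c Int_lower1 cont(1) zero(1)]
    and rd = restrict[where e = d and \<theta> = \<omega>', OF d Int_lower2 cont(2) zero(2)]
  have img: "?\<tau> ` (coord c ` ?U) = coord d ` ?U" using c by (force simp: image_image)
  define g' where "g' y = (\<lambda>v. transition_matrix c d (chart_inv c y) *v v)" for y
  have eq: "\<omega> (chart_inv c y) = \<bar>det (matrix (g' y))\<bar> * \<omega>' (chart_inv d (?\<tau> y))" if y: "y \<in> coord c ` ?U" for y
  proof -
    obtain x where x: "x \<in> ?U" "y = coord c x" using y by blast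
    have "matrix (g' y) = transition_matrix c d x" using x c by (simp add: g'_def matrix_of_matrix_vector_mul)
    then show ?thesis using x c d trans[of x] transition_det_pos[OF c d, of x] by simp
  qed
  have "(LINT y:?\<tau> ` (coord c ` ?U)|lborel. \<omega>' (chart_inv d y)) =
      (LINT y:coord c ` ?U|lborel. \<bar>det (matrix (g' y))\<bar> * \<omega>' (chart_inv d (?\<tau> y)))"
  proof (rule set_integral_change_of_variables[OF rc(3)])
    fix y assume "y \<in> coord c ` ?U"
    then obtain x where x: "x \<in> ?U" "y = coord c x" by blast
    then show "(?\<tau> has_derivative g' y) (at y within coord c ` ?U)"
      using transition_has_derivative[OF c d x(1)] c by (simp add: g'_def)
  next
    show "inj_on ?\<tau> (coord c ` ?U)"
      using coord_inj[OF d] c by (auto intro!: inj_onI dest: inj_onD)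
    show "set_integrable lborel (?\<tau> ` coord c ` ?U) (\<lambda>y. \<omega>' (chart_inv d y))"
      unfolding img by (rule rd(1))
    show "set_integrable lborel (coord c ` ?U) (\<lambda>y. \<bar>det (matrix (g' y))\<bar> * \<omega>' (chart_inv d (?\<tau> y)))"
      using rc(1) eq by (simp cong: set_integrable_cong)
  qed
  also have "\<dots> = (LINT y:coord c ` ?U|lborel. \<omega> (chart_inv c y))"
    by (rule set_lebesgue_integral_cong) (use rc(3) eq in auto)
  finally show ?thesis using rc(2) rd(2) unfolding img by simp
qed

lemma support_props:
  assumes M: "compact_space M" and pu: "partition_of_unity M \<A> C \<rho>" and c: "c \<in> C"
  defines "L \<equiv> M closure_of {x \<in> topspace M. \<rho> c x \<noteq> 0}"
  shows "closedin M L" "compactin M L" "L \<subseteq> chart_dom c" "\<And>x. x \<in> topspace M \<Longrightarrow> x \<notin> L \<Longrightarrow> \<rho> c x = 0"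
proof -
  show 1: "closedin M L" by (simp add: L_def)
  show "compactin M L" by (rule closedin_compact_space[OF M 1])
  show "L \<subseteq> chart_dom c" using pu c by (simp add: partition_of_unity_def L_def)
  show "\<rho> c x = 0" if "x \<in> topspace M" "x \<notin> L" for x
    using closure_of_subset[of "{x \<in> topspace M. \<rho> c x \<noteq> 0}" M] that by (auto simp: L_def)
qed

lemma openin_Diff_nbhd:
  assumes c: "c \<in> \<A>" and L: "closedin M L" and x: "x \<in> chart_dom c" "x \<notin> L"
  obtains W where "open W" "coord c x \<in> W" "\<And>y. y \<in> cimage c \<Longrightarrow> y \<in> W \<Longrightarrow> chart_inv c y \<notin> L"
proof -
  have "openin M (chart_dom c - L)" using L chart_dom_open[OF c] by auto
  then have "openin (top_of_set half_space) (coord c ` (chart_dom c - L))"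
    by (rule openin_coord_image[OF c]) auto
  then obtain W where W: "open W" "coord c ` (chart_dom c - L) = half_space \<inter> W" by (auto simp: openin_open)
  show thesis
  proof (rule that[OF W(1)])
    show "coord c x \<in> W" using W(2) x by auto
    fix y assume y: "y \<in> cimage c" "y \<in> W"
    then have "y \<in> coord c ` (chart_dom c - L)"
      using W(2) openin_imp_subset[OF cimage_open[OF c]] by auto
    then show "chart_inv c y \<notin> L" using c by auto
  qed
qed

lemma differential_eq_0:
  assumes c: "c \<in> \<A>" and L: "closedin M L" and x: "x \<in> chart_dom c" "x \<notin> L"
    and f: "\<And>x. x \<in> topspace M \<Longrightarrow> x \<notin> L \<Longrightarrow> f x = 0"
  shows "differential c f x v = 0"
proof -
  obtain W where W: "open W" "coord c x \<in> W" "\<And>y. y \<in> cimage c \<Longrightarrow> y \<in> W \<Longrightarrow> chart_inv c y \<notin> L"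
    using openin_Diff_nbhd[OF c L x] by blast
  have "deriv_in (cimage c) (f \<circ> chart_inv c) (coord c x) = (\<lambda>v. 0)"
  proof (rule deriv_in_eq_0[OF full_tangent_cimage[OF c] _ W(1,2)])
    show "(f \<circ> chart_inv c) y = 0" if "y \<in> cimage c" "y \<in> W" for y
      using f[OF chart_dom_topspace[OF c chart_inv_in[OF that(1)]] W(3)[OF that]] by simp
  qed (use x(1) in auto)
  then show ?thesis by (simp add: differential_def)
qed

text \<open>
  Weak form of the divergence theorem: \<open>u c f\<close> stands for the derivative of \<open>f\<close> along a vector field,
  times the volume form, and the gradients of the partition functions add up to zero.
\<close>

lemma sum_flux_eq_0:
  assumes M: "compact_space M" and pu: "partition_of_unity M \<A> C \<rho>"
    and cont: "\<And>c f. c \<in> \<A> \<Longrightarrow> smooth_map_on \<A> (topspace M) f \<Longrightarrow> continuous_on (cimage c) (\<lambda>y. u c f (chart_inv c y))"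
    and trans: "\<And>c d f x. c \<in> \<A> \<Longrightarrow> d \<in> \<A> \<Longrightarrow> smooth_map_on \<A> (topspace M) f \<Longrightarrow> x \<in> chart_dom c \<inter> chart_dom d \<Longrightarrow>
      u c f x = det (transition_matrix c d x) * u d f x"
    and grad: "\<And>c f x. c \<in> \<A> \<Longrightarrow> x \<in> chart_dom c \<Longrightarrow> (\<And>v. differential c f x v = 0) \<Longrightarrow> u c f x = 0"
    and sum0: "\<And>d x. d \<in> \<A> \<Longrightarrow> x \<in> chart_dom d \<Longrightarrow> (\<Sum>c\<in>C. u d (\<rho> c) x) = (0 :: real)"
  shows "(\<Sum>c\<in>C. LINT y:cimage c|lborel. u c (\<rho> c) (chart_inv c y)) = 0"
proof -
  define L where "L c = M closure_of {x \<in> topspace M. \<rho> c x \<noteq> 0}" for c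
  note sp = support_props[OF M pu, folded L_def]
  have C: "finite C" "C \<subseteq> \<A>" and s\<rho>: "\<And>c. c \<in> C \<Longrightarrow> smooth_map_on \<A> (topspace M) (\<rho> c)"
    and one: "\<And>x. x \<in> topspace M \<Longrightarrow> (\<Sum>c\<in>C. \<rho> c x) = 1"
    using pu by (auto simp: partition_of_unity_def)
  have c\<rho>: "continuous_on (cimage e) (\<lambda>y. \<rho> d (chart_inv e y) * u e (\<rho> c) (chart_inv e y))"
    if "e \<in> \<A>" "c \<in> C" "d \<in> C" for c d e
    using smooth_on_imp_continuous_on[OF smooth_in_chart[OF that(1) s\<rho>[OF that(3)]]] cont[OF that(1) s\<rho>[OF that(2)]]
    by (auto simp: o_def intro: continuous_on_mult)
  have u0: "u e (\<rho> c) x = 0" if "e \<in> \<A>" "c \<in> C" "x \<in> chart_dom e" "x \<notin> L c" for e c x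
    by (rule grad[OF that(1,3)], rule differential_eq_0[OF that(1) sp(1)[OF that(2)] that(3,4)], rule sp(4)[OF that(2)])
  have z: "\<rho> d x * u e (\<rho> c) x = 0" if "e \<in> \<A>" "c \<in> C" "d \<in> C" "x \<in> chart_dom e" "x \<notin> L c \<inter> L d" for c d e x
    using that u0[OF that(1,2,4)] sp(4)[OF that(3), of x] chart_dom_topspace[OF that(1,4)] by auto
  have comp: "compactin M (L c \<inter> L d)" if "c \<in> C" "d \<in> C" for c d
    using closedin_compact_space[OF M] sp(1) that by blast
  have int: "set_integrable lborel (cimage e) (\<lambda>y. \<rho> d (chart_inv e y) * u e (\<rho> c) (chart_inv e y))"
    if "e \<in> \<A>" "c \<in> C" "d \<in> C" "L c \<inter> L d \<subseteq> chart_dom e" for c d e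
  proof (rule set_integrable_compact_support[OF cimage_open[OF that(1)] compact_coord_image[OF that(1) comp[OF that(2,3)] that(4)]])
    show "continuous_on (cimage e) (\<lambda>y. \<rho> d (chart_inv e y) * u e (\<rho> c) (chart_inv e y))" by (rule c\<rho>[OF that(1-3)])
    fix y assume y: "y \<in> cimage e" "y \<notin> coord e ` (L c \<inter> L d)"
    show "\<rho> d (chart_inv e y) * u e (\<rho> c) (chart_inv e y) = 0"
      by (rule z[OF that(1-3) chart_inv_in[OF y(1)]]) (use y(2) imageI[of "chart_inv e y" "L c \<inter> L d" "coord e"] coord_chart_inv[OF y(1)] in auto)
  qed (use that(4) in auto)
  \<comment> \<open>The integrand vanishes off \<open>L c \<inter> L d\<close>, a compact set inside
    both chart domains, so the integral can be moved from chart c to chart d.\<close>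
  have swap: "(LINT y:cimage c|lborel. \<rho> d (chart_inv c y) * u c (\<rho> c) (chart_inv c y)) =
      (LINT y:cimage d|lborel. \<rho> d (chart_inv d y) * u d (\<rho> c) (chart_inv d y))" if cd: "c \<in> C" "d \<in> C" for c d
  proof -
    have A: "c \<in> \<A>" "d \<in> \<A>" using cd C by auto
    show ?thesis
    proof (rule integral_chart_independent[OF A comp[OF cd]])
      show "L c \<inter> L d \<subseteq> chart_dom c \<inter> chart_dom d" using sp(3) cd by blast
      show "\<rho> d x * u c (\<rho> c) x = det (transition_matrix c d x) * (\<rho> d x * u d (\<rho> c) x)" if "x \<in> chart_dom c \<inter> chart_dom d" for x
        using trans[OF A s\<rho>[OF cd(1)] that] by simp
    qed (use c\<rho> z A cd in auto)
  qed
  have split: "(\<Sum>i\<in>C. LINT y:X|lborel. f i y) = (LINT y:X|lborel. \<Sum>i\<in>C. f i y)"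
    if "\<And>i. i \<in> C \<Longrightarrow> set_integrable lborel X (f i)" for X and f :: "('m, 'n) chart \<Rightarrow> real^'n \<Rightarrow> real"
    using that unfolding set_lebesgue_integral_def set_integrable_def scaleR_sum_right
    by (subst Bochner_Integration.integral_sum) auto
  \<comment> \<open>Insert 1 as the sum of the \<open>\<rho> d\<close>, move every term to the chart
    d, and there sum over c first, which gives zero by \<open>sum0\<close>.\<close>
  have "(\<Sum>c\<in>C. LINT y:cimage c|lborel. u c (\<rho> c) (chart_inv c y)) =
      (\<Sum>c\<in>C. \<Sum>d\<in>C. LINT y:cimage c|lborel. \<rho> d (chart_inv c y) * u c (\<rho> c) (chart_inv c y))"
  proof (rule sum.cong[OF refl])
    fix c assume c: "c \<in> C"
    have A: "c \<in> \<A>" using c C by auto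
    have "(\<Sum>d\<in>C. LINT y:cimage c|lborel. \<rho> d (chart_inv c y) * u c (\<rho> c) (chart_inv c y)) =
        (LINT y:cimage c|lborel. \<Sum>d\<in>C. \<rho> d (chart_inv c y) * u c (\<rho> c) (chart_inv c y))"
      by (rule split) (use int[OF A c] sp(3)[OF c] in auto)
    also have "\<dots> = (LINT y:cimage c|lborel. u c (\<rho> c) (chart_inv c y))"
      unfolding set_lebesgue_integral_def
      by (intro Bochner_Integration.integral_cong refl)
        (auto simp: indicator_def sum_distrib_right[symmetric] one chart_dom_topspace[OF A chart_inv_in])
    finally show "(LINT y:cimage c|lborel. u c (\<rho> c) (chart_inv c y)) =
      (\<Sum>d\<in>C. LINT y:cimage c|lborel. \<rho> d (chart_inv c y) * u c (\<rho> c) (chart_inv c y))" ..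
  qed
  also have "\<dots> = (\<Sum>d\<in>C. \<Sum>c\<in>C. LINT y:cimage d|lborel. \<rho> d (chart_inv d y) * u d (\<rho> c) (chart_inv d y))"
    by (subst sum.swap) (simp add: swap)
  also have "\<dots> = (\<Sum>d\<in>C. 0)"
  proof (rule sum.cong[OF refl])
    fix d assume d: "d \<in> C"
    have A: "d \<in> \<A>" using d C by auto
    have "(\<Sum>c\<in>C. LINT y:cimage d|lborel. \<rho> d (chart_inv d y) * u d (\<rho> c) (chart_inv d y)) =
        (LINT y:cimage d|lborel. \<Sum>c\<in>C. \<rho> d (chart_inv d y) * u d (\<rho> c) (chart_inv d y))"
      by (rule split) (use int[OF A _ d] sp(3)[OF d] in auto)
    also have "\<dots> = (LINT y:cimage d|lborel. 0)"
      unfolding set_lebesgue_integral_def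
      by (intro Bochner_Integration.integral_cong refl)
        (auto simp: indicator_def sum_distrib_left[symmetric] sum0[OF A chart_inv_in])
    finally show "(\<Sum>c\<in>C. LINT y:cimage d|lborel. \<rho> d (chart_inv d y) * u d (\<rho> c) (chart_inv d y)) = 0"
      by (simp add: set_lebesgue_integral_def)
  qed
  finally show ?thesis by simp
qed

end

section \<open>Second variation of the volume\<close>

text \<open>For covectors r and b the contraction with the inverse metric does not depend on the
  coordinates, while the root of the determinant gains the factor det T. The flux density thus
  transforms like the coefficient of an n-form.\<close>

lemma conormal_flux_transform:
  fixes T G G' :: "real^'n::finite^'n"
  assumes G: "G = transpose T ** G' ** T" and T: "det T > 0" and G': "det G' > 0"
  shows "sqrt (det G) * ((transpose T *v r) \<bullet> (matrix_inv G *v (transpose T *v b))) =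
    det T * (sqrt (det G') * (r \<bullet> (matrix_inv G' *v b)))"
proof -
  have dG: "det G = (det T)\<^sup>2 * det G'"
    by (simp add: G det_mul power2_eq_square)
  then have nz: "det G \<noteq> 0" using T G' by simp
  let ?u = "matrix_inv G' *v b" and ?Ti = "matrix_inv T"
  have T': "T *v (?Ti *v v) = v" for v
    using matrix_inv_works(2)[of T] T by (simp add: matrix_vector_mul_assoc)
  have "G *v (?Ti *v ?u) = transpose T *v (G' *v (T *v (?Ti *v ?u)))"
    by (simp add: G matrix_vector_mul_assoc matrix_mul_assoc)
  also have "\<dots> = transpose T *v b"
    unfolding T' using matrix_inv_works(2)[of G'] G' by (simp add: matrix_vector_mul_assoc)
  finally have "transpose T *v b = G *v (?Ti *v ?u)" ..
  then have "matrix_inv G *v (transpose T *v b) = ?Ti *v ?u"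
    using matrix_inv_works(1)[OF nz] by (simp add: matrix_vector_mul_assoc matrix_mul_assoc)
  moreover have "(transpose T *v r) \<bullet> (?Ti *v ?u) = r \<bullet> ?u"
    using dot_lmul_matrix[of r T "?Ti *v ?u"] by (simp add: T')
  moreover have "sqrt (det G) = det T * sqrt (det G')"
    using T by (simp add: dG real_sqrt_mult)
  ultimately show ?thesis by simp
qed

locale admissible_variation = compatible_atlas M \<A>
  for M :: "'m topology" and \<A> :: "('m, 'n::finite) chart set" +
  fixes g :: "('m, 'n) metric" and p q :: "'m \<Rightarrow> 'n minkowski"
    and F :: "real \<Rightarrow> 'm \<Rightarrow> 'n minkowski" and \<epsilon> :: real
  assumes card: "CARD('n) \<ge> 2"
    and compact: "compact_space M"
    and immersion: "light_cone_isometric_immersion M \<A> g p"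
    and dual: "is_dual_map M \<A> p q"
    and variation: "variation M \<A> p \<epsilon> F"
    and fixed: "fixed_boundary \<A> p \<epsilon> F"
    and admissible: "admissible M q F"
    and flat: "\<forall>c\<in>\<A>. \<forall>x\<in>chart_dom c. scalar_curvature g c x = 0"
begin

abbreviation I :: "real set" where "I \<equiv> {-\<epsilon><..<\<epsilon>}"

lemma zero_in_I: "0 \<in> I"
  using variation by (simp add: variation_def)

lemma smooth_p: "smooth_map_on \<A> (topspace M) p"
  using immersion by (simp add: light_cone_isometric_immersion_def smooth_immersion_def)

lemma smooth_q: "smooth_map_on \<A> (topspace M) q"
  using dual by (simp add: is_dual_map_def)

lemma gram_eq: "y \<in> cimage c \<Longrightarrow> gram (cimage c) (f \<circ> chart_inv c) y = induced_metric f c (chart_inv c y)"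
  by (simp add: gram_def induced_metric_def differential_chart_inv)

lemma metric_t: "t \<in> I \<Longrightarrow> riemannian_metric \<A> (induced_metric (F t))"
  using variation by (simp add: variation_def spacelike_immersion_def)

lemma pos_t: "t \<in> I \<Longrightarrow> c \<in> \<A> \<Longrightarrow> x \<in> chart_dom c \<Longrightarrow> positive_definite (induced_metric (F t) c x)"
  using metric_t[of t] unfolding riemannian_metric_def by blast

lemma F_0: "x \<in> topspace M \<Longrightarrow> F 0 x = p x"
  using variation by (simp add: variation_def)

text \<open>Carries definiteness and the transformation law over from the induced metrics to
  \<open>g\<close>.\<close>

lemma induced_metric_0: "c \<in> \<A> \<Longrightarrow> x \<in> chart_dom c \<Longrightarrow> induced_metric (F 0) c x = g c x"
proof -
  assume c: "c \<in> \<A>" and x: "x \<in> chart_dom c"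
  have "differential c (F 0) x = differential c p x"
    unfolding differential_def
    by (rule deriv_in_cong) (use x c F_0 chart_dom_topspace[OF c chart_inv_in] in auto)
  then have "induced_metric (F 0) c x = induced_metric p c x"
    by (simp add: induced_metric_def)
  then show ?thesis
    using immersion c x by (simp add: light_cone_isometric_immersion_def)
qed

lemma gram_p: "c \<in> \<A> \<Longrightarrow> y \<in> cimage c \<Longrightarrow> gram (cimage c) (p \<circ> chart_inv c) y = g c (chart_inv c y)"
  using immersion chart_inv_in[of y c] gram_eq[of y c p] unfolding light_cone_isometric_immersion_def by metis

abbreviation \<Phi> :: "('m, 'n) chart \<Rightarrow> real \<times> (real^'n) \<Rightarrow> 'n minkowski" where
  "\<Phi> c \<equiv> \<lambda>(t, y). F t (chart_inv c y)"

lemma smooth_\<Phi>: "c \<in> \<A> \<Longrightarrow> smooth_on (I \<times> cimage c) (\<Phi> c)"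
  using variation by (simp add: variation_def)

lemma extended_variational_field_eq:
  assumes "c \<in> \<A>" "t \<in> I" "y \<in> cimage c"
  shows "extended_variational_field F t (chart_inv c y) = deriv_in (I \<times> cimage c) (\<Phi> c) (t, y) (1, 0)"
  using vector_derivative_at[OF has_vector_derivative_slice[OF smooth_\<Phi>[OF assms(1)] _ assms(2,3)]]
  by (simp add: extended_variational_field_def)

lemma patch:
  assumes c: "c \<in> \<A>"
  shows "patch_variation (cimage c) (p \<circ> chart_inv c) (q \<circ> chart_inv c) I (\<Phi> c)"
proof
  show "full_tangent (cimage c)" by (rule full_tangent_cimage[OF c])
  show "smooth_on (cimage c) (p \<circ> chart_inv c)" by (rule smooth_in_chart[OF c smooth_p])
  show "smooth_on (cimage c) (q \<circ> chart_inv c)" by (rule smooth_in_chart[OF c smooth_q])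
  show "open I" by simp
  show "0 \<in> I" by (rule zero_in_I)
  show "smooth_on (I \<times> cimage c) (\<Phi> c)" by (rule smooth_\<Phi>[OF c])
  fix y assume y: "y \<in> cimage c"
  have x: "chart_inv c y \<in> chart_dom c" "chart_inv c y \<in> topspace M"
    using chart_inv_in[OF y] chart_dom_topspace[OF c] by auto
  show "lorentz ((p \<circ> chart_inv c) y) ((p \<circ> chart_inv c) y) = 0"
    using immersion x(2) by (auto simp: light_cone_isometric_immersion_def light_cone_def)
  show "lorentz ((q \<circ> chart_inv c) y) ((q \<circ> chart_inv c) y) = 0"
    using dual x(2) by (auto simp: is_dual_map_def light_cone_def)
  show pq: "lorentz ((p \<circ> chart_inv c) y) ((q \<circ> chart_inv c) y) = 1"
    using dual x(2) by (auto simp: is_dual_map_def)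
  show "lorentz (deriv_in (cimage c) (p \<circ> chart_inv c) y v) ((q \<circ> chart_inv c) y) = 0" for v
    using dual c x(1) unfolding differential_chart_inv[OF y, symmetric] o_apply is_dual_map_def by blast
  show "positive_definite (gram (cimage c) (p \<circ> chart_inv c) y)"
    using pos_t[OF zero_in_I c x(1)] by (simp add: gram_p[OF c y] induced_metric_0[OF c x(1)])
  show "\<Phi> c (0, y) = (p \<circ> chart_inv c) y" using F_0[OF x(2)] by simp
  show "positive_definite (gram (cimage c) (\<lambda>y. \<Phi> c (t, y)) y)" if "t \<in> I" for t
    using pos_t[OF that c x(1)] gram_eq[OF y, of "F t"] by (simp add: o_def)
  obtain \<phi> where \<phi>: "variational_field F (chart_inv c y) = \<phi> *\<^sub>R q (chart_inv c y)"
    using admissible x(2) by (auto simp: admissible_def)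
  then have X: "deriv_in (I \<times> cimage c) (\<Phi> c) (0, y) (1, 0) = \<phi> *\<^sub>R q (chart_inv c y)"
    using extended_variational_field_eq[OF c zero_in_I y] by (simp add: variational_field_def)
  have "lorentz (\<phi> *\<^sub>R q (chart_inv c y)) (p (chart_inv c y)) = \<phi>"
    using pq by (simp add: lorentz_simps lorentz_commute)
  then show "deriv_in (I \<times> cimage c) (\<Phi> c) (0, y) (1, 0) =
      lorentz (deriv_in (I \<times> cimage c) (\<Phi> c) (0, y) (1, 0)) ((p \<circ> chart_inv c) y) *\<^sub>R (q \<circ> chart_inv c) y"
    unfolding X by simp
qed

text \<open>Coefficient of \<langle>grad f, Y\<rangle> dV in the chart c, with Y the tangential part
  of the acceleration: the error term that a cut-off by f causes.\<close>

definition flux :: "('m, 'n) chart \<Rightarrow> ('m \<Rightarrow> real) \<Rightarrow> 'm \<Rightarrow> real" where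
  "flux c f x = sqrt (det (g c x)) * ((\<chi> i. differential c f x (axis i 1)) \<bullet>
     (matrix_inv (g c x) *v (\<chi> j. lorentz (differential c p x (axis j 1)) (acceleration_field F x))))"

definition second_variation_form :: "('m, 'n) chart \<Rightarrow> 'm \<Rightarrow> real" where
  "second_variation_form c x =
     (- (lorentz (variational_field F x) (p x))\<^sup>2 * trace (shape_operator p q c x ** shape_operator p q c x)
        + real CARD('n) * lorentz (acceleration_field F x) (q x)) * volume_form (induced_metric (F 0)) c x"

text \<open>Translates the notions of the theorem into those of \<open>patch_variation\<close>; the
  facts are proved together because they share one interpretation of the locale.\<close>

lemma
  assumes c: "c \<in> \<A>"
  defines "S \<equiv> cimage c" and "P \<equiv> p \<circ> chart_inv c" and "q' \<equiv> q \<circ> chart_inv c"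
  defines "Y \<equiv> patch_variation.Y S I (\<Phi> c)"
  shows trace_eq_0: "\<And>y. y \<in> S \<Longrightarrow> trace (matrix_inv (gram S P y) ** light_cone_patch.sff S P q' y) = 0"
    and acceleration_field_eq: "\<And>y. y \<in> S \<Longrightarrow> acceleration_field F (chart_inv c y) = Y y"
    and acceleration_boundary: "\<And>y. y \<in> S \<Longrightarrow> y $ bdry_index = 0 \<Longrightarrow> Y y = 0"
    and flux_eq: "\<And>y f. y \<in> S \<Longrightarrow> flux c f (chart_inv c y) =
      (\<Sum>i\<in>UNIV. deriv_in S (f \<circ> chart_inv c) y (axis i 1) * lorentz (light_cone_patch.conormal S P i y) (Y y))"
    and volume_form_eq: "\<And>t y. t \<in> I \<Longrightarrow> y \<in> S \<Longrightarrow>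
      volume_form (induced_metric (F t)) c (chart_inv c y) = patch_variation.vd S I (\<Phi> c) (t, y)"
    and second_variation_form_eq: "\<And>y. y \<in> S \<Longrightarrow> second_variation_form c (chart_inv c y) =
      (deriv_in (I \<times> S) (\<lambda>z. deriv_in (I \<times> S) (patch_variation.vd S I (\<Phi> c)) z (1, 0)) (0, y) (1, 0)
        - sqrt (det (gram S P y)) * light_cone_patch.trace_dP S P Y y)
      + real CARD('n) * sqrt (det (gram S P y)) * lorentz (Y y) (q' y)"
proof -
  interpret patch_variation S P q' I "\<Phi> c"
    unfolding S_def P_def q'_def by (rule patch[OF c])
  have Gg: "G y = g c (chart_inv c y)" if "y \<in> S" for y
    using gram_p[OF c] that unfolding S_def P_def by simp
  have x: "chart_inv c y \<in> chart_dom c" "coord c (chart_inv c y) = y" if "y \<in> S" for y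
    using chart_inv_in[OF that[unfolded S_def]] coord_chart_inv[OF that[unfolded S_def]] by simp_all
  have partial: "partial c i f (chart_inv c y) = pd i (\<lambda>z. h z) y"
    if "y \<in> S" "\<And>z. z \<in> S \<Longrightarrow> f (chart_inv c z) = h z" for i f h y
    unfolding partial_def differential_def x(2)[OF that(1)] S_def[symmetric]
    by (rule fun_cong[OF deriv_in_cong[OF that(1)]]) (simp add: that(2))
  have chr: "christoffel g c k i j (chart_inv c y) = chr k i j y" if "y \<in> S" for k i j y
    unfolding christoffel_def chr_def
    by (simp add: Gg[OF that] partial[OF that, of _ "\<lambda>z. G z $ a $ b" for a b] Gg)
  have riem: "riemann g c l i j k (chart_inv c y) = riem l i j k y" if "y \<in> S" for l i j k y
  proof -
    have "partial c i (christoffel g c l j k) (chart_inv c y) = pd i (chr l j k) y" for l i j k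
      by (rule partial[OF that]) (rule chr)
    then show ?thesis
      unfolding riemann_def riem_def by (simp add: chr that)
  qed
  show tr: "trace (Gi y ** sff y) = 0" if y: "y \<in> S" for y
  proof -
    have "scal y = scalar_curvature g c (chart_inv c y)"
      by (simp add: scal_def scalar_curvature_def ricci_def riem Gg y)
    then have "(2 - 2 * real CARD('n)) * trace (Gi y ** sff y) = 0"
      using flat c x(1)[OF y] scal_eq[OF y] by simp
    \<comment> \<open>For n \<ge> 2 the factor 2 - 2 n is nonzero.\<close>
    then show ?thesis using card by simp
  qed
  show acc: "acceleration_field F (chart_inv c y) = Y y" if y: "y \<in> S" for y
  proof -
    have d: "((\<lambda>t. dt (\<Phi> c) (t, y)) has_vector_derivative patch_variation.Y S I (\<Phi> c) y) (at 0)"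
      unfolding Y_def by (rule has_derivative_dt[OF sdt[OF s\<Phi>] zero_in_I y])
    have "((\<lambda>t. extended_variational_field F t (chart_inv c y)) has_vector_derivative patch_variation.Y S I (\<Phi> c) y) (at 0)"
      by (rule has_vector_derivative_transform_within_open[OF d _ zero_in_I])
        (use y extended_variational_field_eq[OF c] in \<open>auto simp: S_def\<close>)
    then show ?thesis
      unfolding acceleration_field_def assms(5) by (rule vector_derivative_at)
  qed
  show "Y y = 0" if y: "y \<in> S" "y $ bdry_index = 0" for y
  proof -
    have "chart_inv c y \<in> manifold_boundary \<A>"
      using c x[OF y(1)] y(2) by (auto simp: manifold_boundary_def)
    \<comment> \<open>At a boundary point the variation is constant in t on all of \<open>I\<close>,
      so its first and second time derivatives vanish.\<close>
    then have const: "\<Phi> c (t, y) = p (chart_inv c y)" if "t \<in> I" for t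
      using fixed that by (auto simp: fixed_boundary_def)
    have "dt (\<Phi> c) (t, y) = 0" if t: "t \<in> I" for t
    proof (rule vector_derivative_unique_at[OF has_derivative_dt[OF s\<Phi> t y(1)]])
      show "((\<lambda>t. \<Phi> c (t, y)) has_vector_derivative 0) (at t)"
        by (rule has_vector_derivative_transform_within_open[OF has_vector_derivative_const _ t]) (use const in auto)
    qed
    then have "((\<lambda>t. dt (\<Phi> c) (t, y)) has_vector_derivative 0) (at 0)"
      by (intro has_vector_derivative_transform_within_open[OF has_vector_derivative_const _ zero_in_I]) auto
    from vector_derivative_unique_at[OF has_derivative_dt[OF sdt[OF s\<Phi>] zero_in_I y(1)] this]
    show ?thesis unfolding assms(5) patch_variation.Y_def[OF patch_variation_axioms] .
  qed
  show "flux c f (chart_inv c y) = (\<Sum>i\<in>UNIV. pd i (f \<circ> chart_inv c) y * lorentz (conormal i y) (Y y))"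
    if y: "y \<in> S" for y f
    unfolding flux_def acc[OF y] differential_chart_inv[OF y[unfolded S_def]] S_def[symmetric] P_def[symmetric] Gg[OF y, symmetric]
    by (simp add: conormal_lorentz inner_vec_def matrix_vector_mult_def sum_distrib_left mult_ac)
  show vf: "volume_form (induced_metric (F t)) c (chart_inv c y) = vd (t, y)" if "t \<in> I" "y \<in> S" for t y
  proof -
    have "H (t, y) = induced_metric (F t) c (chart_inv c y)"
      using gram_eq[of y c "F t"] H_eq_gram[OF that] that(2) by (simp add: S_def o_def)
    then show ?thesis by (simp add: volume_form_def vd_def)
  qed
  show "second_variation_form c (chart_inv c y) =
      (dt (dt vd) (0, y) - vol y * trace_dP Y y) + real CARD('n) * vol y * lorentz (Y y) (q' y)" if y: "y \<in> S" for y
  proof -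
    have "shape_operator p q c (chart_inv c y) = Gi y ** sff y"
    proof -
      have d: "differential c p (chart_inv c z) = deriv_in S P z" if "z \<in> S" for z
        using differential_chart_inv[of z c p] that by (simp add: S_def P_def)
      have dd: "differential c (\<lambda>y. differential c p y Z) (chart_inv c y) = deriv_in S (\<lambda>z. deriv_in S P z Z) y" for Z
        unfolding differential_def[of c "\<lambda>y. differential c p y Z"] x(2)[OF y] S_def[symmetric]
        by (rule deriv_in_cong[OF y]) (simp add: d)
      show ?thesis
        unfolding shape_operator_def second_fundamental_form_def dd d[OF y]
        using shape_eq[OF y] by (simp add: q'_def)
    qed
    moreover have "volume_form (induced_metric (F 0)) c (chart_inv c y) = vol y"
      unfolding vf[OF zero_in_I y] by (simp add: vd_def H_0 y)
    moreover have "lorentz (variational_field F (chart_inv c y)) (p (chart_inv c y)) = lorentz (X y) (P y)"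
      using extended_variational_field_eq[OF c zero_in_I y[unfolded S_def], folded S_def]
      by (simp add: variational_field_def P_def X_def)
    moreover have "lorentz (acceleration_field F (chart_inv c y)) (q (chart_inv c y)) = lorentz (Y y) (q' y)"
      by (simp add: acc y q'_def)
    ultimately show ?thesis
      using dt_dt_vd_0[OF y tr[OF y]] unfolding second_variation_form_def assms(5)
      by (simp add: algebra_simps)
  qed
qed

lemma metric_change:
  assumes "c \<in> \<A>" "d \<in> \<A>" "x \<in> chart_dom c \<inter> chart_dom d"
  shows "g c x = transpose (transition_matrix c d x) ** g d x ** transition_matrix c d x"
proof -
  have "induced_metric (F 0) c x =
      transpose (transition_matrix c d x) ** induced_metric (F 0) d x ** transition_matrix c d x"
    using metric_t[OF zero_in_I] assms unfolding riemannian_metric_def by blast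
  then show ?thesis using assms by (simp add: induced_metric_0)
qed

lemma metric_det_pos: "c \<in> \<A> \<Longrightarrow> x \<in> chart_dom c \<Longrightarrow> det (g c x) > 0"
  using positive_definite_det_pos[OF pos_t[OF zero_in_I]] by (metis induced_metric_0)

lemma flux_change:
  assumes c: "c \<in> \<A>" and d: "d \<in> \<A>" and f: "smooth_map_on \<A> (topspace M) f"
    and x: "x \<in> chart_dom c \<inter> chart_dom d"
  shows "flux c f x = det (transition_matrix c d x) * flux d f x"
proof -
  let ?T = "transition_matrix c d x"
  have col: "?T *v axis i 1 = (\<Sum>k\<in>UNIV. ?T $ k $ i *\<^sub>R axis k 1)" for i
    unfolding matrix_vector_mult_basis
    by (simp add: vec_eq_iff column_def sum_component axis_def if_distrib cong: if_cong)
  have lin: "linear (differential d h x)" if "smooth_map_on \<A> (topspace M) h" for h :: "'m \<Rightarrow> 'b::real_normed_vector"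
    unfolding differential_def by (rule linear_deriv_in[OF smooth_in_chart[OF d that]]) (use x in auto)
  have change: "differential c h x (axis i 1) = (\<Sum>k\<in>UNIV. ?T $ k $ i *\<^sub>R differential d h x (axis k 1))"
    if h: "smooth_map_on \<A> (topspace M) h" for i and h :: "'m \<Rightarrow> 'b::real_normed_vector"
    unfolding differential_change[OF c d h x] col linear_sum[OF lin[OF h]] linear_cmul[OF lin[OF h]] ..
  have "(\<chi> i. differential c f x (axis i 1)) = transpose ?T *v (\<chi> i. differential d f x (axis i 1))"
    by (simp add: vec_eq_iff matrix_vector_mult_def transpose_def change[OF f])
  moreover have "(\<chi> j. lorentz (differential c p x (axis j 1)) v) =
      transpose ?T *v (\<chi> j. lorentz (differential d p x (axis j 1)) v)" for v
    by (simp add: vec_eq_iff matrix_vector_mult_def transpose_def change[OF smooth_p] lorentz_simps)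
  ultimately show ?thesis
    unfolding flux_def
    using conormal_flux_transform[OF metric_change[OF c d x] transition_det_pos[OF c d x] metric_det_pos[OF d]] x
    by simp
qed

lemma flux_continuous:
  assumes c: "c \<in> \<A>" and f: "smooth_map_on \<A> (topspace M) f"
  shows "continuous_on (cimage c) (\<lambda>y. flux c f (chart_inv c y))"
proof -
  interpret patch_variation "cimage c" "p \<circ> chart_inv c" "q \<circ> chart_inv c" I "\<Phi> c"
    by (rule patch[OF c])
  have "smooth_on (cimage c) (\<lambda>y. \<Sum>i\<in>UNIV. pd i (f \<circ> chart_inv c) y * lorentz (conormal i y) (Y y))"
    by (intro smooth_on_sum smooth_on_mult smooth_on_lorentz spd sconormal sY smooth_in_chart[OF c f])
  then show ?thesis
    by (intro smooth_on_imp_continuous_on) (rule smooth_on_cong, simp_all only: flux_eq[OF c])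
qed

text \<open>The flux is linear in the differential of its function, and the partition functions add
  up to the constant 1, whose differential is zero. This is the last premise of
  \<open>sum_flux_eq_0\<close>.\<close>

lemma sum_flux_partition:
  assumes pu: "partition_of_unity M \<A> C \<rho>"
  shows "(\<Sum>c\<in>C. LINT y:cimage c|lborel. flux c (\<rho> c) (chart_inv c y)) = 0"
proof (rule sum_flux_eq_0[OF compact pu flux_continuous flux_change])
  show "flux c f x = 0" if "\<And>v. differential c f x v = 0" for c f x
    by (simp add: flux_def that zero_vec_def[symmetric])
  have one: "(\<Sum>c\<in>C. \<rho> c x) = 1" if "x \<in> topspace M" for x
    using pu that by (auto simp: partition_of_unity_def)
  fix d x assume d: "d \<in> \<A>" and x: "x \<in> chart_dom d"
  have s: "smooth_on (cimage d) (\<rho> c \<circ> chart_inv d)" if "c \<in> C" for c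
    using pu that smooth_in_chart[OF d] by (auto simp: partition_of_unity_def)
  have xS: "coord d x \<in> cimage d" using x by blast
  have "(\<Sum>c\<in>C. differential d (\<rho> c) x v) = 0" for v
  proof -
    have "(\<Sum>c\<in>C. differential d (\<rho> c) x v) = deriv_in (cimage d) (\<lambda>y. \<Sum>c\<in>C. (\<rho> c \<circ> chart_inv d) y) (coord d x) v"
      unfolding differential_def by (rule deriv_in_sum[OF full_tangent_cimage[OF d] s xS, symmetric])
    also have "\<dots> = deriv_in (cimage d) (\<lambda>y. 1) (coord d x) v"
    proof (rule fun_cong[OF deriv_in_cong[OF xS]])
      fix y assume "y \<in> cimage d"
      then have "chart_inv d y \<in> topspace M" by (intro chart_dom_topspace[OF d] chart_inv_in)
      then show "(\<Sum>c\<in>C. (\<rho> c \<circ> chart_inv d) y) = 1" unfolding o_apply by (rule one)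
    qed
    also have "\<dots> = 0" by (rule deriv_in_const[OF full_tangent_cimage[OF d] xS])
    finally show ?thesis .
  qed
  moreover have "(\<Sum>c\<in>C. flux d (\<rho> c) x) = sqrt (det (g d x)) * ((\<chi> i. \<Sum>c\<in>C. differential d (\<rho> c) x (axis i 1)) \<bullet>
     (matrix_inv (g d x) *v (\<chi> j. lorentz (differential d p x (axis j 1)) (acceleration_field F x))))"
    unfolding flux_def sum_distrib_left[symmetric] inner_sum_left[symmetric]
    by (rule arg_cong[where f = "\<lambda>v. sqrt (det (g d x)) * (v \<bullet> _)"]) (simp add: vec_eq_iff sum_component)
  ultimately show "(\<Sum>c\<in>C. flux d (\<rho> c) x) = 0"
    by (simp add: zero_vec_def[symmetric])
qed

text \<open>Differentiates twice under the integral sign with a weight r supported in the chart.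
  \<open>integral_trace_dP\<close> then trades the divergence part of the second derivative for n
  \<langle>Y, q\<rangle> dV and the flux of r.\<close>

lemma chart_volume_derivatives:
  assumes c: "c \<in> \<A>" and r: "smooth_map_on \<A> (topspace M) r"
    and L: "compactin M L" "L \<subseteq> chart_dom c" "\<And>x. x \<in> topspace M \<Longrightarrow> x \<notin> L \<Longrightarrow> r x = 0"
  shows "\<exists>V'. (\<forall>t\<in>I. ((\<lambda>t. LINT y:cimage c|lborel. r (chart_inv c y) * volume_form (induced_metric (F t)) c (chart_inv c y))
        has_real_derivative V' t) (at t)) \<and>
      (V' has_real_derivative
        (LINT y:cimage c|lborel. r (chart_inv c y) * second_variation_form c (chart_inv c y))
        - (LINT y:cimage c|lborel. flux c r (chart_inv c y))) (at 0)"
proof -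
  let ?S = "cimage c" and ?r = "r \<circ> chart_inv c" and ?K = "coord c ` L"
  interpret patch_variation ?S "p \<circ> chart_inv c" "q \<circ> chart_inv c" I "\<Phi> c"
    by (rule patch[OF c])
  note S = cimage_open[OF c]
  have K: "compact ?K" "?K \<subseteq> ?S" using compact_coord_image[OF c L(1,2)] L(2) by auto
  have r: "smooth_on ?S ?r" by (rule smooth_in_chart[OF c r])
  have r0: "?r y = 0" if "y \<in> ?S" "y \<notin> ?K" for y
  proof -
    have "chart_inv c y \<notin> L" using that coord_chart_inv[OF that(1)] by (metis image_eqI)
    then show ?thesis using L(3) chart_inv_in[OF that(1)] chart_dom_topspace[OF c] by simp
  qed
  have mS: "?S \<in> sets lborel"
  proof -
    obtain W where "open W" "?S = half_space \<inter> W" using S by (auto simp: openin_open)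
    then show ?thesis using half_space_closed by (auto intro: borel_closed borel_open)
  qed
  have cont: "continuous_on (I \<times> ?S) (\<lambda>z. ?r (snd z) * f z)" if "smooth_on (I \<times> ?S) f" for f :: "real \<times> (real^'n) \<Rightarrow> real"
    by (intro continuous_on_mult smooth_on_imp_continuous_on[OF that]
        continuous_on_compose2[OF smooth_on_imp_continuous_on[OF r]] continuous_on_snd continuous_on_id) auto
  have deriv: "((\<lambda>t. LINT y:?S|lborel. ?r y * f (t, y)) has_real_derivative (LINT y:?S|lborel. ?r y * dt f (t, y))) (at t)"
    if f: "smooth_on (I \<times> ?S) f" and t: "t \<in> I" for f :: "real \<times> (real^'n) \<Rightarrow> real" and t
  proof -
    have "((\<lambda>t. f (t, y)) has_real_derivative dt f (t, y)) (at t)" if "t \<in> I" "y \<in> ?S" for t y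
      unfolding has_real_derivative_iff_has_vector_derivative by (rule has_derivative_dt[OF f that])
    then have "((\<lambda>t. LINT y:?S|lborel. ?r (snd (t, y)) * f (t, y)) has_real_derivative
        (LINT y:?S|lborel. ?r (snd (t, y)) * dt f (t, y))) (at t)"
      by (intro has_real_derivative_set_integral[OF S K _ _ cont[OF f] _ cont[OF sdt[OF f]] _ _ t])
        (simp_all only: snd_conv r0 not_False_eq_True DERIV_cmult mult_zero_left open_greaterThanLessThan convex_real_interval)
    then show ?thesis by (simp only: snd_conv)
  qed
  define V' where "V' t = (LINT y:?S|lborel. ?r y * dt vd (t, y))" for t
  have "((\<lambda>t. LINT y:?S|lborel. r (chart_inv c y) * volume_form (induced_metric (F t)) c (chart_inv c y))
        has_real_derivative V' t) (at t)" if t: "t \<in> I" for t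
    unfolding V'_def
    by (rule has_field_derivative_transform_within_open[OF deriv[OF svd t] _ t])
      (auto intro!: set_lebesgue_integral_cong[OF mS] simp: volume_form_eq[OF c] simp del: image_iff)
  moreover have "(V' has_real_derivative
        (LINT y:?S|lborel. r (chart_inv c y) * second_variation_form c (chart_inv c y))
        - (LINT y:?S|lborel. flux c r (chart_inv c y))) (at 0)"
  proof -
    have int: "set_integrable lborel ?S (\<lambda>y. ?r y * f y)" if "smooth_on ?S f" for f
      by (rule set_integrable_compact_support[OF S K smooth_on_imp_continuous_on[OF smooth_on_mult[OF r that]]])
        (simp_all only: r0 not_False_eq_True mult_zero_left)
    have s1: "smooth_on ?S (\<lambda>y. dt (dt vd) (0, y))"
      by (rule smooth_on_slice[OF sdt[OF sdt[OF svd]] zero_in_I])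
    have s2: "smooth_on ?S (\<lambda>y. vol y * trace_dP Y y)"
      unfolding trace_dP_def by (intro smooth_on_mult smooth_on_sum smooth_on_lorentz svol sGi_nth spd sP sY)
    have s3: "smooth_on ?S (\<lambda>y. real CARD('n) * vol y * lorentz (Y y) ((q \<circ> chart_inv c) y))"
      by (intro smooth_on_mult smooth_on_const smooth_on_lorentz svol sQ sY)
    have "(LINT y:?S|lborel. r (chart_inv c y) * second_variation_form c (chart_inv c y)) =
       (LINT y:?S|lborel. (?r y * dt (dt vd) (0, y) - ?r y * (vol y * trace_dP Y y))
         + ?r y * (real CARD('n) * vol y * lorentz (Y y) ((q \<circ> chart_inv c) y)))"
      by (rule set_lebesgue_integral_cong[OF mS])
        (auto simp: second_variation_form_eq[OF c] algebra_simps simp del: image_iff)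
    also have "\<dots> = (LINT y:?S|lborel. ?r y * dt (dt vd) (0, y)) - (LINT y:?S|lborel. ?r y * (vol y * trace_dP Y y))
        + (LINT y:?S|lborel. ?r y * (real CARD('n) * vol y * lorentz (Y y) ((q \<circ> chart_inv c) y)))"
      using int[OF s1] int[OF s2] int[OF s3] by (simp add: set_integral_add set_integral_diff)
    also have "(LINT y:?S|lborel. ?r y * (vol y * trace_dP Y y)) =
        (LINT y:?S|lborel. ?r y * (real CARD('n) * vol y * lorentz (Y y) ((q \<circ> chart_inv c) y)))
        - (LINT y:?S|lborel. \<Sum>i\<in>UNIV. pd i ?r y * lorentz (conormal i y) (Y y))"
      by (rule integral_trace_dP[OF S K trace_eq_0[OF c] sY acceleration_boundary[OF c] r r0])
    also have "(LINT y:?S|lborel. \<Sum>i\<in>UNIV. pd i ?r y * lorentz (conormal i y) (Y y)) =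
        (LINT y:?S|lborel. flux c r (chart_inv c y))"
      by (rule set_lebesgue_integral_cong[OF mS]) (auto simp: flux_eq[OF c] simp del: image_iff)
    finally show ?thesis
      using deriv[OF sdt[OF svd] zero_in_I] unfolding V'_def[symmetric] by simp
  qed
  ultimately show ?thesis by blast
qed

text \<open>One partition serves all times, so the weighted chart volumes are differentiated
  separately and added; their flux terms cancel by \<open>sum_flux_partition\<close>.\<close>

lemma second_variation:
  "has_second_derivative (\<lambda>t. riemannian_volume M \<A> (induced_metric (F t))) (form_integral M \<A> second_variation_form) 0"
proof -
  obtain C \<rho> where pu: "partition_of_unity M \<A> C \<rho>"
    and form: "\<And>\<omega>. form_integral M \<A> \<omega> = (\<Sum>c\<in>C. LINT y:cimage c|lborel. \<rho> c (chart_inv c y) * \<omega> c (chart_inv c y))"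
    using form_integral_partition[OF compact] by blast
  let ?V = "\<lambda>c t. LINT y:cimage c|lborel. \<rho> c (chart_inv c y) * volume_form (induced_metric (F t)) c (chart_inv c y)"
  let ?D = "\<lambda>c. (LINT y:cimage c|lborel. \<rho> c (chart_inv c y) * second_variation_form c (chart_inv c y))
        - (LINT y:cimage c|lborel. flux c (\<rho> c) (chart_inv c y))"
  have ex: "\<forall>c\<in>C. \<exists>V'. (\<forall>t\<in>I. (?V c has_real_derivative V' t) (at t)) \<and> (V' has_real_derivative ?D c) (at 0)"
  proof
    fix c assume c: "c \<in> C"
    have "c \<in> \<A>" "smooth_map_on \<A> (topspace M) (\<rho> c)"
      using pu c by (auto simp: partition_of_unity_def)
    then show "\<exists>V'. (\<forall>t\<in>I. (?V c has_real_derivative V' t) (at t)) \<and> (V' has_real_derivative ?D c) (at 0)"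
      by (rule chart_volume_derivatives[OF _ _ support_props(2-4)[OF compact pu c]])
  qed
  obtain V' where V': "\<forall>c\<in>C. (\<forall>t\<in>I. (?V c has_real_derivative V' c t) (at t)) \<and> (V' c has_real_derivative ?D c) (at 0)"
    using bchoice[OF ex] by (elim exE) (rule that)
  have "((\<lambda>t. \<Sum>c\<in>C. ?V c t) has_real_derivative (\<Sum>c\<in>C. V' c t)) (at t)" if "t \<in> I" for t
    by (rule DERIV_sum) (use V' that in blast)
  moreover have "((\<lambda>t. \<Sum>c\<in>C. V' c t) has_real_derivative (\<Sum>c\<in>C. ?D c)) (at 0)"
    by (rule DERIV_sum) (use V' in blast)
  moreover have "(\<Sum>c\<in>C. ?D c) = form_integral M \<A> second_variation_form"
    using sum_flux_partition[OF pu] by (simp add: sum_subtractf form)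
  moreover have "\<forall>\<^sub>F t in nhds 0. t \<in> I"
    using zero_in_I by (intro eventually_nhds_in_open) auto
  ultimately show ?thesis
    unfolding has_second_derivative_def riemannian_volume_def form
    by (intro exI[of _ "\<lambda>t. \<Sum>c\<in>C. V' c t"]) (auto elim: eventually_mono)
qed

end

theorem proposition2p5:
  fixes M :: "'m topology"
    and \<A> :: "('m, 'n::finite) chart set"
    and g :: "('m, 'n) metric"
    and p q :: "'m \<Rightarrow> 'n minkowski"
    and F :: "real \<Rightarrow> 'm \<Rightarrow> 'n minkowski"
    and \<epsilon> :: real
  assumes "CARD('n) \<ge> 2"
    and "oriented_manifold_with_boundary M \<A>"
    and "compact_space M"
    and "riemannian_metric \<A> g"
    and "conformally_flat M \<A> g"
    and "light_cone_isometric_immersion M \<A> g p"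
    and "is_dual_map M \<A> p q"
    and "variation M \<A> p \<epsilon> F"
    and "fixed_boundary \<A> p \<epsilon> F"
    and "admissible M q F"
    and "\<forall>c\<in>\<A>. \<forall>x\<in>chart_dom c. scalar_curvature g c x = 0"
  shows "has_second_derivative (\<lambda>t. riemannian_volume M \<A> (induced_metric (F t)))
    (form_integral M \<A> (\<lambda>c x.
       (- (lorentz (variational_field F x) (p x))\<^sup>2
            * trace (shape_operator p q c x ** shape_operator p q c x)
        + real CARD('n) * lorentz (acceleration_field F x) (q x))
       * volume_form (induced_metric (F 0)) c x))
    0"
proof -
  interpret admissible_variation M \<A> g p q F \<epsilon>
    by unfold_locales (use assms in simp_all)
  show ?thesis
    using second_variation unfolding second_variation_form_def[abs_def] .
qed

end
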